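(* Let $n\geq 2$ be an integer and let $\{D_n(t):t\geq 0\}$ be the radial component of the $n$-dimensional hyperbolic Brownian motion started at the origin $O_n$ of $\mathbb{H}^n$. Then, as $t\to\infty$, the family of real random variables $\left\{\frac{D_n(t)}{t}:t>0\right\}$ satisfies the large deviation principle on $\mathbb{R}$ with speed $v_t=t$ and good rate function $I_1:\mathbb{R}\to[0,\infty]$ defined by $$I_1(x)=\begin{cases}\frac{(x-(n-1))^2}{4} & \text{if } x\geq 0,\\ \infty & \text{if } x<0.\end{cases}$$
   Context: Hyperbolic space: for an integer $n\geq 2$, $\mathbb{H}^n=\{z=(x,y):x\in\mathbb{R}^{n-1},\,y>0\}$ with origin $O_n=(0,\ldots,0,1)$ and Riemannian metric $ds^2=\frac{dx_1^2+\cdots+dx_{n-1}^2+dy^2}{y^2}$. The hyperbolic distance $\eta(z,z')$ between $z=(x,y)$ and $z'=(x',y')$ is given by $\cosh\eta(z,z')=\frac{|x-x'|^2+y^2+y'^2}{2yy'}$, where $|\cdot|$ is the Euclidean norm on $\mathbb{R}^{n-1}$. The volume element is $dv=y^{-n}\,dx\,dy=\sinh^{n-1}\eta\,d\eta\,d\Omega_n$, where $d\Omega_n$ is the surface element of the unit sphere in $\mathbb{R}^n$. The Laplace-Beltrami operator is $\Delta_n=y^2\left(\sum_{i=1}^{n-1}\frac{\partial^2}{\partial x_i^2}+\frac{\partial^2}{\partial y^2}\right)-(n-2)\,y\frac{\partial}{\partial y}$. Heat kernel: $k_n(z,z',t)$ is the heat kernel, with respect to $dv$, of the equation $\partial_t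 u=\Delta_n u$. It depends on $z,z'$ only through $\eta=\eta(z,z')$ and is written $k_n(\eta,t)$; for instance $k_3(\eta,t)=\frac{e^{-t}}{2^3(\pi t)^{3/2}}\frac{\eta e^{-\eta^2/(4t)}}{\sinh\eta}$. Radial component: the hyperbolic Brownian motion is the diffusion on $\mathbb{H}^n$ with transition density $k_n$ with respect to $dv$, started at $O_n$, and $D_n(t)$ is the hyperbolic distance from $O_n$ to its position at time $t$. Thus $D_n(0)=0$ and, for $t>0$, $D_n(t)$ has density $p_n(\eta,t)=\frac{2\pi^{n/2}}{\Gamma(n/2)}k_n(\eta,t)\sinh^{n-1}\eta$ on $\eta>0$ with respect to Lebesgue measure. Large deviation principle: a rate function on $\mathbb{R}$ is a lower semicontinuous function $I:\mathbb{R}\to[0,\infty]$; it is good if all level sets $\{x:I(x)\leq\gamma\}$, $\gamma\geq 0$, are compact. A family $\{X(t):t>0\}$ of real random variables satisfies the large deviation principle, as $t\to\infty$, with rate function $I$ and speed $v_t$ if $\lim_{t\to\infty}v_t=\infty$, $\limsup_{t\to\infty}\frac{1}{v_t}\log P(X(t)\in F)\leq-\inf_{x\in F}I(x)$ for all closed sets $F\subset\mathbb{R}$, and $\liminf_{t\to\infty}\frac{1}{v_t}\log P(X(t)\in G)\geq-\inf_{x\in G}I(x)$ for all open sets $G\subset\mathbb{R}$ (with $\log 0=-\infty$ and $\inf\emptyset=\infty$). *)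

theory Defs
  imports "HOL-Probability.Probability"
begin

section \<open>The upper half-space model\<close>

text \<open>
  Hyperbolic space of dimension n is carried by the pairs (x, y) with x in a Euclidean space of
  dimension n - 1, which is CARD('m), and y > 0. As CARD('m) is at least 1, this covers exactly
  the dimensions n at least 2.
\<close>

type_synonym 'm hpoint = "(real ^ 'm) \<times> real"

definition hdim :: "'m::finite itself \<Rightarrow> nat" where
  "hdim _ = CARD('m) + 1"

definition hspace :: "'m::finite hpoint set" where
  "hspace = {z. snd z > 0}"

definition horigin :: "'m::finite hpoint" where
  "horigin = (0, 1)"

definition hdist :: "'m::finite hpoint \<Rightarrow> 'm hpoint \<Rightarrow> real" where
  "hdist z w =
     arcosh (((norm (fst z - fst w))\<^sup>2 + (snd z)\<^sup>2 + (snd w)\<^sup>2) / (2 * snd z * snd w))"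

lemma cosh_hdist:
  fixes z w :: "'m::finite hpoint"
  assumes "z \<in> hspace" "w \<in> hspace"
  shows "cosh (hdist z w) =
    ((norm (fst z - fst w))\<^sup>2 + (snd z)\<^sup>2 + (snd w)\<^sup>2) / (2 * snd z * snd w)"
proof -
  have pos: "snd z > 0" "snd w > 0"
    using assms by (auto simp: hspace_def)
  have "0 \<le> (norm (fst z - fst w))\<^sup>2 + (snd z - snd w)\<^sup>2"
    by simp
  then have "2 * snd z * snd w \<le> (norm (fst z - fst w))\<^sup>2 + (snd z)\<^sup>2 + (snd w)\<^sup>2"
    by (simp add: power2_diff)
  then have "1 \<le> ((norm (fst z - fst w))\<^sup>2 + (snd z)\<^sup>2 + (snd w)\<^sup>2) / (2 * snd z * snd w)"
    using pos by (simp add: le_divide_eq)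
  then show ?thesis
    unfolding hdist_def by (rule cosh_arcosh_real)
qed

definition hvolume :: "'m::finite hpoint measure" where
  "hvolume = density (restrict_space lborel hspace)
               (\<lambda>z. ennreal (1 / snd z ^ hdim TYPE('m)))"

definition dir_deriv :: "'a::real_vector \<Rightarrow> ('a \<Rightarrow> real) \<Rightarrow> 'a \<Rightarrow> real" where
  "dir_deriv v f z = deriv (\<lambda>s. f (z + s *\<^sub>R v)) 0"

definition hlaplacian :: "('m::finite hpoint \<Rightarrow> real) \<Rightarrow> 'm hpoint \<Rightarrow> real" where
  "hlaplacian f z =
     (snd z)\<^sup>2 * ((\<Sum>i\<in>UNIV. dir_deriv (axis i 1, 0) (dir_deriv (axis i 1, 0) f) z)
                 + dir_deriv (0, 1) (dir_deriv (0, 1) f) z)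
     - (real (hdim TYPE('m)) - 2) * snd z * dir_deriv (0, 1) f z"


section \<open>The heat kernel\<close>

text \<open>
  Classical solutions on the half-space, for all positive times: once continuously differentiable
  in time and twice in space, with all these derivatives jointly continuous. The elements of
  \<^const>\<open>Basis\<close> are the coordinate directions \<open>(axis i 1, 0)\<close> and \<open>(0, 1)\<close>. Without the
  differentiability clauses \<^const>\<open>deriv\<close> would be an unspecified value.
\<close>

definition heat_solution :: "('m::finite hpoint \<Rightarrow> real \<Rightarrow> real) \<Rightarrow> bool" where
  "heat_solution u \<longleftrightarrow>
     (\<forall>z\<in>hspace. \<forall>t>0. u z differentiable (at t)) \<and>
     continuous_on (hspace \<times> {0<..}) (\<lambda>(z, t). deriv (u z) t) \<and>
     (\<forall>b\<in>Basis.
        (\<forall>z\<in>hspace. \<forall>t>0. (\<lambda>s. u (z + s *\<^sub>R b) t) differentiable (at 0)) \<and>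
        continuous_on (hspace \<times> {0<..}) (\<lambda>(z, t). dir_deriv b (\<lambda>z. u z t) z)) \<and>
     (\<forall>b\<in>Basis. \<forall>c\<in>Basis.
        (\<forall>z\<in>hspace. \<forall>t>0.
           (\<lambda>s. dir_deriv b (\<lambda>z. u z t) (z + s *\<^sub>R c)) differentiable (at 0)) \<and>
        continuous_on (hspace \<times> {0<..})
          (\<lambda>(z, t). dir_deriv c (dir_deriv b (\<lambda>z. u z t)) z)) \<and>
     (\<forall>z\<in>hspace. \<forall>t>0. deriv (u z) t = hlaplacian (\<lambda>z. u z t) z)"

text \<open>
  Non-negative fundamental solutions with pole w: solutions whose initial value, with respect to
  the hyperbolic volume, is the Dirac measure at w.
\<close>

definition fundamental_solution ::
    "'m::finite hpoint \<Rightarrow> ('m hpoint \<Rightarrow> real \<Rightarrow> real) \<Rightarrow> bool" where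
  "fundamental_solution w u \<longleftrightarrow>
     heat_solution u \<and>
     (\<forall>z\<in>hspace. \<forall>t>0. 0 \<le> u z t) \<and>
     (\<forall>f :: 'm hpoint \<Rightarrow> real. continuous_on hspace f \<and> bounded (f ` hspace) \<longrightarrow>
        ((\<lambda>t. LINT z|hvolume. u z t * f z) \<longlongrightarrow> f w) (at_right 0))"

text \<open>
  The heat kernel of a Riemannian manifold is its smallest non-negative fundamental solution; this
  determines \<open>k z w t\<close> for all points z, w of the half-space and all t > 0.
\<close>

definition heat_kernel :: "('m::finite hpoint \<Rightarrow> 'm hpoint \<Rightarrow> real \<Rightarrow> real) \<Rightarrow> bool" where
  "heat_kernel k \<longleftrightarrow>
     (\<forall>w\<in>hspace.
        fundamental_solution w (\<lambda>z. k z w) \<and>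
        (\<forall>u. fundamental_solution w u \<longrightarrow> (\<forall>z\<in>hspace. \<forall>t>0. k z w t \<le> u z t)))"


section \<open>Hyperbolic Brownian motion and its radial component\<close>

definition natural_filtration ::
    "'w measure \<Rightarrow> (real \<Rightarrow> 'w \<Rightarrow> 'b::topological_space) \<Rightarrow> real \<Rightarrow> 'w measure" where
  "natural_filtration M Z s =
     sigma (space M) {Z r -` A \<inter> space M | r A. 0 \<le> r \<and> r \<le> s \<and> A \<in> sets borel}"

text \<open>
  The continuous Markov process on the half-space, started at a, with transition density k with
  respect to the hyperbolic volume. Its generator is the Laplacian itself, without a factor 1/2.
\<close>

definition hyperbolic_brownian_motion ::
    "('m::finite hpoint \<Rightarrow> 'm hpoint \<Rightarrow> real \<Rightarrow> real) \<Rightarrow> 'm hpoint \<Rightarrow> 'w measure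
      \<Rightarrow> (real \<Rightarrow> 'w \<Rightarrow> 'm hpoint) \<Rightarrow> bool" where
  "hyperbolic_brownian_motion k a M Z \<longleftrightarrow>
     heat_kernel k \<and>
     prob_space M \<and>
     (\<forall>t\<ge>0. Z t \<in> borel_measurable M \<and> (\<forall>\<omega>\<in>space M. Z t \<omega> \<in> hspace)) \<and>
     (AE \<omega> in M. Z 0 \<omega> = a) \<and>
     (AE \<omega> in M. continuous_on {0..} (\<lambda>t. Z t \<omega>)) \<and>
     (\<forall>s t. 0 \<le> s \<longrightarrow> s < t \<longrightarrow> (\<forall>A\<in>sets borel.
        AE \<omega> in M. real_cond_exp M (natural_filtration M Z s) (indicator (Z t -` A)) \<omega>
                    = (LINT w:A|hvolume. k (Z s \<omega>) w (t - s))))"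

definition radial_component ::
    "(real \<Rightarrow> 'w \<Rightarrow> 'm::finite hpoint) \<Rightarrow> real \<Rightarrow> 'w \<Rightarrow> real" where
  "radial_component Z t \<omega> = hdist horigin (Z t \<omega>)"


section \<open>Large deviations\<close>

definition rate_function :: "(real \<Rightarrow> ereal) \<Rightarrow> bool" where
  "rate_function I \<longleftrightarrow> (\<forall>x. 0 \<le> I x) \<and> (\<forall>x. I x \<le> Liminf (at x) I)"

definition good_rate_function :: "(real \<Rightarrow> ereal) \<Rightarrow> bool" where
  "good_rate_function I \<longleftrightarrow>
     rate_function I \<and> (\<forall>\<gamma>::real. 0 \<le> \<gamma> \<longrightarrow> compact {x. I x \<le> ereal \<gamma>})"

text \<open>The logarithm with log 0 = -\<infinity>, whereas \<^term>\<open>ln (0::real) = 0\<close>.\<close>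

definition elog :: "real \<Rightarrow> ereal" where
  "elog p = (if p = 0 then -\<infinity> else ereal (ln p))"

definition large_deviation_principle ::
    "'w measure \<Rightarrow> (real \<Rightarrow> 'w \<Rightarrow> real) \<Rightarrow> (real \<Rightarrow> real) \<Rightarrow> (real \<Rightarrow> ereal) \<Rightarrow> bool" where
  "large_deviation_principle M X v I \<longleftrightarrow>
     (\<forall>t>0. X t \<in> borel_measurable M) \<and>
     rate_function I \<and>
     filterlim v at_top at_top \<and>
     (\<forall>F. closed F \<longrightarrow>
        Limsup at_top (\<lambda>t. ereal (1 / v t) * elog (measure M {\<omega> \<in> space M. X t \<omega> \<in> F}))
          \<le> - (INF x\<in>F. I x)) \<and>
     (\<forall>G. open G \<longrightarrow>
        - (INF x\<in>G. I x)
          \<le> Liminf at_top (\<lambda>t. ereal (1 / v t) * elog (measure M {\<omega> \<in> space M. X t \<omega> \<in> G})))"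

definition I1 :: "nat \<Rightarrow> real \<Rightarrow> ereal" where
  "I1 n x = (if x \<ge> 0 then ereal ((x - (real n - 1))\<^sup>2 / 4) else \<infinity>)"

end

theory Submission
  imports Defs "HOL-Real_Asymp.Real_Asymp"
begin

text \<open>
  Write m = n - 1, and c(z) for the hyperbolic cosine of the distance from the origin to z = (x, y).
  The rate function is a Legendre transform of the growth rates of the moments of cosh of the radial
  component, and these growth rates come from functions on which the Laplacian acts almost like a
  multiplication.

  The half-space is a group: the maps z \<mapsto> (x' + y' x, y' y) are isometries and act simply
  transitively (\<open>aff\<close>). Composing the heat kernel with such a map gives again a fundamental solution,
  so minimality makes the kernel invariant, and \<open>k O w t = k (ginv w) O t\<close>, where \<open>ginv w\<close> is the
  inverse in the group (\<open>heat_kernel_ginv\<close>). This is what connects the two roles of the kernel: the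
  law of the motion involves its second argument, the heat equation its first one. The inverse of the
  position at time t has the density K(z) y^m with respect to the hyperbolic volume, where
  K = k(-, O, t) solves the heat equation (\<open>distr_ginv_hyperbolic_brownian_motion\<close>). Inversion keeps
  the distance from the origin and replaces the height y by 1/y, so that the inverted motion serves as
  well as the motion itself.

  Integration by parts against K yields the forward equation of the inverted motion for the test
  functions y^p \<psi>(c), \<psi> being twice continuously differentiable and zero for large arguments
  (\<open>weak_heat_equation\<close>). Its operator maps these functions to functions of y and c alone. The locale
  \<open>radial_diffusion\<close> records this information about Y = y and C = c along the inverted motion, and
  everything else is a consequence of it. Let D be the radial component, C = cosh D.

  First, y^p is an eigenfunction, whence E Y^p = exp((p^2 + m p) t) (\<open>expectation_Y_powr\<close>). Second, on
  y^p c^\<beta> with \<beta> > 0 and p \<ge> - m the operator is at most the eigenvalue of y^(p - \<beta>), up to an error that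
  is small compared with y^p c^\<beta> or bounded by multiples of y^(p + \<beta>) and y^p. So, up to an arbitrarily
  small loss, E (Y^p C^\<beta>) grows at most with the largest of the rates of Y^(p - \<beta>), Y^p and
  Y^(p + \<beta>) (\<open>expectation_Y_C_powr_le\<close>). Now Markov's inequality for
  C^\<beta> bounds P(D \<ge> a t) when a > m; since Y \<le> exp D, Markov's inequality for Y^(-\<tau>) bounds
  P(D \<le> b t) when b < m. For the lower bound the probability is weighted with Y^\<theta>, where
  \<theta> = (x - m) / 2: under this weight D / t and (ln Y) / t converge to x, because the weighted moments
  of Y and C are again of the form just computed. In all three cases the exponent is
  (x - m)^2 / 4.
\<close>

section \<open>Differential inequalities and cutoff functions\<close>

text \<open>
  The third power of the positive part is twice continuously differentiable; it makes the cutoff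
  (1 - c / R)_+^3, with derivatives that are again explicit.
\<close>
lemma has_real_derivative_pos_part_power:
  fixes v :: real
  shows "((\<lambda>v. (max 0 v) ^ (k + 2)) has_real_derivative real (k + 2) * (max 0 v) ^ (k + 1)) (at v)"
proof (cases "v = 0")
  case False
  show ?thesis
  proof (cases "v > 0")
    case True
    have "((\<lambda>v. v ^ (k + 2)) has_real_derivative real (k + 2) * (max 0 v) ^ (k + 1)) (at v)"
      using True DERIV_pow[of "k + 2" v UNIV] by simp
    moreover have "eventually (\<lambda>x. x \<in> {0<..}) (nhds v)"
      by (rule eventually_nhds_in_open) (use True in auto)
    then have "eventually (\<lambda>x. x ^ (k + 2) = (max 0 x) ^ (k + 2)) (nhds v)"
      by eventually_elim auto
    ultimately show ?thesis
      by (subst (asm) DERIV_cong_ev[OF refl _ refl]) auto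
  next
    case f: False
    have "((\<lambda>v. 0) has_real_derivative real (k + 2) * (max 0 v) ^ (k + 1)) (at v)"
      using f by (auto intro!: derivative_eq_intros)
    moreover have "eventually (\<lambda>x. x \<in> {..<0}) (nhds v)"
      by (rule eventually_nhds_in_open) (use f False in auto)
    then have "eventually (\<lambda>x. 0 = (max 0 x) ^ (k + 2)) (nhds v)"
      by eventually_elim auto
    ultimately show ?thesis
      by (subst (asm) DERIV_cong_ev[OF refl _ refl]) auto
  qed
next
  case True
  have "((\<lambda>h. (max 0 h) ^ (k + 2) / h) \<longlongrightarrow> (0::real)) (at 0)"
  proof (rule Lim_null_comparison)
    show "eventually (\<lambda>h. norm ((max 0 h) ^ (k + 2) / h) \<le> \<bar>h\<bar> ^ (k + 1)) (at (0::real))"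
    proof (rule eventuallyI)
      fix h :: real
      show "norm ((max 0 h) ^ (k + 2) / h) \<le> \<bar>h\<bar> ^ (k + 1)"
      proof (cases "h > 0")
        case False
        then have "max 0 h = 0" by simp
        then have "norm ((max 0 h) ^ (k + 2) / h) = 0" by simp
        then show ?thesis by (simp only: zero_le_power[OF abs_ge_zero])
      qed (simp add: power_add power2_eq_square)
    qed
    show "((\<lambda>h::real. \<bar>h\<bar> ^ (k + 1)) \<longlongrightarrow> 0) (at 0)"
      by (auto intro!: tendsto_eq_intros)
  qed
  then show ?thesis
    using True by (simp add: DERIV_def)
qed

text \<open>
  exp (-\<kappa> r) \<phi> r - h r is nonincreasing. The initial value is a limit because the heat equation holds
  at positive times only.
\<close>

lemma gronwall_right:
  fixes \<phi> \<phi>' :: "real \<Rightarrow> real"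
  assumes lim: "(\<phi> \<longlongrightarrow> L) (at_right 0)" and t: "0 < t"
    and der: "\<And>r. 0 < r \<Longrightarrow> (\<phi> has_real_derivative \<phi>' r) (at r)"
    and le: "\<And>r. 0 < r \<Longrightarrow> r \<le> t \<Longrightarrow> \<phi>' r \<le> \<kappa> * \<phi> r + h * exp (\<kappa> * r)"
  shows "\<phi> t \<le> exp (\<kappa> * t) * (L + h * t)"
proof -
  define g where "g r = exp (- \<kappa> * r) * \<phi> r - h * r" for r
  have dg: "(g has_real_derivative exp (- \<kappa> * r) * (\<phi>' r - \<kappa> * \<phi> r) - h) (at r)" if "0 < r" for r
    unfolding g_def using der[OF that] by (auto intro!: derivative_eq_intros simp: algebra_simps)
  have dg0: "exp (- \<kappa> * r) * (\<phi>' r - \<kappa> * \<phi> r) - h \<le> 0" if "0 < r" "r \<le> t" for r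
  proof -
    have "exp (- \<kappa> * r) * (\<phi>' r - \<kappa> * \<phi> r) \<le> exp (- \<kappa> * r) * (h * exp (\<kappa> * r))"
      by (rule mult_left_mono) (use le[OF that] in auto)
    also have "\<dots> = h"
      by (simp add: exp_minus field_simps)
    finally show ?thesis by simp
  qed
  have "g t \<le> g r" if r: "0 < r" "r < t" for r
  proof (rule DERIV_nonpos_imp_nonincreasing[of r t g])
    fix x assume "r \<le> x" "x \<le> t"
    then show "\<exists>y. (g has_real_derivative y) (at x) \<and> y \<le> 0"
      using dg[of x] dg0[of x] r by auto
  qed (use r in auto)
  then have "eventually (\<lambda>r. g t \<le> g r) (at_right 0)"
    using t by (auto simp: eventually_at_right)
  moreover have "(g \<longlongrightarrow> exp (- \<kappa> * 0) * L - h * 0) (at_right 0)"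
    unfolding g_def by (intro tendsto_intros lim)
  ultimately have "g t \<le> L"
    using tendsto_lowerbound[of g L "at_right 0" "g t"] by (simp add: trivial_limit_at_right_real)
  then have "exp (\<kappa> * t) * (exp (- \<kappa> * t) * \<phi> t) \<le> exp (\<kappa> * t) * (L + h * t)"
    by (intro mult_left_mono) (auto simp: g_def)
  then show ?thesis
    by (simp add: exp_minus field_simps)
qed

text \<open>
  The derivatives are parameters, so that the operator below is an explicit expression. The
  conditions concern positive arguments, as these functions are composed with a hyperbolic cosine.
\<close>

definition radial_test :: "real \<Rightarrow> (real \<Rightarrow> real) \<Rightarrow> (real \<Rightarrow> real) \<Rightarrow> (real \<Rightarrow> real) \<Rightarrow> bool" where
  "radial_test R \<psi> \<psi>1 \<psi>2 \<longleftrightarrow>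
     (\<forall>c>0. (\<psi> has_real_derivative \<psi>1 c) (at c)) \<and>
     (\<forall>c>0. (\<psi>1 has_real_derivative \<psi>2 c) (at c)) \<and>
     continuous_on {0<..} \<psi>2 \<and> (\<forall>c\<ge>R. \<psi> c = 0 \<and> \<psi>1 c = 0 \<and> \<psi>2 c = 0)"

text \<open>
  In dimension m + 1, the operator of the inverted Brownian motion is
  y^2 (\<partial>_1^2 + ... + \<partial>_y^2) + (m + 1) y \<partial>_y. This is its value on y^p \<psi>(c), as a function of y
  and c. It follows from y \<partial>_y c = y - c, from y^2 |grad c|^2 = c^2 - 1 and from the fact that the
  hyperbolic Laplacian of c is (m + 1) c.
\<close>

definition radial_gen ::
    "real \<Rightarrow> real \<Rightarrow> (real \<Rightarrow> real) \<Rightarrow> (real \<Rightarrow> real) \<Rightarrow> (real \<Rightarrow> real) \<Rightarrow> real \<Rightarrow> real \<Rightarrow> real" where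
  "radial_gen m p \<psi> \<psi>1 \<psi>2 y c = y powr p *
     ((p\<^sup>2 + m * p) * \<psi> c + \<psi>1 c * ((m + 1) * c + 2 * (m + p) * (y - c)) + \<psi>2 c * (c\<^sup>2 - 1))"

text \<open>
  The quotient of the value of the operator at y^p c^\<beta> by y^p, arranged so that the eigenvalue of
  y^(p - \<beta>) stands in front of c^\<beta>.
\<close>

definition power_gen :: "real \<Rightarrow> real \<Rightarrow> real \<Rightarrow> real \<Rightarrow> real \<Rightarrow> real" where
  "power_gen m p \<beta> y c = ((p - \<beta>)\<^sup>2 + m * (p - \<beta>)) * c powr \<beta>
     + 2 * (m + p) * \<beta> * (y * c powr (\<beta> - 1)) - \<beta> * (\<beta> - 1) * c powr (\<beta> - 2)"

lemma radial_test_cubic: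
  assumes "\<And>c. 0 < c \<Longrightarrow> (f has_real_derivative f1 c) (at c)"
    and "\<And>c. 0 < c \<Longrightarrow> (f1 has_real_derivative f2 c) (at c)"
    and "continuous_on {0<..} f2"
    and "\<And>c. R \<le> c \<Longrightarrow> f c \<le> 0"
  shows "radial_test R (\<lambda>c. (max 0 (f c)) ^ 3) (\<lambda>c. 3 * (max 0 (f c)) ^ 2 * f1 c)
     (\<lambda>c. 6 * max 0 (f c) * (f1 c)\<^sup>2 + 3 * (max 0 (f c)) ^ 2 * f2 c)"
proof -
  have p3: "((\<lambda>v. (max 0 v) ^ 3) has_real_derivative 3 * (max 0 v) ^ 2) (at v)" for v :: real
    using has_real_derivative_pos_part_power[of 1 v] by (simp add: numeral_eq_Suc)
  have p2: "((\<lambda>v. (max 0 v) ^ 2) has_real_derivative 2 * (max 0 v)) (at v)" for v :: real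
    using has_real_derivative_pos_part_power[of 0 v] by (simp add: numeral_eq_Suc)
  have "((\<lambda>c. (max 0 (f c)) ^ 3) has_real_derivative 3 * (max 0 (f c)) ^ 2 * f1 c) (at c)" if "c > 0" for c
    by (rule DERIV_chain2[OF p3 assms(1)[OF that]])
  moreover have "((\<lambda>c. 3 * (max 0 (f c)) ^ 2 * f1 c) has_real_derivative
      6 * max 0 (f c) * (f1 c)\<^sup>2 + 3 * (max 0 (f c)) ^ 2 * f2 c) (at c)" if "c > 0" for c
    using DERIV_mult[OF DERIV_cmult[OF DERIV_chain2[OF p2 assms(1)[OF that]], of 3] assms(2)[OF that]]
    by (simp add: power2_eq_square algebra_simps)
  moreover have "continuous_on {0<..} f" "continuous_on {0<..} f1"
    using assms(1,2) by (auto intro!: continuous_at_imp_continuous_on DERIV_isCont)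
  then have "continuous_on {0<..} (\<lambda>c. 6 * max 0 (f c) * (f1 c)\<^sup>2 + 3 * (max 0 (f c)) ^ 2 * f2 c)"
    by (intro continuous_intros assms(3))
  moreover have "max 0 (f c) = 0" if "R \<le> c" for c
    using assms(4)[OF that] by simp
  ultimately show ?thesis
    unfolding radial_test_def by simp
qed

lemma radial_test_mult:
  assumes "radial_test R \<psi> \<psi>1 \<psi>2"
    and "\<And>c. 0 < c \<Longrightarrow> (f has_real_derivative f1 c) (at c)"
    and "\<And>c. 0 < c \<Longrightarrow> (f1 has_real_derivative f2 c) (at c)"
    and "continuous_on {0<..} f2"
  shows "radial_test R (\<lambda>c. f c * \<psi> c) (\<lambda>c. f c * \<psi>1 c + f1 c * \<psi> c)
     (\<lambda>c. f c * \<psi>2 c + 2 * f1 c * \<psi>1 c + f2 c * \<psi> c)"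
proof -
  note a = assms(1)[unfolded radial_test_def]
  have c: "continuous_on {0<..} f" "continuous_on {0<..} f1" "continuous_on {0<..} \<psi>" "continuous_on {0<..} \<psi>1"
    using assms(2,3) a by (auto intro!: continuous_at_imp_continuous_on DERIV_isCont)
  show ?thesis
    unfolding radial_test_def
    using a assms(2-4) c by (auto intro!: derivative_eq_intros continuous_intros)
qed

lemma cubic_truncation_ge:
  fixes u :: real
  assumes "0 \<le> u" "u \<le> 1"
  shows "3 * (1 - u) * u\<^sup>2 \<le> 1 - u ^ 3"
proof -
  have "0 \<le> (1 - u)\<^sup>2 * (1 + 2 * u)" using assms by simp
  then show ?thesis by (simp add: power2_eq_square power3_eq_cube algebra_simps)
qed

text \<open>
  Each derivative that falls on the cutoff brings a factor 1 / R. Two derivatives on the cutoff come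
  with the coefficient c^2 - 1, but then c \<le> R on the support, so that c^2 / R^2 \<le> c / R. Hence the
  cutoff costs an error of order 1 / R, at the price of one more power of c.
\<close>

lemma radial_gen_cutoff:
  fixes m p \<beta> R :: real
  assumes R: "0 < R" and m: "0 \<le> m"
  defines "\<psi> \<equiv> \<lambda>c. c powr \<beta> * (max 0 (1 - c / R)) ^ 3"
    and "a \<equiv> power_gen m p \<beta>"
  obtains \<psi>1 \<psi>2 where "radial_test R \<psi> \<psi>1 \<psi>2"
    "\<psi> \<in> borel_measurable borel" "\<psi>1 \<in> borel_measurable borel" "\<psi>2 \<in> borel_measurable borel"
    "\<And>y c. 0 < y \<Longrightarrow> y \<le> 2 * c \<Longrightarrow> 1 \<le> c \<Longrightarrow>
       \<bar>radial_gen m p \<psi> \<psi>1 \<psi>2 y c - y powr p * (max 0 (1 - c / R)) ^ 3 * a y c\<bar>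
         \<le> (3 * (m + 1) + 6 * \<bar>m + p\<bar> + 6 + 6 * \<bar>\<beta>\<bar>) / R * (y powr p * c powr (\<beta> + 1))"
proof -
  define f where "f c = c powr \<beta>" for c :: real
  define f1 where "f1 c = \<beta> * c powr (\<beta> - 1)" for c :: real
  define f2 where "f2 c = \<beta> * (\<beta> - 1) * c powr (\<beta> - 2)" for c :: real
  define u where "u c = max 0 (1 - c / R)" for c :: real
  define \<rho>1 where "\<rho>1 c = 3 * (u c) ^ 2 * (- 1 / R)" for c :: real
  define \<rho>2 where "\<rho>2 c = 6 * u c * (- 1 / R)\<^sup>2 + 3 * (u c) ^ 2 * 0" for c :: real
  define \<psi>1 where "\<psi>1 c = f c * \<rho>1 c + f1 c * (u c) ^ 3" for c
  define \<psi>2 where "\<psi>2 c = f c * \<rho>2 c + 2 * f1 c * \<rho>1 c + f2 c * (u c) ^ 3" for c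
  have \<rho>: "radial_test R (\<lambda>c. (u c) ^ 3) \<rho>1 \<rho>2"
    unfolding u_def \<rho>1_def \<rho>2_def
    by (rule radial_test_cubic) (use R in \<open>auto intro!: derivative_eq_intros simp: field_simps\<close>)
  have "radial_test R (\<lambda>c. f c * (u c) ^ 3) \<psi>1 \<psi>2"
    unfolding \<psi>1_def \<psi>2_def
  proof (rule radial_test_mult[OF \<rho>])
    show "(f has_real_derivative f1 c) (at c)" if "0 < c" for c
      unfolding f_def f1_def using that by (auto intro!: derivative_eq_intros)
    show "(f1 has_real_derivative f2 c) (at c)" if "0 < c" for c
      unfolding f1_def f2_def using that by (auto intro!: derivative_eq_intros)
    show "continuous_on {0<..} f2"
      unfolding f2_def by (auto intro!: continuous_intros)
  qed
  then have rt: "radial_test R \<psi> \<psi>1 \<psi>2"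
    by (simp add: \<psi>_def f_def u_def)
  have meas: "\<psi> \<in> borel_measurable borel" "\<psi>1 \<in> borel_measurable borel" "\<psi>2 \<in> borel_measurable borel"
    unfolding \<psi>_def \<psi>1_def \<psi>2_def \<rho>1_def \<rho>2_def f_def f1_def f2_def u_def by measurable
  have "\<bar>radial_gen m p \<psi> \<psi>1 \<psi>2 y c - y powr p * (max 0 (1 - c / R)) ^ 3 * a y c\<bar>
         \<le> (3 * (m + 1) + 6 * \<bar>m + p\<bar> + 6 + 6 * \<bar>\<beta>\<bar>) / R * (y powr p * c powr (\<beta> + 1))"
    if y: "0 < y" "y \<le> 2 * c" and c: "1 \<le> c" for y c
  proof -
    define L where "L = (m + 1) * c + 2 * (m + p) * (y - c)"
    define b where "b = f c"
    have b: "0 < b" using c by (simp add: b_def f_def)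
    have f1c: "f1 c * c = \<beta> * b" and f2c: "f2 c * c\<^sup>2 = \<beta> * (\<beta> - 1) * b"
      and b1: "c powr (\<beta> + 1) = b * c" and bm1: "c powr (\<beta> - 1) = b / c"
      and bm2: "c powr (\<beta> - 2) = b / c\<^sup>2"
      using c by (auto simp: f1_def f2_def b_def f_def powr_diff powr_add powr_numeral)
    have L: "\<bar>L\<bar> \<le> (m + 1 + 2 * \<bar>m + p\<bar>) * c"
    proof -
      have "\<bar>L\<bar> \<le> \<bar>(m + 1) * c\<bar> + \<bar>2 * (m + p) * (y - c)\<bar>"
        unfolding L_def by (rule abs_triangle_ineq)
      also have "\<dots> \<le> (m + 1) * c + 2 * \<bar>m + p\<bar> * c"
      proof (rule add_mono)
        have "\<bar>2 * (m + p) * (y - c)\<bar> = 2 * \<bar>m + p\<bar> * \<bar>y - c\<bar>"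
          by (simp only: abs_mult abs_numeral)
        also have "\<dots> \<le> 2 * \<bar>m + p\<bar> * c"
          using y by (intro mult_left_mono) auto
        finally show "\<bar>2 * (m + p) * (y - c)\<bar> \<le> 2 * \<bar>m + p\<bar> * c" .
      qed (use m c in auto)
      finally show ?thesis by (simp add: algebra_simps)
    qed
    have u: "0 \<le> u c" "u c \<le> 1" using R c by (auto simp: u_def)
    have \<rho>1: "\<bar>\<rho>1 c\<bar> \<le> 3 / R"
      using R u power_le_one[of "u c" 2] by (simp add: \<rho>1_def abs_mult divide_right_mono)
    have \<rho>2: "\<bar>\<rho>2 c\<bar> * (c\<^sup>2 - 1) \<le> 6 / R * c"
    proof (cases "c \<le> R")
      case True
      have "\<bar>\<rho>2 c\<bar> * (c\<^sup>2 - 1) \<le> (6 / R\<^sup>2) * (R * c)"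
      proof (rule mult_mono)
        show "\<bar>\<rho>2 c\<bar> \<le> 6 / R\<^sup>2" using R u by (simp add: \<rho>2_def power_divide abs_mult divide_right_mono)
        have "c\<^sup>2 \<le> R * c" using True c by (simp add: power2_eq_square)
        then show "c\<^sup>2 - 1 \<le> R * c" by simp
      qed (use R c in auto)
      then show ?thesis using R by (simp add: power2_eq_square)
    next
      case False
      then have "u c = 0" using R by (simp add: u_def)
      then show ?thesis using R c by (simp add: \<rho>2_def)
    qed
    have main: "radial_gen m p \<psi> \<psi>1 \<psi>2 y c - y powr p * (u c) ^ 3 * a y c =
       y powr p * (b * \<rho>1 c * L + b * (\<rho>2 c * (c\<^sup>2 - 1)) + 2 * f1 c * \<rho>1 c * (c\<^sup>2 - 1))"
    proof -
      have a_eq: "a y c = (p\<^sup>2 + m * p) * b + f1 c * L + f2 c * (c\<^sup>2 - 1)"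
      proof -
        have "f1 c * L = \<beta> * b * (m + 1 - 2 * (m + p)) + 2 * (m + p) * \<beta> * (y * (b / c))"
          using c by (simp add: L_def f1_def bm1 field_simps)
        moreover have "f2 c * (c\<^sup>2 - 1) = \<beta> * (\<beta> - 1) * b - \<beta> * (\<beta> - 1) * (b / c\<^sup>2)"
          using f2c by (simp add: right_diff_distrib f2_def bm2)
        ultimately show ?thesis
          unfolding a_def power_gen_def bm1 bm2 f_def[symmetric] b_def[symmetric]
          by (simp add: algebra_simps power2_eq_square)
      qed
      have gen_eq: "radial_gen m p \<psi> \<psi>1 \<psi>2 y c = y powr p * ((p\<^sup>2 + m * p) * (b * (u c) ^ 3)
          + (b * \<rho>1 c + f1 c * (u c) ^ 3) * L
          + (b * \<rho>2 c + 2 * f1 c * \<rho>1 c + f2 c * (u c) ^ 3) * (c\<^sup>2 - 1))"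
        by (simp add: radial_gen_def \<psi>_def \<psi>1_def \<psi>2_def L_def b_def f_def u_def)
      have ring: "P * (l * (b * U) + (b * r1 + g1 * U) * K + (b * r2 + 2 * g1 * r1 + g2 * U) * Q)
          - P * U * (l * b + g1 * K + g2 * Q) = P * (b * r1 * K + b * (r2 * Q) + 2 * g1 * r1 * Q)"
        for P l b U r1 g1 K r2 g2 Q :: real
        by (simp add: algebra_simps)
      show ?thesis
        unfolding gen_eq a_eq by (rule ring)
    qed
    have c2: "0 \<le> c\<^sup>2 - 1" using c by simp
    have t1: "\<bar>b * \<rho>1 c * L\<bar> \<le> (3 * (m + 1) + 6 * \<bar>m + p\<bar>) / R * (b * c)"
    proof -
      have "\<bar>\<rho>1 c\<bar> * \<bar>L\<bar> \<le> 3 / R * ((m + 1 + 2 * \<bar>m + p\<bar>) * c)"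
        using \<rho>1 L R by (intro mult_mono) auto
      then have "b * (\<bar>\<rho>1 c\<bar> * \<bar>L\<bar>) \<le> b * (3 / R * ((m + 1 + 2 * \<bar>m + p\<bar>) * c))"
        using b by (intro mult_left_mono) auto
      moreover have "\<bar>b * \<rho>1 c * L\<bar> = b * (\<bar>\<rho>1 c\<bar> * \<bar>L\<bar>)" using b by (simp add: abs_mult)
      moreover have "b * (3 / R * ((m + 1 + 2 * \<bar>m + p\<bar>) * c)) = (3 * (m + 1) + 6 * \<bar>m + p\<bar>) / R * (b * c)"
        by (simp add: algebra_simps add_divide_distrib)
      ultimately show ?thesis by (simp only:)
    qed
    have t2: "\<bar>b * (\<rho>2 c * (c\<^sup>2 - 1))\<bar> \<le> 6 / R * (b * c)"
    proof -
      have "\<bar>b * (\<rho>2 c * (c\<^sup>2 - 1))\<bar> = b * (\<bar>\<rho>2 c\<bar> * (c\<^sup>2 - 1))"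
        using b by (simp only: abs_mult abs_of_nonneg[OF c2] abs_of_pos[OF b])
      also have "\<dots> \<le> b * (6 / R * c)"
        using b \<rho>2 by (intro mult_left_mono) auto
      finally show ?thesis by (simp add: mult_ac)
    qed
    have t3: "\<bar>2 * f1 c * \<rho>1 c * (c\<^sup>2 - 1)\<bar> \<le> 6 * \<bar>\<beta>\<bar> / R * (b * c)"
    proof -
      have "\<bar>f1 c\<bar> * (c\<^sup>2 - 1) \<le> \<bar>f1 c\<bar> * (c * c)"
        by (intro mult_left_mono) (auto simp: power2_eq_square)
      also have "\<dots> = \<bar>f1 c * c\<bar> * c" using c by (simp add: abs_mult)
      also have "\<dots> = \<bar>\<beta>\<bar> * b * c" using b by (simp add: f1c abs_mult)
      finally have "2 * \<bar>\<rho>1 c\<bar> * (\<bar>f1 c\<bar> * (c\<^sup>2 - 1)) \<le> 2 * (3 / R) * (\<bar>\<beta>\<bar> * b * c)"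
        using \<rho>1 R c2 c b by (intro mult_mono[of "2 * _" _ "_ * _" "_ * _ * _"] mult_left_mono) auto
      moreover have "\<bar>2 * f1 c * \<rho>1 c * (c\<^sup>2 - 1)\<bar> = 2 * \<bar>\<rho>1 c\<bar> * (\<bar>f1 c\<bar> * (c\<^sup>2 - 1))"
        by (simp only: abs_mult abs_of_nonneg[OF c2] abs_numeral mult_ac)
      ultimately show ?thesis by (simp add: mult_ac)
    qed
    have "\<bar>b * \<rho>1 c * L + b * (\<rho>2 c * (c\<^sup>2 - 1)) + 2 * f1 c * \<rho>1 c * (c\<^sup>2 - 1)\<bar>
        \<le> (3 * (m + 1) + 6 * \<bar>m + p\<bar>) / R * (b * c) + 6 / R * (b * c) + 6 * \<bar>\<beta>\<bar> / R * (b * c)"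
      using t1 t2 t3 by linarith
    also have "\<dots> = (3 * (m + 1) + 6 * \<bar>m + p\<bar> + 6 + 6 * \<bar>\<beta>\<bar>) / R * (b * c)"
      by (simp add: add_divide_distrib distrib_right)
    finally have "y powr p * \<bar>b * \<rho>1 c * L + b * (\<rho>2 c * (c\<^sup>2 - 1)) + 2 * f1 c * \<rho>1 c * (c\<^sup>2 - 1)\<bar>
       \<le> y powr p * ((3 * (m + 1) + 6 * \<bar>m + p\<bar> + 6 + 6 * \<bar>\<beta>\<bar>) / R * (b * c))"
      by (rule mult_left_mono) simp
    then show ?thesis
      unfolding u_def[symmetric] main b1 abs_mult by (simp only: abs_of_nonneg[OF powr_ge_zero] mult_ac)
  qed
  then show thesis by (rule that[OF rt meas])
qed

section \<open>Moments of an abstract radial diffusion\<close>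

text \<open>
  Y and C model the height of the inverted motion and the hyperbolic cosine of its distance from the
  origin; m is the dimension minus one. The bound on Y + 1 / Y says that the absolute value of ln Y is
  at most the distance. The last two conditions are the forward equation for radial test functions,
  started at the point with y = c = 1.
\<close>


locale radial_diffusion = prob_space M for M :: "'w measure" +
  fixes Y C :: "real \<Rightarrow> 'w \<Rightarrow> real" and m :: real
  assumes m_nonneg: "0 \<le> m"
    and Y_meas: "0 < t \<Longrightarrow> Y t \<in> borel_measurable M"
    and C_meas: "0 < t \<Longrightarrow> C t \<in> borel_measurable M"
    and Y_pos: "0 < t \<Longrightarrow> \<omega> \<in> space M \<Longrightarrow> 0 < Y t \<omega>"
    and Y_C: "0 < t \<Longrightarrow> \<omega> \<in> space M \<Longrightarrow> Y t \<omega> + 1 / Y t \<omega> \<le> 2 * C t \<omega>"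
    and start: "radial_test R \<psi> \<psi>1 \<psi>2 \<Longrightarrow>
      ((\<lambda>t. expectation (\<lambda>\<omega>. Y t \<omega> powr p * \<psi> (C t \<omega>))) \<longlongrightarrow> \<psi> 1) (at_right 0)"
    and forward: "radial_test R \<psi> \<psi>1 \<psi>2 \<Longrightarrow> 0 < t \<Longrightarrow>
      ((\<lambda>t. expectation (\<lambda>\<omega>. Y t \<omega> powr p * \<psi> (C t \<omega>))) has_real_derivative
         expectation (\<lambda>\<omega>. radial_gen m p \<psi> \<psi>1 \<psi>2 (Y t \<omega>) (C t \<omega>))) (at t)"
begin

lemma Y_le: "0 < t \<Longrightarrow> \<omega> \<in> space M \<Longrightarrow> Y t \<omega> \<le> 2 * C t \<omega>"
  using Y_C[of t \<omega>] divide_pos_pos[OF zero_less_one Y_pos[of t \<omega>]] by linarith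

lemma inverse_Y_le: "0 < t \<Longrightarrow> \<omega> \<in> space M \<Longrightarrow> 1 / Y t \<omega> \<le> 2 * C t \<omega>"
  using Y_C[of t \<omega>] Y_pos[of t \<omega>] by linarith

lemma C_ge_1: "0 < t \<Longrightarrow> \<omega> \<in> space M \<Longrightarrow> 1 \<le> C t \<omega>"
proof -
  assume a: "0 < t" "\<omega> \<in> space M"
  have "2 \<le> y + 1 / y" if "y > 0" for y :: real
  proof -
    have "0 \<le> (y - 1)\<^sup>2 / y" using that by simp
    also have "\<dots> = y + 1 / y - 2" using that by (simp add: field_simps power2_eq_square)
    finally show ?thesis by simp
  qed
  from this[OF Y_pos[OF a]] show ?thesis using Y_C[OF a] by simp
qed

text \<open>
  Moments of C have to be shown finite before anything else. With u = (1 - x / R)_+, the function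
  R / 3 (1 - u^3) of x = c^q is concave with derivative u^2, at most x, and equal to a constant minus a
  test function. By concavity the operator is at most B x u^2 on it, and x u^2 is at most
  the function itself. So its expectation grows at most like exp (B t), for every R.
\<close>

lemma expectation_C_power_truncated:
  assumes "0 < R" "0 < t" and q: "0 < q"
  defines "B \<equiv> real q * (m + 1) + 2 * m * real q + (real q)\<^sup>2"
  shows "R / 3 * (1 - expectation (\<lambda>\<omega>. (max 0 (1 - C t \<omega> ^ q / R)) ^ 3)) \<le> exp (B * t)"
proof -
  define f where "f c = 1 - c ^ q / R" for c :: real
  define f1 where "f1 c = - real q * c ^ (q - 1) / R" for c :: real
  define f2 where "f2 c = - real q * real (q - 1) * c ^ (q - 2) / R" for c :: real
  define \<psi> where "\<psi> c = (max 0 (f c)) ^ 3" for c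
  define \<psi>1 where "\<psi>1 c = 3 * (max 0 (f c)) ^ 2 * f1 c" for c
  define \<psi>2 where "\<psi>2 c = 6 * max 0 (f c) * (f1 c)\<^sup>2 + 3 * (max 0 (f c)) ^ 2 * f2 c" for c
  have rt: "radial_test (R + 1) \<psi> \<psi>1 \<psi>2"
    unfolding \<psi>_def \<psi>1_def \<psi>2_def
  proof (rule radial_test_cubic)
    show "(f has_real_derivative f1 c) (at c)" for c
      unfolding f_def f1_def using assms(1)
      by (auto intro!: derivative_eq_intros simp: field_simps)
    show "(f1 has_real_derivative f2 c) (at c)" for c
      unfolding f1_def f2_def using assms(1)
      by (auto intro!: derivative_eq_intros simp: field_simps numeral_2_eq_2)
    show "continuous_on {0<..} f2"
      unfolding f2_def by (intro continuous_intros) (use assms in auto)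
    show "f c \<le> 0" if "R + 1 \<le> c" for c
    proof -
      have "R \<le> c ^ 1" "c ^ 1 \<le> c ^ q"
        using that q assms by (simp, intro power_increasing) auto
      then show ?thesis using assms by (simp add: f_def field_simps)
    qed
  qed
  define \<phi> where "\<phi> r = R / 3 * (1 - expectation (\<lambda>\<omega>. \<psi> (C r \<omega>)))" for r
  define \<phi>' where "\<phi>' r = - R / 3 * expectation (\<lambda>\<omega>. radial_gen m 0 \<psi> \<psi>1 \<psi>2 (Y r \<omega>) (C r \<omega>))" for r
  have ex[simplified]: "expectation (\<lambda>\<omega>. Y r \<omega> powr 0 * \<psi> (C r \<omega>)) = expectation (\<lambda>\<omega>. \<psi> (C r \<omega>))" if "r > 0" for r
    by (rule Bochner_Integration.integral_cong) (use Y_pos[OF that] in \<open>auto simp: less_le\<close>)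
  have lim: "(\<phi> \<longlongrightarrow> R / 3 * (1 - \<psi> 1)) (at_right 0)"
  proof -
    have "((\<lambda>t. R / 3 * (1 - expectation (\<lambda>\<omega>. Y t \<omega> powr 0 * \<psi> (C t \<omega>)))) \<longlongrightarrow> R / 3 * (1 - \<psi> 1)) (at_right 0)"
      by (intro tendsto_intros start[OF rt])
    then show ?thesis
      by (rule Lim_transform_eventually)
        (auto simp: \<phi>_def ex intro!: eventually_mono[OF eventually_at_right_less])
  qed
  have der: "(\<phi> has_real_derivative \<phi>' r) (at r)" if "0 < r" for r
  proof -
    have "((\<lambda>t. R / 3 * (1 - expectation (\<lambda>\<omega>. Y t \<omega> powr 0 * \<psi> (C t \<omega>)))) has_real_derivative \<phi>' r) (at r)"
      unfolding \<phi>'_def using DERIV_cmult[OF DERIV_diff[OF DERIV_const[of 1] forward[OF rt that, of 0]], of "R / 3"]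
      by simp
    moreover have "eventually (\<lambda>x. x \<in> {0<..}) (nhds r)"
      by (rule eventually_nhds_in_open) (use that in auto)
    then have "eventually (\<lambda>t. R / 3 * (1 - expectation (\<lambda>\<omega>. Y t \<omega> powr 0 * \<psi> (C t \<omega>))) = \<phi> t) (nhds r)"
      by eventually_elim (auto simp: \<phi>_def ex)
    ultimately show ?thesis
      by (subst (asm) DERIV_cong_ev[OF refl _ refl]) auto
  qed
  have pw: "- R / 3 * radial_gen m 0 \<psi> \<psi>1 \<psi>2 y c \<le> B * (R / 3 * (1 - \<psi> c))"
    if y: "0 < y" "y \<le> 2 * c" and c: "1 \<le> c" for y c
  proof -
    define u where "u = max 0 (f c)"
    have u: "0 \<le> u" "u \<le> 1" "R * (1 - u) * u\<^sup>2 = c ^ q * u\<^sup>2"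
      using assms c by (auto simp: u_def f_def max_def power2_eq_square)
    have cq: "c ^ (q - 1) * c = c ^ q" using q by (cases q) auto
    have cq2: "real q * real (q - 1) * c ^ (q - 2) * c\<^sup>2 = real q * real (q - 1) * c ^ q"
    proof (cases "q = 1")
      case False
      then have "q - 2 + 2 = q" using q by simp
      then show ?thesis by (metis mult.assoc power_add)
    qed simp
    have e1: "- R / 3 * (\<psi>1 c * X) = u\<^sup>2 * (real q * c ^ (q - 1) * X)" for X
      using assms by (simp add: \<psi>1_def f1_def u_def)
    have e2: "- R / 3 * (\<psi>2 c * (c\<^sup>2 - 1)) \<le> u\<^sup>2 * ((real q)\<^sup>2 * c ^ q)"
    proof -
      define K where "K = real q * real (q - 1) * c ^ (q - 2)"
      have "K = - R * f2 c" using assms(1) by (simp add: f2_def K_def)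
      then have "- R / 3 * (\<psi>2 c * (c\<^sup>2 - 1)) = - (2 * R * u * (f1 c)\<^sup>2) * (c\<^sup>2 - 1) + u\<^sup>2 * K * (c\<^sup>2 - 1)"
        using assms(1) by (simp add: \<psi>2_def u_def[symmetric] field_simps)
      then have "- R / 3 * (\<psi>2 c * (c\<^sup>2 - 1)) = - (2 * R * u * (f1 c)\<^sup>2) * (c\<^sup>2 - 1) +
          u\<^sup>2 * (real q * real (q - 1) * c ^ (q - 2)) * (c\<^sup>2 - 1)"
        by (simp only: K_def)
      also have "\<dots> \<le> 0 + u\<^sup>2 * (real q * real (q - 1) * c ^ (q - 2) * c\<^sup>2)"
      proof (rule add_mono)
        show "- (2 * R * u * (f1 c)\<^sup>2) * (c\<^sup>2 - 1) \<le> 0"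
          using u c assms(1) by (intro mult_nonpos_nonneg) auto
        have "real q * real (q - 1) * c ^ (q - 2) * (c\<^sup>2 - 1) \<le> real q * real (q - 1) * c ^ (q - 2) * c\<^sup>2"
          using c by (intro mult_left_mono) auto
        from mult_left_mono[OF this, of "u\<^sup>2"]
        show "u\<^sup>2 * (real q * real (q - 1) * c ^ (q - 2)) * (c\<^sup>2 - 1) \<le> u\<^sup>2 * (real q * real (q - 1) * c ^ (q - 2) * c\<^sup>2)"
          by (simp only: mult.assoc zero_le_power2)
      qed
      also have "\<dots> = u\<^sup>2 * (real q * real (q - 1) * c ^ q)"
        by (simp only: cq2)
      also have "\<dots> \<le> u\<^sup>2 * ((real q)\<^sup>2 * c ^ q)"
        unfolding power2_eq_square[of "real q"] using c q by (intro mult_left_mono mult_right_mono) auto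
      finally show ?thesis .
    qed
    have e3: "real q * c ^ (q - 1) * ((m + 1) * c + 2 * m * (y - c)) \<le> (real q * (m + 1) + 2 * m * real q) * c ^ q"
    proof -
      have "real q * c ^ (q - 1) * ((m + 1) * c + 2 * m * (y - c)) \<le> real q * c ^ (q - 1) * ((m + 1) * c + 2 * m * c)"
        using y c m_nonneg by (intro mult_left_mono add_mono) auto
      also have "\<dots> = (real q * (m + 1) + 2 * m * real q) * (c ^ (q - 1) * c)"
        by (simp add: algebra_simps)
      finally show ?thesis by (simp only: cq)
    qed
    have "- R / 3 * radial_gen m 0 \<psi> \<psi>1 \<psi>2 y c =
        - R / 3 * (\<psi>1 c * ((m + 1) * c + 2 * m * (y - c))) + (- R / 3 * (\<psi>2 c * (c\<^sup>2 - 1)))"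
      using y by (simp add: radial_gen_def algebra_simps)
    also have "\<dots> \<le> u\<^sup>2 * ((real q * (m + 1) + 2 * m * real q) * c ^ q) + u\<^sup>2 * ((real q)\<^sup>2 * c ^ q)"
      unfolding e1 by (intro add_mono e2 mult_left_mono e3) auto
    also have "\<dots> = B * (c ^ q * u\<^sup>2)"
      by (simp add: B_def algebra_simps)
    also have "\<dots> = B * (R / 3 * (3 * (1 - u) * u\<^sup>2))"
    proof -
      have "R / 3 * (3 * (1 - u) * u\<^sup>2) = R * (1 - u) * u\<^sup>2" by simp
      then show ?thesis by (simp only: u(3))
    qed
    also have "\<dots> \<le> B * (R / 3 * (1 - u ^ 3))"
      using cubic_truncation_ge[OF u(1,2)] assms(1) m_nonneg
      by (intro mult_left_mono) (auto simp: B_def)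
    finally show ?thesis by (simp add: \<psi>_def u_def)
  qed
  have \<psi>01: "0 \<le> \<psi> c" "\<psi> c \<le> 1" if "1 \<le> c" for c
    using that assms(1) by (auto simp: \<psi>_def f_def max_def intro!: power_le_one)
  have meas: "\<psi> \<in> borel_measurable borel" "\<psi>1 \<in> borel_measurable borel" "\<psi>2 \<in> borel_measurable borel"
    unfolding \<psi>_def \<psi>1_def \<psi>2_def f_def f1_def f2_def by measurable
  have le: "\<phi>' r \<le> B * \<phi> r" if "0 < r" for r
  proof -
    note [measurable] = C_meas[OF that] Y_meas[OF that] meas
    have int: "integrable M (\<lambda>\<omega>. \<psi> (C r \<omega>))"
      by (rule integrable_const_bound[where B=1]) (use \<psi>01 C_ge_1[OF that] in \<open>auto intro!: AE_I2\<close>)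
    show ?thesis
    proof (cases "integrable M (\<lambda>\<omega>. radial_gen m 0 \<psi> \<psi>1 \<psi>2 (Y r \<omega>) (C r \<omega>))")
      case True
      have "\<phi>' r = expectation (\<lambda>\<omega>. - R / 3 * radial_gen m 0 \<psi> \<psi>1 \<psi>2 (Y r \<omega>) (C r \<omega>))"
        unfolding \<phi>'_def by simp
      also have "\<dots> \<le> expectation (\<lambda>\<omega>. B * (R / 3 * (1 - \<psi> (C r \<omega>))))"
        by (rule integral_mono) (use True int pw Y_pos[OF that] Y_le[OF that] C_ge_1[OF that] in auto)
      also have "\<dots> = B * \<phi> r"
        using int by (simp add: \<phi>_def prob_space)
      finally show ?thesis .
    next
      case False
      \<comment> \<open>Then the integral is 0 by convention, and \<phi> is nonnegative.\<close>
      then have "\<phi>' r = 0" by (simp add: \<phi>'_def not_integrable_integral_eq)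
      moreover have "expectation (\<lambda>\<omega>. \<psi> (C r \<omega>)) \<le> expectation (\<lambda>\<omega>. 1)"
        by (rule integral_mono) (use int \<psi>01 C_ge_1[OF that] in auto)
      ultimately show ?thesis
        using assms(1) m_nonneg by (auto simp: \<phi>_def prob_space B_def)
    qed
  qed
  have "\<phi> t \<le> exp (B * t) * (R / 3 * (1 - \<psi> 1) + 0 * t)"
    by (rule gronwall_right[OF lim assms(2) der]) (use le in auto)
  moreover have "R / 3 * (1 - \<psi> 1) \<le> 1"
  proof -
    define u where "u = max 0 (1 - 1 / R)"
    have u: "0 \<le> u" "u \<le> 1" "R * (1 - u) \<le> 1"
      using assms(1) by (auto simp: u_def max_def field_simps)
    have "1 - u ^ 3 = (1 - u) * (1 + u + u\<^sup>2)"
      by (simp add: power2_eq_square power3_eq_cube algebra_simps)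
    also have "\<dots> \<le> (1 - u) * 3"
      using u power_le_one[of u 2] by (intro mult_left_mono) auto
    finally have "R / 3 * (1 - u ^ 3) \<le> R / 3 * ((1 - u) * 3)"
      using assms(1) by (intro mult_left_mono) auto
    moreover have "R / 3 * ((1 - u) * 3) = R * (1 - u)" by simp
    moreover have "\<psi> 1 = u ^ 3" by (simp add: \<psi>_def f_def u_def)
    ultimately show ?thesis using u(3) by (metis order_trans)
  qed
  then have "exp (B * t) * (R / 3 * (1 - \<psi> 1) + 0 * t) \<le> exp (B * t) * 1"
    by (intro mult_left_mono) auto
  ultimately have "\<phi> t \<le> exp (B * t) * 1"
    by (rule order_trans)
  then show ?thesis by (simp add: \<phi>_def \<psi>_def f_def)
qed


text \<open>
  Fatou's lemma as R tends to infinity: the truncated power is at least x / 3 wherever x \<le> R.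
\<close>

lemma expectation_C_power:
  assumes q: "0 < q"
  obtains B where "0 \<le> B"
    "\<And>t. 0 < t \<Longrightarrow> integrable M (\<lambda>\<omega>. C t \<omega> ^ q)"
    "\<And>t. 0 < t \<Longrightarrow> expectation (\<lambda>\<omega>. C t \<omega> ^ q) \<le> 3 * exp (B * t)"
proof -
  define B where "B = real q * (m + 1) + 2 * m * real q + (real q)\<^sup>2"
  have B: "0 \<le> B" using m_nonneg by (simp add: B_def)
  have nn: "(\<integral>\<^sup>+ \<omega>. ennreal (C t \<omega> ^ q) \<partial>M) \<le> ennreal (3 * exp (B * t))" if t: "0 < t" for t
  proof -
    note [measurable] = C_meas[OF t]
    define u where "u R \<omega> = (if C t \<omega> ^ q \<le> real R then ennreal (C t \<omega> ^ q) else 0)" for R \<omega>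
    have u_meas[measurable]: "u R \<in> borel_measurable M" for R
      unfolding u_def by measurable
    have le: "(\<integral>\<^sup>+ \<omega>. u R \<omega> \<partial>M) \<le> ennreal (3 * exp (B * t))" if R: "0 < R" for R
    proof -
      define g where "g \<omega> = (max 0 (1 - C t \<omega> ^ q / real R)) ^ 3" for \<omega>
      have g01: "0 \<le> g \<omega>" "g \<omega> \<le> 1" if "\<omega> \<in> space M" for \<omega>
        using C_ge_1[OF t that] R by (auto simp: g_def max_def intro!: power_le_one)
      have [measurable]: "g \<in> borel_measurable M"
        unfolding g_def by measurable
      have int: "integrable M g"
        by (rule integrable_const_bound[where B=1]) (use g01 in \<open>auto intro!: AE_I2\<close>)
      have "(\<integral>\<^sup>+ \<omega>. u R \<omega> \<partial>M) \<le> (\<integral>\<^sup>+ \<omega>. ennreal (real R * (1 - g \<omega>)) \<partial>M)"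
      proof (rule nn_integral_mono)
        fix \<omega> assume w: "\<omega> \<in> space M"
        show "u R \<omega> \<le> ennreal (real R * (1 - g \<omega>))"
        proof (cases "C t \<omega> ^ q \<le> real R")
          case True
          define v where "v = 1 - C t \<omega> ^ q / real R"
          have v: "0 \<le> v" "v \<le> 1" "real R * (1 - v) = C t \<omega> ^ q"
            using True R C_ge_1[OF t w] by (auto simp: v_def)
          have "g \<omega> = v ^ 3"
            using v by (simp add: g_def v_def)
          moreover have "v ^ 3 \<le> v"
            using v power_decreasing[of 1 3 v] by simp
          ultimately have "real R * (1 - v) \<le> real R * (1 - g \<omega>)"
            by (intro mult_left_mono) auto
          then show ?thesis using True by (simp add: u_def v ennreal_leI)
        qed (simp add: u_def)
      qed
      also have "\<dots> = ennreal (expectation (\<lambda>\<omega>. real R * (1 - g \<omega>)))"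
        by (rule nn_integral_eq_integral) (use int g01 in \<open>auto intro!: AE_I2\<close>)
      also have "expectation (\<lambda>\<omega>. real R * (1 - g \<omega>)) = 3 * (real R / 3 * (1 - expectation g))"
        using int by (simp add: prob_space)
      also have "\<dots> \<le> 3 * exp (B * t)"
        unfolding g_def B_def using expectation_C_power_truncated[OF _ t q, of "real R"] R by simp
      finally show ?thesis by (simp add: ennreal_leI)
    qed
    have "(\<integral>\<^sup>+ \<omega>. ennreal (C t \<omega> ^ q) \<partial>M) = (\<integral>\<^sup>+ \<omega>. liminf (\<lambda>R. u R \<omega>) \<partial>M)"
    proof (rule nn_integral_cong)
      fix \<omega>
      have "eventually (\<lambda>R. C t \<omega> ^ q \<le> real R) sequentially"
        by (rule eventually_mono[OF eventually_ge_at_top[of "nat \<lceil>C t \<omega> ^ q\<rceil>"]]) linarith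
      then have "(\<lambda>R. u R \<omega>) \<longlonglongrightarrow> ennreal (C t \<omega> ^ q)"
        by (intro tendsto_eventually) (erule eventually_mono, simp add: u_def)
      then show "ennreal (C t \<omega> ^ q) = liminf (\<lambda>R. u R \<omega>)"
        by (simp add: lim_imp_Liminf)
    qed
    also have "\<dots> \<le> liminf (\<lambda>R. \<integral>\<^sup>+ \<omega>. u R \<omega> \<partial>M)"
      by (rule nn_integral_liminf) simp
    also have "\<dots> \<le> ennreal (3 * exp (B * t))"
      by (rule Liminf_le) (auto intro!: eventually_mono[OF eventually_gt_at_top[of 0]] le)
    finally show ?thesis .
  qed
  have nonneg: "AE \<omega> in M. 0 \<le> C t \<omega> ^ q" if "0 < t" for t
    using C_ge_1[OF that] by (intro AE_I2) (auto intro!: zero_le_power order_trans[OF zero_le_one])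
  show thesis
  proof (rule that[OF B])
    fix t :: real assume t: "0 < t"
    note [measurable] = C_meas[OF t]
    show int: "integrable M (\<lambda>\<omega>. C t \<omega> ^ q)"
      using nn[OF t] nonneg[OF t] by (intro integrableI_nonneg) (auto intro: le_less_trans)
    show "expectation (\<lambda>\<omega>. C t \<omega> ^ q) \<le> 3 * exp (B * t)"
      using nn[OF t] nn_integral_eq_integral[OF int nonneg[OF t]] by simp
  qed
qed

lemma Y_powr_le: "0 < t \<Longrightarrow> \<omega> \<in> space M \<Longrightarrow> Y t \<omega> powr p \<le> 2 powr \<bar>p\<bar> * C t \<omega> powr \<bar>p\<bar>"
proof -
  assume a: "0 < t" "\<omega> \<in> space M"
  have c: "0 \<le> C t \<omega>" using C_ge_1[OF a] by simp
  show ?thesis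
  proof (cases "p \<ge> 0")
    case True
    then have "Y t \<omega> powr p \<le> (2 * C t \<omega>) powr p"
      using Y_pos[OF a] Y_le[OF a] by (intro powr_mono2) auto
    then show ?thesis using True c by (simp add: powr_mult)
  next
    case False
    have "Y t \<omega> powr p = (1 / Y t \<omega>) powr (- p)"
      using Y_pos[OF a] by (simp add: powr_divide powr_minus_divide)
    also have "\<dots> \<le> (2 * C t \<omega>) powr (- p)"
      using False Y_pos[OF a] inverse_Y_le[OF a] by (intro powr_mono2) auto
    finally show ?thesis using False c by (simp add: powr_mult)
  qed
qed

lemma expectation_powr_bound:
  obtains K B where "0 \<le> K" "0 \<le> B"
    "\<And>t. 0 < t \<Longrightarrow> integrable M (\<lambda>\<omega>. Y t \<omega> powr p * C t \<omega> powr \<beta>)"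
    "\<And>t. 0 < t \<Longrightarrow> expectation (\<lambda>\<omega>. Y t \<omega> powr p * C t \<omega> powr \<beta>) \<le> K * exp (B * t)"
proof -
  define q where "q = nat \<lceil>\<bar>p\<bar> + \<bar>\<beta>\<bar>\<rceil> + 1"
  have "0 < q" by (simp add: q_def)
  then obtain B where B: "0 \<le> B" "\<And>t. 0 < t \<Longrightarrow> integrable M (\<lambda>\<omega>. C t \<omega> ^ q)"
      "\<And>t. 0 < t \<Longrightarrow> expectation (\<lambda>\<omega>. C t \<omega> ^ q) \<le> 3 * exp (B * t)"
    using expectation_C_power by blast
  have pw: "Y t \<omega> powr p * C t \<omega> powr \<beta> \<le> 2 powr \<bar>p\<bar> * C t \<omega> ^ q" if a: "0 < t" "\<omega> \<in> space M" for t \<omega>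
  proof -
    note c = C_ge_1[OF a]
    have "C t \<omega> powr \<beta> \<le> C t \<omega> powr \<bar>\<beta>\<bar>"
      using c by (intro powr_mono) auto
    then have "Y t \<omega> powr p * C t \<omega> powr \<beta> \<le> (2 powr \<bar>p\<bar> * C t \<omega> powr \<bar>p\<bar>) * C t \<omega> powr \<bar>\<beta>\<bar>"
      using Y_powr_le[OF a, of p] by (intro mult_mono) auto
    also have "\<dots> = 2 powr \<bar>p\<bar> * C t \<omega> powr (\<bar>p\<bar> + \<bar>\<beta>\<bar>)"
      by (simp add: powr_add)
    also have "\<dots> \<le> 2 powr \<bar>p\<bar> * C t \<omega> powr (real q)"
      using c by (intro mult_left_mono powr_mono) (auto simp: q_def, linarith)
    also have "C t \<omega> powr (real q) = C t \<omega> ^ q"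
      using c by (intro powr_realpow) auto
    finally show ?thesis .
  qed
  have int: "integrable M (\<lambda>\<omega>. Y t \<omega> powr p * C t \<omega> powr \<beta>)" if t: "0 < t" for t
  proof (rule Bochner_Integration.integrable_bound)
    note [measurable] = C_meas[OF t] Y_meas[OF t]
    show "integrable M (\<lambda>\<omega>. 2 powr \<bar>p\<bar> * C t \<omega> ^ q)" using B(2)[OF t] by simp
    show "(\<lambda>\<omega>. Y t \<omega> powr p * C t \<omega> powr \<beta>) \<in> borel_measurable M" by measurable
    show "AE \<omega> in M. norm (Y t \<omega> powr p * C t \<omega> powr \<beta>) \<le> norm (2 powr \<bar>p\<bar> * C t \<omega> ^ q)"
    proof (rule AE_I2)
      fix \<omega> assume "\<omega> \<in> space M"
      from pw[OF t this] show "norm (Y t \<omega> powr p * C t \<omega> powr \<beta>) \<le> norm (2 powr \<bar>p\<bar> * C t \<omega> ^ q)"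
        using order_trans[OF _ abs_ge_self, of "Y t \<omega> powr p * C t \<omega> powr \<beta>"] by simp
    qed
  qed
  show thesis
  proof (rule that[of "2 powr \<bar>p\<bar> * 3" B])
    fix t :: real assume t: "0 < t"
    have "expectation (\<lambda>\<omega>. Y t \<omega> powr p * C t \<omega> powr \<beta>) \<le> expectation (\<lambda>\<omega>. 2 powr \<bar>p\<bar> * C t \<omega> ^ q)"
      by (rule integral_mono) (use int B(2) pw t in auto)
    also have "\<dots> \<le> 2 powr \<bar>p\<bar> * (3 * exp (B * t))"
      using B(3)[OF t] by simp
    finally show "expectation (\<lambda>\<omega>. Y t \<omega> powr p * C t \<omega> powr \<beta>) \<le> 2 powr \<bar>p\<bar> * 3 * exp (B * t)" by simp
  qed (use B int in auto)
qed



end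

context radial_diffusion
begin

lemma integrable_powr: "0 < t \<Longrightarrow> integrable M (\<lambda>\<omega>. Y t \<omega> powr p * C t \<omega> powr \<beta>)"
  using expectation_powr_bound[of p \<beta>] by metis

lemma integrable_cutoff:
  assumes t: "0 < t" and [measurable]: "g \<in> borel_measurable borel"
    and g01: "\<And>c. 1 \<le> c \<Longrightarrow> 0 \<le> g c" "\<And>c. 1 \<le> c \<Longrightarrow> g c \<le> 1"
  shows "integrable M (\<lambda>\<omega>. Y t \<omega> powr p * (C t \<omega> powr \<beta> * g (C t \<omega>)))"
proof (rule Bochner_Integration.integrable_bound[OF integrable_powr[OF t, of p \<beta>]])
  note [measurable] = C_meas[OF t] Y_meas[OF t]
  show "(\<lambda>\<omega>. Y t \<omega> powr p * (C t \<omega> powr \<beta> * g (C t \<omega>))) \<in> borel_measurable M" by measurable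
  show "AE \<omega> in M. norm (Y t \<omega> powr p * (C t \<omega> powr \<beta> * g (C t \<omega>))) \<le> norm (Y t \<omega> powr p * C t \<omega> powr \<beta>)"
    using g01 C_ge_1[OF t] by (intro AE_I2) (auto simp: abs_mult intro!: mult_left_mono mult_left_le)
qed

lemma integrable_power_gen_cutoff:
  assumes t: "0 < t" and g: "g \<in> borel_measurable borel"
    "\<And>c. 1 \<le> c \<Longrightarrow> 0 \<le> g c" "\<And>c. 1 \<le> c \<Longrightarrow> g c \<le> 1"
  shows "integrable M (\<lambda>\<omega>. Y t \<omega> powr p * g (C t \<omega>) * power_gen m p \<beta> (Y t \<omega>) (C t \<omega>))"
proof -
  let ?L = "\<lambda>\<omega>. ((p - \<beta>)\<^sup>2 + m * (p - \<beta>)) * (Y t \<omega> powr p * (C t \<omega> powr \<beta> * g (C t \<omega>)))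
     + 2 * (m + p) * \<beta> * (Y t \<omega> powr (p + 1) * (C t \<omega> powr (\<beta> - 1) * g (C t \<omega>)))
     - \<beta> * (\<beta> - 1) * (Y t \<omega> powr p * (C t \<omega> powr (\<beta> - 2) * g (C t \<omega>)))"
  let ?R = "\<lambda>\<omega>. Y t \<omega> powr p * g (C t \<omega>) * power_gen m p \<beta> (Y t \<omega>) (C t \<omega>)"
  have "integrable M ?L"
    by (intro Bochner_Integration.integrable_add Bochner_Integration.integrable_diff
        integrable_mult_right integrable_cutoff[OF t g])
  moreover have "integrable M ?L \<longleftrightarrow> integrable M ?R"
  proof (rule Bochner_Integration.integrable_cong[OF refl])
    fix \<omega> assume w: "\<omega> \<in> space M"
    have y: "Y t \<omega> powr (p + 1) = Y t \<omega> powr p * Y t \<omega>"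
      using Y_pos[OF t w] by (simp add: powr_add)
    show "?L \<omega> = ?R \<omega>" unfolding y power_gen_def by (simp add: algebra_simps)
  qed
  ultimately show ?thesis by blast
qed

text \<open>
  A differential inequality for y^p c^\<beta> with the cutoff passes to the limit: the error of the cutoff is
  a finite moment times 1 / R, and is absorbed into h. The sign \<sigma> gives upper and lower bounds by one
  argument.
\<close>

lemma expectation_limit:
  fixes p \<beta> \<kappa> h \<sigma> :: real
  defines "\<rho> \<equiv> \<lambda>R c. (max 0 (1 - c / R)) ^ 3"
    and "a \<equiv> power_gen m p \<beta>"
  assumes t: "0 < t" and \<sigma>: "\<bar>\<sigma>\<bar> = 1"
    and le: "\<And>R r. 0 < R \<Longrightarrow> 0 < r \<Longrightarrow> r \<le> t \<Longrightarrow>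
      \<sigma> * expectation (\<lambda>\<omega>. Y r \<omega> powr p * \<rho> R (C r \<omega>) * a (Y r \<omega>) (C r \<omega>))
       \<le> \<kappa> * (\<sigma> * expectation (\<lambda>\<omega>. Y r \<omega> powr p * (C r \<omega> powr \<beta> * \<rho> R (C r \<omega>)))) + h * exp (\<kappa> * r)"
  shows "\<sigma> * expectation (\<lambda>\<omega>. Y t \<omega> powr p * C t \<omega> powr \<beta>) \<le> exp (\<kappa> * t) * (\<sigma> + h * t)"
proof -
  define D where "D = 3 * (m + 1) + 6 * \<bar>m + p\<bar> + 6 + 6 * \<bar>\<beta>\<bar>"
  have D: "0 \<le> D" using m_nonneg by (simp add: D_def)
  obtain K B where KB: "0 \<le> K" "0 \<le> B"
    "\<And>t. 0 < t \<Longrightarrow> integrable M (\<lambda>\<omega>. Y t \<omega> powr p * C t \<omega> powr (\<beta> + 1))"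
    "\<And>t. 0 < t \<Longrightarrow> expectation (\<lambda>\<omega>. Y t \<omega> powr p * C t \<omega> powr (\<beta> + 1)) \<le> K * exp (B * t)"
    using expectation_powr_bound by blast
  have \<rho>01: "0 \<le> \<rho> R c" "\<rho> R c \<le> 1" if "0 < R" "1 \<le> c" for R c
    using that by (auto simp: \<rho>_def max_def intro!: power_le_one)
  have \<rho>_meas[measurable]: "\<rho> R \<in> borel_measurable borel" for R
    unfolding \<rho>_def by measurable
  have intb: "integrable M (\<lambda>\<omega>. Y t \<omega> powr p * C t \<omega> powr \<beta>)" if "0 < t" for p \<beta> t
    using expectation_powr_bound[of p \<beta>] that by metis
  have bound: "\<sigma> * expectation (\<lambda>\<omega>. Y t \<omega> powr p * (C t \<omega> powr \<beta> * \<rho> R (C t \<omega>)))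
      \<le> exp (\<kappa> * t) * (\<sigma> * \<rho> R 1 + (h + D / R * K * exp ((B + \<bar>\<kappa>\<bar>) * t)) * t)"
    (is "_ \<le> _ * (_ + ?h * _)") if R: "0 < R" for R
  proof -
    define \<psi> where "\<psi> c = c powr \<beta> * \<rho> R c" for c
    obtain \<psi>1 \<psi>2 where rt: "radial_test R \<psi> \<psi>1 \<psi>2"
      and meas: "\<psi> \<in> borel_measurable borel" "\<psi>1 \<in> borel_measurable borel" "\<psi>2 \<in> borel_measurable borel"
      and err: "\<And>y c. 0 < y \<Longrightarrow> y \<le> 2 * c \<Longrightarrow> 1 \<le> c \<Longrightarrow>
        \<bar>radial_gen m p \<psi> \<psi>1 \<psi>2 y c - y powr p * \<rho> R c * a y c\<bar> \<le> D / R * (y powr p * c powr (\<beta> + 1))"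
      using radial_gen_cutoff[OF R m_nonneg, of \<beta> p] unfolding \<psi>_def \<rho>_def a_def D_def by blast
    let ?e = "\<lambda>r. expectation (\<lambda>\<omega>. Y r \<omega> powr p * \<psi> (C r \<omega>))"
    let ?g = "\<lambda>r. expectation (\<lambda>\<omega>. radial_gen m p \<psi> \<psi>1 \<psi>2 (Y r \<omega>) (C r \<omega>))"
    have "\<sigma> * ?e t \<le> exp (\<kappa> * t) * (\<sigma> * \<psi> 1 + ?h * t)"
    proof (rule gronwall_right[where \<phi>' = "\<lambda>r. \<sigma> * ?g r", OF _ t])
      show "((\<lambda>r. \<sigma> * ?e r) \<longlongrightarrow> \<sigma> * \<psi> 1) (at_right 0)"
        by (intro tendsto_intros start[OF rt])
      fix r :: real assume r: "0 < r"
      show "((\<lambda>r. \<sigma> * ?e r) has_real_derivative \<sigma> * ?g r) (at r)"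
        by (intro DERIV_cmult forward[OF rt r])
      assume rt: "r \<le> t"
      note [measurable] = C_meas[OF r] Y_meas[OF r] meas
      let ?a = "\<lambda>\<omega>. Y r \<omega> powr p * \<rho> R (C r \<omega>) * a (Y r \<omega>) (C r \<omega>)"
      let ?G = "\<lambda>\<omega>. radial_gen m p \<psi> \<psi>1 \<psi>2 (Y r \<omega>) (C r \<omega>)"
      let ?E = "\<lambda>\<omega>. D / R * (Y r \<omega> powr p * C r \<omega> powr (\<beta> + 1))"
      have inta: "integrable M ?a"
        unfolding a_def by (rule integrable_power_gen_cutoff[OF r]) (use \<rho>01[OF R] in auto)
      have intE: "integrable M ?E" using KB(3)[OF r] by simp
      have ptw: "\<bar>?G \<omega> - ?a \<omega>\<bar> \<le> ?E \<omega>" if "\<omega> \<in> space M" for \<omega>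
        using err[OF Y_pos[OF r that] Y_le[OF r that] C_ge_1[OF r that]] by simp
      have intG: "integrable M ?G"
      proof -
        have "integrable M (\<lambda>\<omega>. ?G \<omega> - ?a \<omega>)"
        proof (rule Bochner_Integration.integrable_bound[OF intE])
          show "(\<lambda>\<omega>. ?G \<omega> - ?a \<omega>) \<in> borel_measurable M"
            unfolding radial_gen_def a_def power_gen_def by measurable
          show "AE \<omega> in M. norm (?G \<omega> - ?a \<omega>) \<le> norm (?E \<omega>)"
          proof (rule AE_I2)
            fix \<omega> assume "\<omega> \<in> space M"
            from ptw[OF this] show "norm (?G \<omega> - ?a \<omega>) \<le> norm (?E \<omega>)"
              unfolding real_norm_def by (rule order_trans[OF _ abs_ge_self])
          qed
        qed
        from Bochner_Integration.integrable_add[OF this inta] show ?thesis by simp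
      qed
      have "\<sigma> * ?g r = expectation (\<lambda>\<omega>. \<sigma> * (?G \<omega> - ?a \<omega>)) + \<sigma> * expectation ?a"
        using intG inta by (simp add: algebra_simps)
      also have "\<dots> \<le> expectation ?E + (\<kappa> * (\<sigma> * expectation (\<lambda>\<omega>. Y r \<omega> powr p * (C r \<omega> powr \<beta> * \<rho> R (C r \<omega>)))) + h * exp (\<kappa> * r))"
      proof (intro add_mono le[OF R r rt] integral_mono)
        fix \<omega> assume w: "\<omega> \<in> space M"
        have "\<sigma> * (?G \<omega> - ?a \<omega>) \<le> \<bar>?G \<omega> - ?a \<omega>\<bar>"
        proof -
          have "\<sigma> = 1 \<or> \<sigma> = -1" using \<sigma> by linarith
          then show ?thesis by auto
        qed
        then show "\<sigma> * (?G \<omega> - ?a \<omega>) \<le> ?E \<omega>" using ptw[OF w] by linarith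
      qed (use intG inta intE in auto)
      also have "expectation ?E \<le> D / R * K * exp ((B + \<bar>\<kappa>\<bar>) * t) * exp (\<kappa> * r)"
      proof -
        have "expectation ?E \<le> D / R * (K * exp (B * r))"
          using KB(4)[OF r] D R by (simp add: mult_left_mono divide_right_mono)
        also have "exp (B * r) \<le> exp ((B + \<bar>\<kappa>\<bar>) * t + \<kappa> * r)"
        proof -
          have "B * r \<le> B * t" "\<bar>\<kappa>\<bar> * r \<le> \<bar>\<kappa>\<bar> * t" using KB rt by (auto intro!: mult_left_mono)
          moreover have "- (\<kappa> * r) \<le> \<bar>\<kappa>\<bar> * r" using r by (metis abs_ge_minus_self abs_mult abs_of_pos)
          ultimately show ?thesis by (simp add: algebra_simps)
        qed
        finally show ?thesis
          using D R KB by (simp add: exp_add mult_left_mono divide_right_mono mult.assoc)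
      qed
      finally show "\<sigma> * ?g r \<le> \<kappa> * (\<sigma> * ?e r) + ?h * exp (\<kappa> * r)"
        by (simp add: \<psi>_def algebra_simps)
    qed
    then show ?thesis by (simp add: \<psi>_def)
  qed
  have lim1: "(\<lambda>R. expectation (\<lambda>\<omega>. Y t \<omega> powr p * (C t \<omega> powr \<beta> * \<rho> (real (Suc R)) (C t \<omega>))))
      \<longlonglongrightarrow> expectation (\<lambda>\<omega>. Y t \<omega> powr p * C t \<omega> powr \<beta>)"
  proof (rule integral_dominated_convergence[where w="\<lambda>\<omega>. Y t \<omega> powr p * C t \<omega> powr \<beta>"])
    note [measurable] = C_meas[OF t] Y_meas[OF t]
    show "(\<lambda>\<omega>. Y t \<omega> powr p * C t \<omega> powr \<beta>) \<in> borel_measurable M" by measurable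
    show "(\<lambda>\<omega>. Y t \<omega> powr p * (C t \<omega> powr \<beta> * \<rho> (real (Suc R)) (C t \<omega>))) \<in> borel_measurable M" for R
      by measurable
    show "integrable M (\<lambda>\<omega>. Y t \<omega> powr p * C t \<omega> powr \<beta>)" by (rule intb[OF t])
    have "(\<lambda>R. \<rho> (real (Suc R)) c) \<longlonglongrightarrow> 1" for c
    proof -
      have "(\<lambda>R. c / real (Suc R)) \<longlonglongrightarrow> 0"
        by (rule LIMSEQ_Suc[OF lim_const_over_n])
      then have "(\<lambda>R. (max 0 (1 - c / real (Suc R))) ^ 3) \<longlonglongrightarrow> (max 0 (1 - 0)) ^ 3"
        by (intro tendsto_intros)
      then show ?thesis by (simp add: \<rho>_def)
    qed
    from tendsto_mult[OF tendsto_const tendsto_mult[OF tendsto_const this]]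
    show "AE \<omega> in M. (\<lambda>R. Y t \<omega> powr p * (C t \<omega> powr \<beta> * \<rho> (real (Suc R)) (C t \<omega>))) \<longlonglongrightarrow> Y t \<omega> powr p * C t \<omega> powr \<beta>"
      by (intro AE_I2) (metis mult.right_neutral)
    show "AE \<omega> in M. norm (Y t \<omega> powr p * (C t \<omega> powr \<beta> * \<rho> (real (Suc R)) (C t \<omega>))) \<le> Y t \<omega> powr p * C t \<omega> powr \<beta>" for R
      using \<rho>01[of "real (Suc R)"] C_ge_1[OF t]
      by (intro AE_I2) (auto simp: abs_mult intro!: mult_left_mono mult_left_le)
  qed
  have lim2: "(\<lambda>R. exp (\<kappa> * t) * (\<sigma> * \<rho> (real (Suc R)) 1 + (h + D / real (Suc R) * K * exp ((B + \<bar>\<kappa>\<bar>) * t)) * t))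
      \<longlonglongrightarrow> exp (\<kappa> * t) * (\<sigma> * (max 0 (1 - 0)) ^ 3 + (h + 0 * K * exp ((B + \<bar>\<kappa>\<bar>) * t)) * t)"
    unfolding \<rho>_def by (intro tendsto_intros LIMSEQ_Suc[OF lim_const_over_n])
  have "\<sigma> * expectation (\<lambda>\<omega>. Y t \<omega> powr p * C t \<omega> powr \<beta>)
      \<le> exp (\<kappa> * t) * (\<sigma> * (max 0 (1 - 0)) ^ 3 + (h + 0 * K * exp ((B + \<bar>\<kappa>\<bar>) * t)) * t)"
    by (rule LIMSEQ_le[OF tendsto_mult[OF tendsto_const lim1] lim2]) (use bound in auto)
  then show ?thesis by simp
qed


text \<open>
  For \<beta> = 0 the operator is multiplication by p^2 + m p, so the differential inequality holds with both
  signs and no remainder.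
\<close>

lemma expectation_Y_powr:
  assumes t: "0 < t"
  shows "integrable M (\<lambda>\<omega>. Y t \<omega> powr p)" "expectation (\<lambda>\<omega>. Y t \<omega> powr p) = exp ((p\<^sup>2 + m * p) * t)"
proof -
  let ?e = "expectation (\<lambda>\<omega>. Y t \<omega> powr p * C t \<omega> powr 0)"
  have *: "\<sigma> * ?e \<le> exp ((p\<^sup>2 + m * p) * t) * (\<sigma> + 0 * t)" if "\<bar>\<sigma>\<bar> = 1" for \<sigma> :: real
  proof (rule expectation_limit[OF t that])
    fix R r :: real
    let ?g = "\<lambda>\<omega>. max 0 (1 - C r \<omega> / R) ^ 3"
    have "expectation (\<lambda>\<omega>. Y r \<omega> powr p * ?g \<omega> * power_gen m p 0 (Y r \<omega>) (C r \<omega>))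
       = expectation (\<lambda>\<omega>. (p\<^sup>2 + m * p) * (Y r \<omega> powr p * (C r \<omega> powr 0 * ?g \<omega>)))"
      by (rule Bochner_Integration.integral_cong) (auto simp: power_gen_def)
    also have "\<dots> = (p\<^sup>2 + m * p) * expectation (\<lambda>\<omega>. Y r \<omega> powr p * (C r \<omega> powr 0 * ?g \<omega>))"
      by (rule integral_mult_right_zero)
    finally show "\<sigma> * expectation (\<lambda>\<omega>. Y r \<omega> powr p * ?g \<omega> * power_gen m p 0 (Y r \<omega>) (C r \<omega>))
       \<le> (p\<^sup>2 + m * p) * (\<sigma> * expectation (\<lambda>\<omega>. Y r \<omega> powr p * (C r \<omega> powr 0 * ?g \<omega>))) + 0 * exp ((p\<^sup>2 + m * p) * r)"
      by simp
  qed
  have eq: "Y t \<omega> powr p * C t \<omega> powr 0 = Y t \<omega> powr p" if "\<omega> \<in> space M" for \<omega>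
    using C_ge_1[OF t that] by simp
  have "?e = exp ((p\<^sup>2 + m * p) * t)" using *[of 1] *[of "-1"] by simp
  moreover have "?e = expectation (\<lambda>\<omega>. Y t \<omega> powr p)"
    by (rule Bochner_Integration.integral_cong) (use eq in auto)
  ultimately show "expectation (\<lambda>\<omega>. Y t \<omega> powr p) = exp ((p\<^sup>2 + m * p) * t)" by simp
  show "integrable M (\<lambda>\<omega>. Y t \<omega> powr p)"
  proof -
    have "integrable M (\<lambda>\<omega>. Y t \<omega> powr p * C t \<omega> powr 0) \<longleftrightarrow> integrable M (\<lambda>\<omega>. Y t \<omega> powr p)"
      by (rule Bochner_Integration.integrable_cong) (use eq in auto)
    then show ?thesis using integrable_powr[OF t, of p 0] by simp
  qed
qed

text \<open>
  The remainder y c^(\<beta> - 1) is at most \<epsilon> c^\<beta> where y / c is small; elsewhere y and c are comparable,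
  since y \<le> 2 c, and the remainder is at most a multiple of y^\<beta>. So the operator is at most \<kappa> times the
  function, plus multiples of y^(p + \<beta>) and y^p, whose expectations are known and grow at most like
  exp (\<kappa> t).
\<close>

lemma expectation_Y_C_powr_le:
  assumes \<beta>: "0 < \<beta>" and mp: "0 \<le> m + p" and \<epsilon>: "0 < \<epsilon>"
    and \<kappa>: "(p - \<beta>)\<^sup>2 + m * (p - \<beta>) + \<epsilon> \<le> \<kappa>" "p\<^sup>2 + m * p \<le> \<kappa>" "(p + \<beta>)\<^sup>2 + m * (p + \<beta>) \<le> \<kappa>"
  obtains A where "0 \<le> A"
    "\<And>t. 0 < t \<Longrightarrow> expectation (\<lambda>\<omega>. Y t \<omega> powr p * C t \<omega> powr \<beta>) \<le> exp (\<kappa> * t) * (1 + A * t)"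
proof -
  define s where "s = 2 * (m + p) * \<beta>"
  define \<delta> where "\<delta> = \<epsilon> / (s + 1)"
  define K where "K = s * (\<delta> powr (1 - \<beta>) + 2 powr (1 - \<beta>))"
  have s: "0 \<le> s" using mp \<beta> by (simp add: s_def)
  have \<delta>: "0 < \<delta>" "s * \<delta> \<le> \<epsilon>" using s \<epsilon> by (auto simp: \<delta>_def field_simps)
  have K: "0 \<le> K" using s by (simp add: K_def)
  have young: "s * (y * c powr (\<beta> - 1)) \<le> \<epsilon> * c powr \<beta> + K * y powr \<beta>"
    if y: "0 < y" "y \<le> 2 * c" and c: "1 \<le> c" for y c
  proof (cases "y \<le> \<delta> * c")
    case True
    have "s * (y * c powr (\<beta> - 1)) \<le> s * ((\<delta> * c) * c powr (\<beta> - 1))"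
      using s True by (intro mult_left_mono mult_right_mono) auto
    also have "\<dots> = (s * \<delta>) * c powr \<beta>"
      using c by (simp add: powr_diff)
    finally have "s * (y * c powr (\<beta> - 1)) \<le> (s * \<delta>) * c powr \<beta>" .
    also have "\<dots> \<le> \<epsilon> * c powr \<beta>" using \<delta> by (intro mult_right_mono) auto
    finally have "s * (y * c powr (\<beta> - 1)) \<le> \<epsilon> * c powr \<beta>" .
    moreover have "0 \<le> K * y powr \<beta>" using K by simp
    ultimately show ?thesis by linarith
  next
    case False
    have "y * c powr (\<beta> - 1) \<le> (\<delta> powr (1 - \<beta>) + 2 powr (1 - \<beta>)) * y powr \<beta>"
    proof (cases "\<beta> \<ge> 1")
      case b: True
      have "c powr (\<beta> - 1) \<le> (y / \<delta>) powr (\<beta> - 1)"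
        using False \<delta> b c by (intro powr_mono2) (auto simp: field_simps)
      also have "\<dots> = y powr (\<beta> - 1) * \<delta> powr (1 - \<beta>)"
        using y \<delta> by (simp add: powr_divide powr_diff)
      finally have "y * c powr (\<beta> - 1) \<le> y * (y powr (\<beta> - 1) * \<delta> powr (1 - \<beta>))"
        using y by (intro mult_left_mono) auto
      also have "\<dots> = \<delta> powr (1 - \<beta>) * y powr \<beta>" using y by (simp add: powr_diff)
      finally show ?thesis by (simp add: distrib_right add_increasing2)
    next
      case b: False
      have "c powr (\<beta> - 1) \<le> (y / 2) powr (\<beta> - 1)"
        using y b c by (intro powr_mono2') auto
      also have "\<dots> = y powr (\<beta> - 1) * 2 powr (1 - \<beta>)"
        using y by (simp add: powr_divide powr_diff)
      finally have "y * c powr (\<beta> - 1) \<le> y * (y powr (\<beta> - 1) * 2 powr (1 - \<beta>))"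
        using y by (intro mult_left_mono) auto
      also have "\<dots> = 2 powr (1 - \<beta>) * y powr \<beta>" using y by (simp add: powr_diff)
      finally show ?thesis by (simp add: distrib_right add_increasing)
    qed
    from mult_left_mono[OF this s] have "s * (y * c powr (\<beta> - 1)) \<le> K * y powr \<beta>"
      by (simp add: K_def mult.assoc)
    moreover have "0 \<le> \<epsilon> * c powr \<beta>" using \<epsilon> by simp
    ultimately show ?thesis by linarith
  qed
  have low: "- \<beta> * (\<beta> - 1) * c powr (\<beta> - 2) \<le> \<beta>" if c: "1 \<le> c" for c
  proof (cases "\<beta> \<ge> 1")
    case True
    then have "- \<beta> * (\<beta> - 1) * c powr (\<beta> - 2) \<le> 0"
      by (intro mult_nonpos_nonneg) (auto simp: mult_nonpos_nonneg)
    then show ?thesis using \<beta> by simp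
  next
    case False
    have "\<beta> * (1 - \<beta>) * c powr (\<beta> - 2) \<le> \<beta> * 1 * c powr 0"
      using False \<beta> c by (intro mult_mono powr_mono) auto
    then show ?thesis using c by (simp add: algebra_simps)
  qed
  show thesis
  proof (rule that[of "K + \<beta>"])
    show "0 \<le> K + \<beta>" using K \<beta> by simp
    fix t :: real assume t: "0 < t"
    have "1 * expectation (\<lambda>\<omega>. Y t \<omega> powr p * C t \<omega> powr \<beta>) \<le> exp (\<kappa> * t) * (1 + (K + \<beta>) * t)"
    proof (rule expectation_limit[OF t])
      fix R r :: real assume R: "0 < R" and r: "0 < r"
      let ?g = "\<lambda>\<omega>. max 0 (1 - C r \<omega> / R) ^ 3"
      let ?a = "power_gen m p \<beta>"
      note [measurable] = C_meas[OF r] Y_meas[OF r]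
      have g01: "0 \<le> max 0 (1 - c / R) ^ 3" "max 0 (1 - c / R) ^ 3 \<le> 1" if "1 \<le> c" for c
        using that R by (auto simp: max_def intro!: power_le_one)
      have int2: "integrable M (\<lambda>\<omega>. Y r \<omega> powr p * (C r \<omega> powr \<beta> * ?g \<omega>))"
        by (rule integrable_cutoff[OF r]) (use g01 in auto)
      have "expectation (\<lambda>\<omega>. Y r \<omega> powr p * ?g \<omega> * ?a (Y r \<omega>) (C r \<omega>))
        \<le> expectation (\<lambda>\<omega>. \<kappa> * (Y r \<omega> powr p * (C r \<omega> powr \<beta> * ?g \<omega>)) + K * Y r \<omega> powr (p + \<beta>) + \<beta> * Y r \<omega> powr p)"
      proof (rule integral_mono)
        show "integrable M (\<lambda>\<omega>. Y r \<omega> powr p * ?g \<omega> * ?a (Y r \<omega>) (C r \<omega>))"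
          by (rule integrable_power_gen_cutoff[OF r]) (use g01 in auto)
        show "integrable M (\<lambda>\<omega>. \<kappa> * (Y r \<omega> powr p * (C r \<omega> powr \<beta> * ?g \<omega>)) + K * Y r \<omega> powr (p + \<beta>) + \<beta> * Y r \<omega> powr p)"
          using int2 expectation_Y_powr(1)[OF r] by (intro Bochner_Integration.integrable_add) auto
        fix \<omega> assume w: "\<omega> \<in> space M"
        define y c g where "y = Y r \<omega>" and "c = C r \<omega>" and "g = max 0 (1 - c / R) ^ 3"
        have y: "0 < y" "y \<le> 2 * c" and c: "1 \<le> c"
          using Y_pos[OF r w] Y_le[OF r w] C_ge_1[OF r w] by (auto simp: y_def c_def)
        have "?a y c \<le> ((p - \<beta>)\<^sup>2 + m * (p - \<beta>) + \<epsilon>) * c powr \<beta> + K * y powr \<beta> + \<beta>"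
          using young[OF y c] low[OF c] by (simp add: power_gen_def s_def algebra_simps)
        also have "\<dots> \<le> \<kappa> * c powr \<beta> + K * y powr \<beta> + \<beta>"
          using \<kappa>(1) by (intro add_mono mult_right_mono) auto
        finally have "(y powr p * g) * ?a y c \<le> (y powr p * g) * (\<kappa> * c powr \<beta> + K * y powr \<beta> + \<beta>)"
          using g01[OF c] by (intro mult_left_mono) (auto simp: g_def)
        also have "\<dots> = \<kappa> * (y powr p * (c powr \<beta> * g)) + (K * y powr (p + \<beta>) + \<beta> * y powr p) * g"
          by (simp add: powr_add algebra_simps)
        also have "\<dots> \<le> \<kappa> * (y powr p * (c powr \<beta> * g)) + (K * y powr (p + \<beta>) + \<beta> * y powr p) * 1"
          using g01[OF c] K \<beta> by (intro add_left_mono mult_left_mono) (auto simp: g_def)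
        finally show "Y r \<omega> powr p * ?g \<omega> * ?a (Y r \<omega>) (C r \<omega>)
           \<le> \<kappa> * (Y r \<omega> powr p * (C r \<omega> powr \<beta> * ?g \<omega>)) + K * Y r \<omega> powr (p + \<beta>) + \<beta> * Y r \<omega> powr p"
          by (simp add: y_def c_def g_def)
      qed
      also have "\<dots> = \<kappa> * expectation (\<lambda>\<omega>. Y r \<omega> powr p * (C r \<omega> powr \<beta> * ?g \<omega>))
          + K * exp (((p + \<beta>)\<^sup>2 + m * (p + \<beta>)) * r) + \<beta> * exp ((p\<^sup>2 + m * p) * r)"
        using int2 expectation_Y_powr[OF r] by simp
      also have "\<dots> \<le> \<kappa> * expectation (\<lambda>\<omega>. Y r \<omega> powr p * (C r \<omega> powr \<beta> * ?g \<omega>))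
          + K * exp (\<kappa> * r) + \<beta> * exp (\<kappa> * r)"
        using K \<beta> \<kappa> r by (intro add_mono mult_left_mono order_refl iffD2[OF exp_le_cancel_iff] mult_right_mono) auto
      finally show "1 * expectation (\<lambda>\<omega>. Y r \<omega> powr p * ?g \<omega> * ?a (Y r \<omega>) (C r \<omega>))
        \<le> \<kappa> * (1 * expectation (\<lambda>\<omega>. Y r \<omega> powr p * (C r \<omega> powr \<beta> * ?g \<omega>))) + (K + \<beta>) * exp (\<kappa> * r)"
        by (simp add: algebra_simps)
    qed simp
    then show "expectation (\<lambda>\<omega>. Y t \<omega> powr p * C t \<omega> powr \<beta>) \<le> exp (\<kappa> * t) * (1 + (K + \<beta>) * t)" by simp
  qed
qed

end

section \<open>Large deviations of an abstract radial diffusion\<close>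


lemma Limsup_elog_le:
  assumes K: "0 < K" and le: "\<And>t. 0 < t \<Longrightarrow> P t \<le> K * (1 + t) * exp (- s * t)" and P: "\<And>t. 0 \<le> P t"
  shows "Limsup at_top (\<lambda>t. ereal (1 / t) * elog (P t)) \<le> - ereal s"
proof -
  have "eventually (\<lambda>t. ereal (1 / t) * elog (P t) \<le> ereal (ln (K * (1 + t)) / t - s)) at_top"
    using eventually_gt_at_top[of 0]
  proof eventually_elim
    case (elim t)
    show ?case
    proof (cases "P t = 0")
      case True
      then show ?thesis using elim by (simp add: elog_def)
    next
      case False
      then have pos: "0 < P t" using P[of t] by simp
      have "ln (P t) \<le> ln (K * (1 + t) * exp (- s * t))"
        using le[OF elim] pos by (simp add: ln_mono)
      also have "\<dots> = ln (K * (1 + t)) - s * t"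
        using K elim by (simp add: ln_mult)
      finally have "1 / t * ln (P t) \<le> 1 / t * (ln (K * (1 + t)) - s * t)"
        using elim by (intro mult_left_mono) auto
      also have "\<dots> = ln (K * (1 + t)) / t - s"
        using elim by (simp add: field_simps)
      finally show ?thesis using False by (simp add: elog_def)
    qed
  qed
  then have "Limsup at_top (\<lambda>t. ereal (1 / t) * elog (P t)) \<le> Limsup at_top (\<lambda>t. ereal (ln (K * (1 + t)) / t - s))"
    by (rule Limsup_mono)
  also have "((\<lambda>t. ln (K * (1 + t)) / t - s) \<longlongrightarrow> - s) at_top"
    using K by real_asymp
  then have "Limsup at_top (\<lambda>t. ereal (ln (K * (1 + t)) / t - s)) = - ereal s"
    by (intro lim_imp_Limsup) (auto simp: trivial_limit_at_top_linorder)
  finally show ?thesis .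
qed

lemma Liminf_elog_ge:
  assumes "eventually (\<lambda>t. 1 / 2 * exp (- s * t) \<le> P t) at_top"
  shows "- ereal s \<le> Liminf at_top (\<lambda>t. ereal (1 / t) * elog (P t))"
proof -
  have "((\<lambda>t. ln (1 / 2) / t - s) \<longlongrightarrow> - s) at_top"
    by real_asymp
  then have "- ereal s = Liminf at_top (\<lambda>t. ereal (ln (1 / 2) / t - s))"
    by (intro lim_imp_Liminf[symmetric]) (auto simp: trivial_limit_at_top_linorder)
  also have "eventually (\<lambda>t. ereal (ln (1 / 2) / t - s) \<le> ereal (1 / t) * elog (P t)) at_top"
    using assms eventually_gt_at_top[of 0]
  proof eventually_elim
    case (elim t)
    have pos: "0 < 1 / 2 * exp (- s * t)" by simp
    then have P: "0 < P t" using elim(1) by linarith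
    have "ln (1 / 2) - s * t = ln (1 / 2 * exp (- s * t))"
      by (subst ln_mult) auto
    also have "\<dots> \<le> ln (P t)"
      using elim(1) pos by (rule ln_mono)
    finally have "1 / t * (ln (1 / 2) - s * t) \<le> 1 / t * ln (P t)"
      using elim by (intro mult_left_mono) auto
    moreover have "1 / t * (ln (1 / 2) - s * t) = ln (1 / 2) / t - s"
      using elim by (simp add: field_simps)
    ultimately show ?case using P by (simp add: elog_def)
  qed
  then have "Liminf at_top (\<lambda>t. ereal (ln (1 / 2) / t - s)) \<le> Liminf at_top (\<lambda>t. ereal (1 / t) * elog (P t))"
    by (rule Liminf_mono)
  finally show ?thesis .
qed

lemma good_rate_function_I1: "good_rate_function (I1 n)"
  unfolding good_rate_function_def rate_function_def
proof (intro conjI allI impI)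
  show "0 \<le> I1 n x" for x
    by (simp add: I1_def)
  show "I1 n x \<le> Liminf (at x) (I1 n)" for x
  proof (cases "x \<ge> 0")
    case True
    have "((\<lambda>y. ereal ((y - (real n - 1))\<^sup>2 / 4)) \<longlongrightarrow> ereal ((x - (real n - 1))\<^sup>2 / 4)) (at x)"
      by (intro tendsto_intros) auto
    then have "I1 n x = Liminf (at x) (\<lambda>y. ereal ((y - (real n - 1))\<^sup>2 / 4))"
      using True by (simp only: lim_imp_Liminf[OF at_neq_bot] I1_def if_True)
    also have "\<dots> \<le> Liminf (at x) (I1 n)"
      by (intro Liminf_mono always_eventually allI) (simp add: I1_def)
    finally show ?thesis .
  next
    case False
    have "eventually (\<lambda>y. y \<in> {..<0}) (at x)"
      by (rule eventually_at_in_open') (use False in auto)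
    then have "((I1 n) \<longlongrightarrow> \<infinity>) (at x)"
      by (intro tendsto_eventually) (erule eventually_mono, simp add: I1_def)
    then have "Liminf (at x) (I1 n) = \<infinity>"
      by (rule lim_imp_Liminf[OF at_neq_bot])
    then show ?thesis by simp
  qed
  show "compact {x. I1 n x \<le> ereal \<gamma>}" if "0 \<le> \<gamma>" for \<gamma>
  proof -
    have le_iff: "(x - (real n - 1))\<^sup>2 / 4 \<le> \<gamma> \<longleftrightarrow> \<bar>x - (real n - 1)\<bar> \<le> 2 * sqrt \<gamma>" for x
    proof -
      have "(x - (real n - 1))\<^sup>2 / 4 \<le> \<gamma> \<longleftrightarrow> (x - (real n - 1))\<^sup>2 \<le> (2 * sqrt \<gamma>)\<^sup>2"
        using that by (simp add: power_mult_distrib field_simps)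
      also have "\<dots> \<longleftrightarrow> \<bar>x - (real n - 1)\<bar> \<le> 2 * sqrt \<gamma>"
        using abs_le_square_iff[of "x - (real n - 1)" "2 * sqrt \<gamma>"] that by simp
      finally show ?thesis .
    qed
    have "x \<in> {x. I1 n x \<le> ereal \<gamma>} \<longleftrightarrow> x \<in> {max 0 (real n - 1 - 2 * sqrt \<gamma>)..real n - 1 + 2 * sqrt \<gamma>}" for x
    proof (cases "0 \<le> x")
      case True
      have "x \<in> {x. I1 n x \<le> ereal \<gamma>} \<longleftrightarrow> \<bar>x - (real n - 1)\<bar> \<le> 2 * sqrt \<gamma>"
        using True by (simp only: I1_def if_True mem_Collect_eq ereal_less_eq le_iff)
      also have "\<dots> \<longleftrightarrow> real n - 1 - 2 * sqrt \<gamma> \<le> x \<and> x \<le> real n - 1 + 2 * sqrt \<gamma>"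
        by arith
      finally show ?thesis using True by simp
    qed (simp add: I1_def)
    then have "{x. I1 n x \<le> ereal \<gamma>} = {max 0 (real n - 1 - 2 * sqrt \<gamma>)..real n - 1 + 2 * sqrt \<gamma>}"
      by blast
    then show ?thesis by simp
  qed
qed

context radial_diffusion
begin

abbreviation D :: "real \<Rightarrow> 'w \<Rightarrow> real" where
  "D t \<omega> \<equiv> arcosh (C t \<omega>)"

lemma D_meas: "0 < t \<Longrightarrow> D t \<in> borel_measurable M"
proof -
  assume t: "0 < t"
  note [measurable] = C_meas[OF t]
  show ?thesis unfolding arcosh_def by measurable
qed

lemma D_nonneg: "0 < t \<Longrightarrow> \<omega> \<in> space M \<Longrightarrow> 0 \<le> D t \<omega>"
  using C_ge_1 by simp

lemma cosh_D: "0 < t \<Longrightarrow> \<omega> \<in> space M \<Longrightarrow> cosh (D t \<omega>) = C t \<omega>"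
  using C_ge_1 by simp

lemma exp_D_le: "0 < t \<Longrightarrow> \<omega> \<in> space M \<Longrightarrow> exp (D t \<omega>) \<le> 2 * C t \<omega>"
proof -
  assume a: "0 < t" "\<omega> \<in> space M"
  have "exp (D t \<omega>) + exp (- D t \<omega>) = 2 * C t \<omega>"
    using cosh_D[OF a] by (simp add: cosh_def)
  then show ?thesis using exp_gt_zero[of "- D t \<omega>"] by linarith
qed

lemma Y_le_exp_D: "0 < t \<Longrightarrow> \<omega> \<in> space M \<Longrightarrow> Y t \<omega> \<le> exp (D t \<omega>)"
proof -
  assume a: "0 < t" "\<omega> \<in> space M"
  note y = Y_pos[OF a]
  have "cosh (ln (Y t \<omega>)) = (Y t \<omega> + 1 / Y t \<omega>) / 2"
    using y by (simp add: cosh_def exp_minus field_simps)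
  also have "\<dots> \<le> cosh (D t \<omega>)"
    unfolding cosh_D[OF a] using divide_right_mono[OF Y_C[OF a], of 2] by simp
  finally have "cosh \<bar>ln (Y t \<omega>)\<bar> \<le> cosh (D t \<omega>)"
    by simp
  then have "\<bar>ln (Y t \<omega>)\<bar> \<le> D t \<omega>"
    using cosh_real_nonneg_le_iff[of "\<bar>ln (Y t \<omega>)\<bar>" "D t \<omega>"] D_nonneg[OF a] by simp
  then have "ln (Y t \<omega>) \<le> D t \<omega>" by simp
  then have "exp (ln (Y t \<omega>)) \<le> exp (D t \<omega>)" by (simp only: exp_le_cancel_iff)
  then show ?thesis using y by simp
qed

lemma one_le_C_powr:
  assumes t: "0 < t" and w: "\<omega> \<in> space M" and r: "r \<le> D t \<omega>" and \<beta>: "0 \<le> \<beta>"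
  shows "1 \<le> exp (- \<beta> * r) * (2 powr \<beta> * C t \<omega> powr \<beta>)"
proof -
  have "exp r \<le> 2 * C t \<omega>"
    using r exp_D_le[OF t w] by (meson exp_le_cancel_iff order_trans)
  then have "exp r powr \<beta> \<le> (2 * C t \<omega>) powr \<beta>"
    using \<beta> by (intro powr_mono2) auto
  also have "\<dots> = 2 powr \<beta> * C t \<omega> powr \<beta>"
    using C_ge_1[OF t w] by (intro powr_mult)
  finally have "exp (- \<beta> * r) * exp (\<beta> * r) \<le> exp (- \<beta> * r) * (2 powr \<beta> * C t \<omega> powr \<beta>)"
    by (intro mult_left_mono) (auto simp: powr_def mult_ac)
  then show ?thesis by (simp flip: exp_add)
qed

text \<open>
  Markov's inequality for C^\<beta>. The choice \<beta> = (a - m) / 2 minimises the exponent \<beta>^2 + m \<beta> - a \<beta>.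
\<close>

lemma prob_D_ge:
  assumes a: "m < a" and \<epsilon>: "0 < \<epsilon>"
  obtains K where "0 < K"
    "\<And>t. 0 < t \<Longrightarrow> prob {\<omega> \<in> space M. a * t \<le> D t \<omega>} \<le> K * (1 + t) * exp (- ((a - m)\<^sup>2 / 4 - \<epsilon>) * t)"
proof -
  define \<beta> where "\<beta> = (a - m) / 2"
  have \<beta>: "0 < \<beta>" using a by (simp add: \<beta>_def)
  define \<kappa> where "\<kappa> = \<beta>\<^sup>2 + m * \<beta> + \<epsilon>"
  have \<kappa>0: "0 \<le> m * \<beta>" using m_nonneg \<beta> by simp
  have k: "(0 - \<beta>)\<^sup>2 + m * (0 - \<beta>) + \<epsilon> \<le> \<kappa>" "0\<^sup>2 + m * 0 \<le> \<kappa>" "(0 + \<beta>)\<^sup>2 + m * (0 + \<beta>) \<le> \<kappa>"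
    using \<kappa>0 zero_le_power2[of \<beta>] \<epsilon> by (simp_all add: \<kappa>_def)
  have mp: "0 \<le> m + 0" using m_nonneg by simp
  obtain A where A: "0 \<le> A" "\<And>t. 0 < t \<Longrightarrow> expectation (\<lambda>\<omega>. Y t \<omega> powr 0 * C t \<omega> powr \<beta>) \<le> exp (\<kappa> * t) * (1 + A * t)"
    using expectation_Y_C_powr_le[OF \<beta> mp \<epsilon> k] by blast
  show thesis
  proof (rule that[of "2 powr \<beta> * (1 + A)"])
    show "0 < 2 powr \<beta> * (1 + A)" using A by simp
    fix t :: real assume t: "0 < t"
    note [measurable] = D_meas[OF t]
    have "prob {\<omega> \<in> space M. a * t \<le> D t \<omega>} = expectation (indicator {\<omega> \<in> space M. a * t \<le> D t \<omega>})"
      by simp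
    also have "\<dots> \<le> expectation (\<lambda>\<omega>. 2 powr \<beta> * exp (- \<beta> * a * t) * (Y t \<omega> powr 0 * C t \<omega> powr \<beta>))"
    proof (rule integral_mono)
      fix \<omega> assume w: "\<omega> \<in> space M"
      show "indicator {\<omega> \<in> space M. a * t \<le> D t \<omega>} \<omega> \<le> 2 powr \<beta> * exp (- \<beta> * a * t) * (Y t \<omega> powr 0 * C t \<omega> powr \<beta>)"
      proof (cases "a * t \<le> D t \<omega>")
        case True
        have "1 \<le> exp (- \<beta> * (a * t)) * (2 powr \<beta> * C t \<omega> powr \<beta>)"
          using one_le_C_powr[OF t w True] \<beta> by simp
        then show ?thesis using True w Y_pos[OF t w] by (simp add: mult_ac)
      qed simp
    next
      have "{\<omega> \<in> space M. a * t \<le> D t \<omega>} \<in> events" by measurable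
      then show "integrable M (indicat_real {\<omega> \<in> space M. a * t \<le> D t \<omega>})"
        by (intro integrable_real_indicator) (auto simp: less_top[symmetric])
      show "integrable M (\<lambda>\<omega>. 2 powr \<beta> * exp (- \<beta> * a * t) * (Y t \<omega> powr 0 * C t \<omega> powr \<beta>))"
        by (intro integrable_mult_right integrable_powr[OF t])
    qed
    also have "\<dots> = 2 powr \<beta> * exp (- \<beta> * a * t) * expectation (\<lambda>\<omega>. Y t \<omega> powr 0 * C t \<omega> powr \<beta>)"
      by simp
    also have "\<dots> \<le> 2 powr \<beta> * exp (- \<beta> * a * t) * (exp (\<kappa> * t) * (1 + A * t))"
      using A(2)[OF t] by (intro mult_left_mono) auto
    also have "\<dots> = 2 powr \<beta> * exp (- ((a - m)\<^sup>2 / 4 - \<epsilon>) * t) * (1 + A * t)"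
    proof -
      have am: "a = 2 * \<beta> + m" by (simp add: \<beta>_def field_simps)
      have "- \<beta> * a * t + \<kappa> * t = - ((a - m)\<^sup>2 / 4 - \<epsilon>) * t"
        unfolding \<kappa>_def am by (simp add: power2_eq_square algebra_simps)
      then show ?thesis by (simp add: mult.assoc flip: exp_add)
    qed
    also have "\<dots> \<le> 2 powr \<beta> * exp (- ((a - m)\<^sup>2 / 4 - \<epsilon>) * t) * ((1 + A) * (1 + t))"
      using A t by (intro mult_left_mono) (auto simp: algebra_simps)
    finally show "prob {\<omega> \<in> space M. a * t \<le> D t \<omega>} \<le> 2 powr \<beta> * (1 + A) * (1 + t) * exp (- ((a - m)\<^sup>2 / 4 - \<epsilon>) * t)"
      by (simp add: mult_ac)
  qed
qed

text \<open>
  D \<le> b t forces Y \<le> exp (b t), and ln Y has drift m. Markov's inequality for the power -\<tau> of Y gives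
  the exponent \<tau>^2 - m \<tau> + b \<tau>, which is minimal at \<tau> = (m - b) / 2.
\<close>

lemma prob_D_le:
  assumes b: "b < m" and t: "0 < t"
  shows "prob {\<omega> \<in> space M. D t \<omega> \<le> b * t} \<le> exp (- ((m - b)\<^sup>2 / 4) * t)"
proof -
  define \<tau> where "\<tau> = (m - b) / 2"
  have \<tau>: "0 < \<tau>" using b by (simp add: \<tau>_def)
  note [measurable] = D_meas[OF t]
  have "prob {\<omega> \<in> space M. D t \<omega> \<le> b * t} = expectation (indicator {\<omega> \<in> space M. D t \<omega> \<le> b * t})"
    by simp
  also have "\<dots> \<le> expectation (\<lambda>\<omega>. exp (\<tau> * b * t) * Y t \<omega> powr (- \<tau>))"
  proof (rule integral_mono)
    fix \<omega> assume w: "\<omega> \<in> space M"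
    show "indicator {\<omega> \<in> space M. D t \<omega> \<le> b * t} \<omega> \<le> exp (\<tau> * b * t) * Y t \<omega> powr (- \<tau>)"
    proof (cases "D t \<omega> \<le> b * t")
      case True
      have "Y t \<omega> \<le> exp (b * t)"
        using True Y_le_exp_D[OF t w] by (meson exp_le_cancel_iff order_trans)
      then have "exp (b * t) powr (- \<tau>) \<le> Y t \<omega> powr (- \<tau>)"
        using \<tau> Y_pos[OF t w] by (intro powr_mono2') auto
      then have "exp (\<tau> * b * t) * exp (- \<tau> * (b * t)) \<le> exp (\<tau> * b * t) * Y t \<omega> powr (- \<tau>)"
        by (intro mult_left_mono) (auto simp: powr_def)
      then show ?thesis using True w by (simp add: mult_ac flip: exp_add)
    qed simp
  next
    have "{\<omega> \<in> space M. D t \<omega> \<le> b * t} \<in> events" by measurable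
    then show "integrable M (indicat_real {\<omega> \<in> space M. D t \<omega> \<le> b * t})"
      by (intro integrable_real_indicator) (auto simp: less_top[symmetric])
    show "integrable M (\<lambda>\<omega>. exp (\<tau> * b * t) * Y t \<omega> powr (- \<tau>))"
      by (intro integrable_mult_right expectation_Y_powr(1)[OF t])
  qed
  also have "\<dots> = exp (\<tau> * b * t) * exp (((- \<tau>)\<^sup>2 + m * (- \<tau>)) * t)"
    using expectation_Y_powr(2)[OF t] by simp
  also have "\<dots> = exp (- ((m - b)\<^sup>2 / 4) * t)"
  proof -
    have bm: "b = m - 2 * \<tau>" by (simp add: \<tau>_def field_simps)
    have "\<tau> * b * t + ((- \<tau>)\<^sup>2 + m * (- \<tau>)) * t = - ((m - b)\<^sup>2 / 4) * t"
      unfolding bm by (simp add: power2_eq_square algebra_simps)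
    then show ?thesis by (simp flip: exp_add)
  qed
  finally show ?thesis .
qed

text \<open>
  Under the weight Y^\<theta> the total mass is exp (\<Lambda> t). The two ways to leave the neighbourhood of x are
  D \<ge> (x + \<delta>) t and ln Y \<le> (x - \<delta>) t, and both have a weighted mass of smaller exponential
  order. What remains has (x - \<delta>) t < ln Y \<le> D < (x + \<delta>) t, so that the weight is at most
  exp ((\<theta> x + \<bar>\<theta>\<bar> \<delta>) t) there. Finally \<Lambda> - \<theta> x = - \<theta>^2.
\<close>

lemma prob_D_near_ge:
  assumes x: "0 < x" and \<delta>: "0 < \<delta>"
  shows "eventually (\<lambda>t. 1 / 2 * exp (- ((x - m)\<^sup>2 / 4 + \<bar>(x - m) / 2\<bar> * \<delta>) * t)
     \<le> prob {\<omega> \<in> space M. (x - \<delta>) * t < D t \<omega> \<and> D t \<omega> < (x + \<delta>) * t}) at_top"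
proof -
  define \<theta> where "\<theta> = (x - m) / 2"
  define \<Lambda> where "\<Lambda> = \<theta>\<^sup>2 + m * \<theta>"
  \<comment> \<open>The errors then decay with the exponents 3/2 \<beta>^2 - \<beta> \<delta> = - \<beta>^2 / 2 and \<beta>^2 - \<beta> \<delta> = - \<beta>^2.\<close>
  define \<beta> where "\<beta> = \<delta> / 2"
  have xm: "x = 2 * \<theta> + m" by (simp add: \<theta>_def field_simps)
  have \<delta>\<beta>: "\<delta> = 2 * \<beta>" by (simp add: \<beta>_def)
  have \<beta>: "0 < \<beta>" using \<delta> by (simp add: \<beta>_def)
  have bx: "0 < \<beta> * x" using \<beta> x by simp
  have b2: "0 < \<beta>\<^sup>2 / 2" using \<beta> by simp
  define \<kappa> where "\<kappa> = \<Lambda> + \<beta> * x + \<beta>\<^sup>2 + \<beta>\<^sup>2 / 2"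
  have mp: "0 \<le> m + \<theta>" using x m_nonneg by (simp add: \<theta>_def field_simps)
  have eq1: "(\<theta> - \<beta>)\<^sup>2 + m * (\<theta> - \<beta>) = \<Lambda> - \<beta> * x + \<beta>\<^sup>2"
    by (simp add: \<Lambda>_def xm power2_eq_square algebra_simps)
  have k1: "(\<theta> - \<beta>)\<^sup>2 + m * (\<theta> - \<beta>) + \<beta>\<^sup>2 / 2 \<le> \<kappa>"
    using bx unfolding eq1 \<kappa>_def by linarith
  have k2: "\<theta>\<^sup>2 + m * \<theta> \<le> \<kappa>"
    using bx b2 zero_le_power2[of \<beta>] unfolding \<Lambda>_def[symmetric] \<kappa>_def by linarith
  have eq2: "(\<theta> + \<beta>)\<^sup>2 + m * (\<theta> + \<beta>) = \<Lambda> + \<beta> * x + \<beta>\<^sup>2"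
    by (simp add: \<Lambda>_def xm power2_eq_square algebra_simps)
  have k3: "(\<theta> + \<beta>)\<^sup>2 + m * (\<theta> + \<beta>) \<le> \<kappa>"
    using b2 unfolding eq2 \<kappa>_def by linarith
  obtain A where A: "0 \<le> A" "\<And>t. 0 < t \<Longrightarrow> expectation (\<lambda>\<omega>. Y t \<omega> powr \<theta> * C t \<omega> powr \<beta>) \<le> exp (\<kappa> * t) * (1 + A * t)"
    using expectation_Y_C_powr_le[OF \<beta> mp b2 k1 k2 k3] by blast
  have "((\<lambda>t. 2 powr \<beta> * exp (- (\<beta>\<^sup>2 / 2) * t) * (1 + A * t) + exp (- \<beta>\<^sup>2 * t)) \<longlongrightarrow> 0) at_top"
  proof -
    have "((\<lambda>t. exp (- (\<beta>\<^sup>2 / 2) * t) * (1 + t)) \<longlongrightarrow> 0) at_top" "((\<lambda>t. exp (- \<beta>\<^sup>2 * t)) \<longlongrightarrow> 0) at_top"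
      "((\<lambda>t. exp (- (\<beta>\<^sup>2 / 2) * t)) \<longlongrightarrow> 0) at_top"
      using \<beta> by real_asymp+
    then have "((\<lambda>t. 2 powr \<beta> * (A * (exp (- (\<beta>\<^sup>2 / 2) * t) * (1 + t)) + (1 - A) * exp (- (\<beta>\<^sup>2 / 2) * t)) + exp (- \<beta>\<^sup>2 * t)) \<longlongrightarrow> 2 powr \<beta> * (A * 0 + (1 - A) * 0) + 0) at_top"
      by (intro tendsto_intros)
    then show ?thesis by (simp add: algebra_simps)
  qed
  then have "eventually (\<lambda>t. 2 powr \<beta> * exp (- (\<beta>\<^sup>2 / 2) * t) * (1 + A * t) + exp (- \<beta>\<^sup>2 * t) < 1 / 2) at_top"
    by (rule order_tendstoD) simp
  then show ?thesis
    using eventually_gt_at_top[of 0]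
  proof eventually_elim
    case (elim t)
    note t = elim(2)
    note [measurable] = D_meas[OF t]
    let ?G = "{\<omega> \<in> space M. (x - \<delta>) * t < D t \<omega> \<and> D t \<omega> < (x + \<delta>) * t}"
    have pw: "Y t \<omega> powr \<theta> \<le> exp ((\<theta> * x + \<bar>\<theta>\<bar> * \<delta>) * t) * indicator ?G \<omega>
         + 2 powr \<beta> * exp (- \<beta> * (x + \<delta>) * t) * (Y t \<omega> powr \<theta> * C t \<omega> powr \<beta>)
         + exp (\<beta> * (x - \<delta>) * t) * Y t \<omega> powr (\<theta> - \<beta>)" (is "_ \<le> ?g + ?b1 + ?b2") if w: "\<omega> \<in> space M" for \<omega>
    proof -
      have nn: "0 \<le> ?g" "0 \<le> ?b1" "0 \<le> ?b2" by auto
      note y = Y_pos[OF t w]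
      consider "(x + \<delta>) * t \<le> D t \<omega>" | "ln (Y t \<omega>) \<le> (x - \<delta>) * t"
        | "D t \<omega> < (x + \<delta>) * t" "(x - \<delta>) * t < ln (Y t \<omega>)" by linarith
      then show ?thesis
      proof cases
        case 1
        have "1 \<le> exp (- \<beta> * ((x + \<delta>) * t)) * (2 powr \<beta> * C t \<omega> powr \<beta>)"
          using one_le_C_powr[OF t w 1] \<beta> by simp
        from mult_left_mono[OF this, of "Y t \<omega> powr \<theta>"] have "Y t \<omega> powr \<theta> \<le> ?b1"
          by (simp add: mult_ac)
        then show ?thesis using nn by linarith
      next
        case 2
        have "\<beta> * ln (Y t \<omega>) \<le> \<beta> * ((x - \<delta>) * t)" using 2 \<beta> by (intro mult_left_mono) auto
        then have "Y t \<omega> powr \<beta> \<le> exp (\<beta> * (x - \<delta>) * t)"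
          using y by (simp add: powr_def mult.assoc)
        from mult_right_mono[OF this, of "Y t \<omega> powr (\<theta> - \<beta>)"] have "Y t \<omega> powr \<theta> \<le> ?b2"
          by (simp flip: powr_add)
        then show ?thesis using nn by linarith
      next
        case 3
        have lD: "ln (Y t \<omega>) \<le> D t \<omega>"
          using ln_mono[OF Y_le_exp_D[OF t w] y] by simp
        have "\<theta> * (ln (Y t \<omega>) - x * t) \<le> \<bar>\<theta>\<bar> * \<bar>ln (Y t \<omega>) - x * t\<bar>"
          by (simp only: abs_ge_self flip: abs_mult)
        also have "\<dots> \<le> \<bar>\<theta>\<bar> * (\<delta> * t)"
          using 3 lD by (intro mult_left_mono) (auto simp: algebra_simps abs_le_iff)
        finally have "\<theta> * ln (Y t \<omega>) \<le> (\<theta> * x + \<bar>\<theta>\<bar> * \<delta>) * t"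
          by (simp add: algebra_simps)
        then have "Y t \<omega> powr \<theta> \<le> exp ((\<theta> * x + \<bar>\<theta>\<bar> * \<delta>) * t)"
          using y by (simp add: powr_def)
        also have "\<dots> = ?g" using 3 lD w by simp
        finally show ?thesis using nn by linarith
      qed
    qed
    have "?G \<in> events" by measurable
    then have intG: "integrable M (indicat_real ?G)"
      by (intro integrable_real_indicator) (auto simp: less_top[symmetric])
    have "exp (\<Lambda> * t) = expectation (\<lambda>\<omega>. Y t \<omega> powr \<theta>)"
      using expectation_Y_powr(2)[OF t] by (simp add: \<Lambda>_def)
    also have "\<dots> \<le> expectation (\<lambda>\<omega>. exp ((\<theta> * x + \<bar>\<theta>\<bar> * \<delta>) * t) * indicator ?G \<omega>
         + 2 powr \<beta> * exp (- \<beta> * (x + \<delta>) * t) * (Y t \<omega> powr \<theta> * C t \<omega> powr \<beta>)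
         + exp (\<beta> * (x - \<delta>) * t) * Y t \<omega> powr (\<theta> - \<beta>))"
      by (rule integral_mono)
        (use pw integrable_powr[OF t] expectation_Y_powr(1)[OF t] in \<open>auto intro!: Bochner_Integration.integrable_add integrable_mult_right intG\<close>)
    also have "\<dots> = exp ((\<theta> * x + \<bar>\<theta>\<bar> * \<delta>) * t) * prob ?G
         + 2 powr \<beta> * exp (- \<beta> * (x + \<delta>) * t) * expectation (\<lambda>\<omega>. Y t \<omega> powr \<theta> * C t \<omega> powr \<beta>)
         + exp (\<beta> * (x - \<delta>) * t) * exp (((\<theta> - \<beta>)\<^sup>2 + m * (\<theta> - \<beta>)) * t)"
      using integrable_powr[OF t] expectation_Y_powr[OF t] intG by simp
    also have "\<dots> \<le> exp ((\<theta> * x + \<bar>\<theta>\<bar> * \<delta>) * t) * prob ?G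
         + 2 powr \<beta> * exp (- \<beta> * (x + \<delta>) * t) * (exp (\<kappa> * t) * (1 + A * t))
         + exp (\<beta> * (x - \<delta>) * t) * exp (((\<theta> - \<beta>)\<^sup>2 + m * (\<theta> - \<beta>)) * t)"
      using A(2)[OF t] by (intro add_mono mult_left_mono) auto
    also have "\<dots> = exp ((\<theta> * x + \<bar>\<theta>\<bar> * \<delta>) * t) * prob ?G
         + exp (\<Lambda> * t) * (2 powr \<beta> * exp (- (\<beta>\<^sup>2 / 2) * t) * (1 + A * t) + exp (- \<beta>\<^sup>2 * t))"
    proof -
      have e1: "- \<beta> * (x + \<delta>) * t + \<kappa> * t = \<Lambda> * t + - (\<beta>\<^sup>2 / 2) * t"
        unfolding \<kappa>_def \<delta>\<beta> by (simp add: power2_eq_square algebra_simps)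
      have e2: "\<beta> * (x - \<delta>) * t + ((\<theta> - \<beta>)\<^sup>2 + m * (\<theta> - \<beta>)) * t = \<Lambda> * t + - \<beta>\<^sup>2 * t"
        unfolding \<Lambda>_def \<delta>\<beta> xm by (simp add: power2_eq_square algebra_simps)
      have e1': "exp (- \<beta> * (x + \<delta>) * t) * exp (\<kappa> * t) = exp (\<Lambda> * t) * exp (- (\<beta>\<^sup>2 / 2) * t)"
        by (simp only: e1 flip: exp_add)
      have e2': "exp (\<beta> * (x - \<delta>) * t) * exp (((\<theta> - \<beta>)\<^sup>2 + m * (\<theta> - \<beta>)) * t) = exp (\<Lambda> * t) * exp (- \<beta>\<^sup>2 * t)"
        by (simp only: e2 flip: exp_add)
      have "2 powr \<beta> * exp (- \<beta> * (x + \<delta>) * t) * (exp (\<kappa> * t) * (1 + A * t))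
          = 2 powr \<beta> * (exp (- \<beta> * (x + \<delta>) * t) * exp (\<kappa> * t)) * (1 + A * t)"
        by (simp only: mult.assoc)
      then show ?thesis unfolding e1' e2' by (simp only: distrib_left mult_ac add.assoc)
    qed
    also have "\<dots> \<le> exp ((\<theta> * x + \<bar>\<theta>\<bar> * \<delta>) * t) * prob ?G + exp (\<Lambda> * t) * (1 / 2)"
      using elim(1) by (intro add_left_mono mult_left_mono) auto
    finally have "1 / 2 * exp (\<Lambda> * t) \<le> exp ((\<theta> * x + \<bar>\<theta>\<bar> * \<delta>) * t) * prob ?G" by simp
    then have "exp (- ((\<theta> * x + \<bar>\<theta>\<bar> * \<delta>) * t)) * (1 / 2 * exp (\<Lambda> * t)) \<le> exp (- ((\<theta> * x + \<bar>\<theta>\<bar> * \<delta>) * t)) * (exp ((\<theta> * x + \<bar>\<theta>\<bar> * \<delta>) * t) * prob ?G)"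
      by (intro mult_left_mono) auto
    also have "\<dots> = prob ?G" by (simp add: exp_minus)
    also have "exp (- ((\<theta> * x + \<bar>\<theta>\<bar> * \<delta>) * t)) * (1 / 2 * exp (\<Lambda> * t)) = 1 / 2 * exp (- ((x - m)\<^sup>2 / 4 + \<bar>(x - m) / 2\<bar> * \<delta>) * t)"
    proof -
      have "- ((\<theta> * x + \<bar>\<theta>\<bar> * \<delta>) * t) + \<Lambda> * t = - ((x - m)\<^sup>2 / 4 + \<bar>(x - m) / 2\<bar> * \<delta>) * t"
        unfolding \<Lambda>_def \<theta>_def[symmetric] by (simp add: xm power2_eq_square algebra_simps)
      then show ?thesis by (simp only: mult.left_commute[of _ "1/2"] flip: exp_add)
    qed
    finally show ?case .
  qed
qed

text \<open>
  If r is below the infimum of the rate function over F, then every nonnegative point of F has distance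
  at least 2 sqrt r from m, which leaves the two tails. For an open set G and a point x \<ge> 0 of it, the
  local bound is applied at a point y of G slightly to the right of x, which is positive even for x = 0.
\<close>

lemma large_deviation_principle_D:
  assumes n: "m = real n - 1"
  shows "large_deviation_principle M (\<lambda>t \<omega>. D t \<omega> / t) (\<lambda>t. t) (I1 n)"
  unfolding large_deviation_principle_def
proof (intro conjI allI impI)
  show "(\<lambda>\<omega>. D t \<omega> / t) \<in> borel_measurable M" if "0 < t" for t
    using D_meas[OF that] by measurable
  show "rate_function (I1 n)"
    using good_rate_function_I1 by (simp add: good_rate_function_def)
  show "filterlim (\<lambda>t::real. t) at_top at_top"
    by (rule filterlim_ident)
next
  fix F :: "real set" assume "closed F"
  define P where "P t = prob {\<omega> \<in> space M. D t \<omega> / t \<in> F}" for t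
  let ?S = "Limsup at_top (\<lambda>t. ereal (1 / t) * elog (P t))"
  have main: "?S \<le> - ereal s"
    if s: "0 < s" "ereal s < (INF x\<in>F. I1 n x)" for s
  proof -
    obtain r where r: "s < r" "ereal r < (INF x\<in>F. I1 n x)"
      using ereal_dense2[OF s(2)] by auto
    define a b where "a = m + 2 * sqrt r" and "b = m - 2 * sqrt r"
    have ab: "m < a" "b < m" "(a - m)\<^sup>2 / 4 = r" "(m - b)\<^sup>2 / 4 = r"
      using r(1) s(1) by (auto simp: a_def b_def power_mult_distrib)
    have F: "x \<le> b \<or> a \<le> x" if "x \<in> F" "0 \<le> x" for x
    proof (rule ccontr)
      assume "\<not> (x \<le> b \<or> a \<le> x)"
      then have "\<bar>x - m\<bar> \<le> 2 * sqrt r" by (auto simp: a_def b_def)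
      then have "\<bar>x - m\<bar>\<^sup>2 \<le> (2 * sqrt r)\<^sup>2" by (intro power_mono) auto
      then have "(x - m)\<^sup>2 / 4 \<le> r" using r(1) s(1) by (simp add: power_mult_distrib)
      moreover have "ereal r < I1 n x" using r(2) INF_lower[OF that(1), of "I1 n"] by (rule less_le_trans)
      ultimately show False using that(2) by (simp add: I1_def n)
    qed
    obtain K where K: "0 < K"
      "\<And>t. 0 < t \<Longrightarrow> prob {\<omega> \<in> space M. a * t \<le> D t \<omega>} \<le> K * (1 + t) * exp (- ((a - m)\<^sup>2 / 4 - (r - s)) * t)"
      using prob_D_ge[OF ab(1), of "r - s"] r(1) by auto
    show ?thesis
    proof (rule Limsup_elog_le)
      show "0 < K + 1" using K by simp
      show "0 \<le> P t" for t by (simp add: P_def)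
      fix t :: real assume t: "0 < t"
      note [measurable] = D_meas[OF t]
      have "P t \<le> prob ({\<omega> \<in> space M. a * t \<le> D t \<omega>} \<union> {\<omega> \<in> space M. D t \<omega> \<le> b * t})"
        unfolding P_def
      proof (rule finite_measure_mono)
        show "{\<omega> \<in> space M. D t \<omega> / t \<in> F} \<subseteq> {\<omega> \<in> space M. a * t \<le> D t \<omega>} \<union> {\<omega> \<in> space M. D t \<omega> \<le> b * t}"
        proof
          fix \<omega> assume w: "\<omega> \<in> {\<omega> \<in> space M. D t \<omega> / t \<in> F}"
          then have "D t \<omega> / t \<le> b \<or> a \<le> D t \<omega> / t"
            using t D_nonneg[OF t, of \<omega>] by (intro F) auto
          then show "\<omega> \<in> {\<omega> \<in> space M. a * t \<le> D t \<omega>} \<union> {\<omega> \<in> space M. D t \<omega> \<le> b * t}"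
            using w t by (auto simp: field_simps)
        qed
      qed measurable
      also have "\<dots> \<le> prob {\<omega> \<in> space M. a * t \<le> D t \<omega>} + prob {\<omega> \<in> space M. D t \<omega> \<le> b * t}"
        by (rule measure_Un_le) measurable
      also have "\<dots> \<le> K * (1 + t) * exp (- s * t) + (1 + t) * exp (- s * t)"
      proof (rule add_mono)
        show "prob {\<omega> \<in> space M. a * t \<le> D t \<omega>} \<le> K * (1 + t) * exp (- s * t)"
          using K(2)[OF t] by (simp add: ab)
        have "prob {\<omega> \<in> space M. D t \<omega> \<le> b * t} \<le> exp (- r * t)"
          using prob_D_le[OF ab(2) t] by (simp add: ab)
        also have "\<dots> \<le> 1 * exp (- s * t)" using r(1) t by simp
        also have "\<dots> \<le> (1 + t) * exp (- s * t)" using t by (intro mult_right_mono) auto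
        finally show "prob {\<omega> \<in> space M. D t \<omega> \<le> b * t} \<le> (1 + t) * exp (- s * t)" .
      qed
      also have "\<dots> = (K + 1) * (1 + t) * exp (- s * t)" by (simp add: algebra_simps)
      finally show "P t \<le> (K + 1) * (1 + t) * exp (- s * t)" .
    qed
  qed
  have le0: "?S \<le> 0"
  proof (rule Limsup_bounded)
    show "eventually (\<lambda>t. ereal (1 / t) * elog (P t) \<le> 0) at_top"
      using eventually_gt_at_top[of 0]
    proof eventually_elim
      case (elim t)
      have "ln (P t) \<le> 0" if "P t \<noteq> 0"
        using that measure_nonneg[of M] prob_le_1 by (subst ln_le_zero_iff) (auto simp: P_def zero_less_measure_iff)
      then show ?case using elim by (auto simp: elog_def divide_le_0_iff)
    qed
  qed
  have INF_le: "(INF x\<in>F. I1 n x) \<le> - ?S"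
  proof (rule dense_le)
    fix z assume z: "z < (INF x\<in>F. I1 n x)"
    show "z \<le> - ?S"
    proof (cases "z \<le> 0")
      case True
      note True
      also have "0 \<le> - ?S"
        using le0 ereal_minus_le_minus[of 0] by simp
      finally show ?thesis .
    next
      case False
      then obtain s where "z = ereal s" "0 < s" using z by (cases z) auto
      then have "- (- z) \<le> - ?S"
        using main[of s] z by (simp only: ereal_minus_le_minus)
      then show ?thesis by simp
    qed
  qed
  have "- (- ?S) \<le> - (INF x\<in>F. I1 n x)"
    using INF_le by (simp only: ereal_minus_le_minus)
  then show "Limsup at_top (\<lambda>t. ereal (1 / t) * elog (prob {\<omega> \<in> space M. D t \<omega> / t \<in> F})) \<le> - (INF x\<in>F. I1 n x)"
    by (simp add: P_def)
next
  fix G :: "real set" assume G: "open G"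
  let ?L = "Liminf at_top (\<lambda>t. ereal (1 / t) * elog (prob {\<omega> \<in> space M. D t \<omega> / t \<in> G}))"
  have "- I1 n x \<le> ?L" if x: "x \<in> G" for x
  proof (cases "0 \<le> x")
    case False
    then show ?thesis by (simp add: I1_def)
  next
    case True
    have eps: "- ereal ((x - m)\<^sup>2 / 4) \<le> ?L + ereal \<epsilon>" if \<epsilon>: "0 < \<epsilon>" for \<epsilon>
    proof -
      have "((\<lambda>y. (y - m)\<^sup>2 / 4) \<longlongrightarrow> (x - m)\<^sup>2 / 4) (at_right x)"
        by (intro tendsto_intros) auto
      then have "eventually (\<lambda>y. (y - m)\<^sup>2 / 4 < (x - m)\<^sup>2 / 4 + \<epsilon> / 2) (at_right x)"
        by (rule order_tendstoD) (use \<epsilon> in auto)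
      moreover have "eventually (\<lambda>y. y \<in> G) (at_right x)"
        unfolding eventually_at_filter using eventually_nhds_in_open[OF G x] by (rule eventually_mono) simp
      moreover have "eventually (\<lambda>y. x < y) (at_right x)"
        by (rule eventually_at_right_less)
      ultimately have "eventually (\<lambda>y. (y - m)\<^sup>2 / 4 < (x - m)\<^sup>2 / 4 + \<epsilon> / 2 \<and> y \<in> G \<and> x < y) (at_right x)"
        by eventually_elim auto
      then obtain y where y: "(y - m)\<^sup>2 / 4 < (x - m)\<^sup>2 / 4 + \<epsilon> / 2" "y \<in> G" "x < y"
        using eventually_happens'[OF trivial_limit_at_right_real] by blast
      obtain \<delta>0 where \<delta>0: "0 < \<delta>0" "ball y \<delta>0 \<subseteq> G"
        by (rule openE[OF G y(2)])
      define \<delta> where "\<delta> = min \<delta>0 (\<epsilon> / (2 * (\<bar>(y - m) / 2\<bar> + 1)))"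
      have \<delta>: "0 < \<delta>" "\<delta> \<le> \<delta>0" using \<delta>0 \<epsilon> by (auto simp: \<delta>_def)
      have \<delta>2: "\<bar>(y - m) / 2\<bar> * \<delta> \<le> \<epsilon> / 2"
      proof -
        have "\<bar>(y - m) / 2\<bar> * \<delta> \<le> (\<bar>(y - m) / 2\<bar> + 1) * (\<epsilon> / (2 * (\<bar>(y - m) / 2\<bar> + 1)))"
          using \<delta>(1) by (intro mult_mono) (auto simp: \<delta>_def)
        also have "\<dots> = \<epsilon> / 2"
        proof -
          have "k * (\<epsilon> / (2 * k)) = \<epsilon> / 2" if "0 < k" for k
            using that by simp
          from this[OF add_nonneg_pos[OF abs_ge_zero zero_less_one]] show ?thesis .
        qed
        finally show ?thesis .
      qed
      have y0: "0 < y" using y(3) True by simp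
      have "eventually (\<lambda>t. 1 / 2 * exp (- ((x - m)\<^sup>2 / 4 + \<epsilon>) * t) \<le> prob {\<omega> \<in> space M. D t \<omega> / t \<in> G}) at_top"
        using prob_D_near_ge[OF _ \<delta>(1), of y, OF y0] eventually_gt_at_top[of 0]
      proof eventually_elim
        case (elim t)
        note le = elim(1) and t = elim(2)
        note [measurable] = D_meas[OF t]
        have exponent_le: "- ((x - m)\<^sup>2 / 4 + \<epsilon>) * t \<le> - ((y - m)\<^sup>2 / 4 + \<bar>(y - m) / 2\<bar> * \<delta>) * t"
          using y(1) \<delta>2 t \<epsilon> by (intro mult_right_mono) linarith+
        have exp_le: "1 / 2 * exp (- ((x - m)\<^sup>2 / 4 + \<epsilon>) * t) \<le> 1 / 2 * exp (- ((y - m)\<^sup>2 / 4 + \<bar>(y - m) / 2\<bar> * \<delta>) * t)"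
          by (rule mult_left_mono[OF iffD2[OF exp_le_cancel_iff exponent_le]]) simp
        have prob_le: "prob {\<omega> \<in> space M. (y - \<delta>) * t < D t \<omega> \<and> D t \<omega> < (y + \<delta>) * t} \<le> prob {\<omega> \<in> space M. D t \<omega> / t \<in> G}"
        proof (rule finite_measure_mono)
          have "z / t \<in> G" if "(y - \<delta>) * t < z" "z < (y + \<delta>) * t" for z
          proof -
            have "y - \<delta> < z / t" "z / t < y + \<delta>" using that t by (auto simp: field_simps)
            then have "z / t \<in> ball y \<delta>0" using \<delta>(2) by (auto simp: dist_real_def)
            then show ?thesis using \<delta>0(2) by blast
          qed
          then show "{\<omega> \<in> space M. (y - \<delta>) * t < D t \<omega> \<and> D t \<omega> < (y + \<delta>) * t} \<subseteq> {\<omega> \<in> space M. D t \<omega> / t \<in> G}"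
            by blast
          have "(\<lambda>\<omega>. D t \<omega> / t) \<in> borel_measurable M" by measurable
          from measurable_sets[OF this borel_open[OF G]]
          show "{\<omega> \<in> space M. D t \<omega> / t \<in> G} \<in> events" by (simp add: vimage_def Int_def conj_commute)
        qed
        show ?case by (rule order_trans[OF order_trans[OF exp_le le] prob_le])
      qed
      then have "- ereal ((x - m)\<^sup>2 / 4 + \<epsilon>) \<le> ?L" by (rule Liminf_elog_ge)
      from add_right_mono[OF this, of "ereal \<epsilon>"]
      have "- ereal ((x - m)\<^sup>2 / 4 + \<epsilon>) + ereal \<epsilon> \<le> ?L + ereal \<epsilon>" .
      moreover have "- ereal ((x - m)\<^sup>2 / 4 + \<epsilon>) + ereal \<epsilon> = - ereal ((x - m)\<^sup>2 / 4)"
        by simp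
      ultimately show ?thesis by (simp only:)
    qed
    have "- ereal ((x - m)\<^sup>2 / 4) \<le> ?L"
      by (rule ereal_le_epsilon2[OF eps])
    then show ?thesis using True by (simp add: I1_def n)
  qed
  then have "- ?L \<le> - (- I1 n x)" if "x \<in> G" for x
    using that by (simp only: ereal_minus_le_minus)
  then have "- ?L \<le> (INF x\<in>G. I1 n x)"
    by (intro INF_greatest) simp
  then have "- (INF x\<in>G. I1 n x) \<le> - (- ?L)"
    by (simp only: ereal_minus_le_minus)
  then show "- (INF x\<in>G. I1 n x) \<le> ?L" by simp
qed

end

section \<open>Affine isometries and the heat kernel\<close>

text \<open>
  The isometry z \<mapsto> (x' + y' x, y' y) for w = (x', y'); it maps the origin to w. These maps make the
  half-space a group.
\<close>


definition aff :: "'m::finite hpoint \<Rightarrow> 'm hpoint \<Rightarrow> 'm hpoint" where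
  "aff w z = (fst w, 0) + snd w *\<^sub>R z"

text \<open>
  The inverse of w in this group.
\<close>

definition ginv :: "'m::finite hpoint \<Rightarrow> 'm hpoint" where
  "ginv w = (- (1 / snd w) *\<^sub>R fst w, 1 / snd w)"

lemma snd_aff: "snd (aff w z) = snd w * snd z"
  by (auto simp: aff_def)

lemma ginv_in_hspace: "w \<in> hspace \<Longrightarrow> ginv w \<in> hspace"
  by (auto simp: hspace_def ginv_def)

lemma aff_in_hspace: "w \<in> hspace \<Longrightarrow> z \<in> hspace \<Longrightarrow> aff w z \<in> hspace"
  by (auto simp: hspace_def aff_def)

lemma horigin_in_hspace: "horigin \<in> hspace"
  by (auto simp: hspace_def horigin_def)

lemma aff_ginv: "w \<in> hspace \<Longrightarrow> aff w (aff (ginv w) z) = z"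
  and ginv_aff: "w \<in> hspace \<Longrightarrow> aff (ginv w) (aff w z) = z"
  by (auto simp: hspace_def aff_def ginv_def prod_eq_iff algebra_simps)

lemma aff_origin: "aff w horigin = w" and aff_ginv_self: "w \<in> hspace \<Longrightarrow> aff w (ginv w) = horigin"
  and aff_ginv_self': "w \<in> hspace \<Longrightarrow> aff (ginv w) w = horigin"
  by (auto simp: aff_def horigin_def hspace_def ginv_def prod_eq_iff)

lemma aff_scale: "aff w (z + s *\<^sub>R b) = aff w z + (snd w * s) *\<^sub>R b"
  by (simp add: aff_def algebra_simps)

lemma open_hspace: "open (hspace :: 'm::finite hpoint set)"
  unfolding hspace_def by (intro open_Collect_less continuous_intros)

lemma sets_hspace[measurable]: "(hspace :: 'm::finite hpoint set) \<in> sets borel"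
  by (rule borel_open[OF open_hspace])

lemma fst_hpoint_measurable[measurable]: "fst \<in> borel_measurable (borel :: 'm::finite hpoint measure)"
  and snd_hpoint_measurable[measurable]: "snd \<in> borel_measurable (borel :: 'm::finite hpoint measure)"
  by (intro borel_measurable_continuous_onI continuous_intros)+

lemma continuous_on_aff[continuous_intros]:
  "continuous_on S f \<Longrightarrow> continuous_on S (\<lambda>x. aff w (f x))"
  unfolding aff_def by (intro continuous_intros)

lemma aff_measurable[measurable]: "aff w \<in> borel_measurable borel"
  by (intro borel_measurable_continuous_onI continuous_intros)

lemma dir_deriv_aff:
  assumes "(\<lambda>s. f (aff w z + s *\<^sub>R b)) differentiable (at 0)"
  shows "((\<lambda>s. f (aff w (z + s *\<^sub>R b))) has_real_derivative snd w * dir_deriv b f (aff w z)) (at 0)"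
proof -
  have "((\<lambda>s. f (aff w z + s *\<^sub>R b)) has_real_derivative dir_deriv b f (aff w z)) (at (snd w * 0))"
    using assms by (simp add: dir_deriv_def DERIV_deriv_iff_real_differentiable)
  moreover have "((\<lambda>s. snd w * s) has_real_derivative snd w) (at 0)"
    by (auto intro!: derivative_eq_intros)
  ultimately have "((\<lambda>s. f (aff w z + (snd w * s) *\<^sub>R b)) has_real_derivative dir_deriv b f (aff w z) * snd w) (at 0)"
    by (rule DERIV_chain2)
  then show ?thesis by (simp add: aff_scale mult.commute)
qed

lemma eventually_hspace_line:
  "z \<in> hspace \<Longrightarrow> eventually (\<lambda>s. z + s *\<^sub>R c \<in> hspace) (nhds (0::real))"
proof -
  assume "z \<in> hspace"
  have "open ((\<lambda>s. z + s *\<^sub>R c) -` hspace)"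
    by (intro continuous_open_vimage open_hspace continuous_intros)
  from eventually_nhds_in_open[OF this, of 0] show ?thesis
    using \<open>z \<in> hspace\<close> by simp
qed

lemma sum_Basis_hpoint:
  fixes h :: "'m::finite hpoint \<Rightarrow> real"
  shows "(\<Sum>b\<in>Basis. h b) = (\<Sum>i\<in>UNIV. h (axis i 1, 0)) + h (0, 1)"
proof -
  let ?e = "\<lambda>i. (axis i 1 :: real ^ 'm, 0 :: real)"
  have inj: "inj ?e"
    by (auto simp: inj_on_def axis_eq_axis)
  have "(Basis :: 'm hpoint set) = range ?e \<union> {(0, 1)}"
    by (auto simp: Basis_prod_def Basis_vec_def)
  then have "(\<Sum>b\<in>Basis. h b) = sum h (range ?e \<union> {(0, 1)})"
    by simp
  also have "\<dots> = sum h (range ?e) + sum h {(0, 1)}"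
    by (rule sum.union_disjoint) auto
  also have "sum h (range ?e) = (\<Sum>i\<in>UNIV. h (?e i))"
    by (simp add: sum.reindex[OF inj])
  finally show ?thesis by simp
qed

lemma hlaplacian_Basis:
  fixes f :: "'m::finite hpoint \<Rightarrow> real"
  shows "hlaplacian f z = (snd z)\<^sup>2 * (\<Sum>b\<in>Basis. dir_deriv b (dir_deriv b f) z)
     - (real (hdim TYPE('m)) - 2) * snd z * (\<Sum>b\<in>Basis. snd b * dir_deriv b f z)"
  unfolding hlaplacian_def sum_Basis_hpoint by simp

text \<open>
  The map scales all coordinate directions by the same factor, the height of w. First derivatives
  acquire this factor and second derivatives its square, which the coefficients y and y^2 of the
  Laplacian compensate.
\<close>

lemma heat_solution_aff:
  fixes u :: "'m::finite hpoint \<Rightarrow> real \<Rightarrow> real"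
  assumes u: "heat_solution u" and w: "w \<in> hspace"
  shows "heat_solution (\<lambda>z. u (aff w z))"
proof -
  define a where "a = snd w"
  have a: "0 < a" using w by (simp add: a_def hspace_def)
  note h = u[unfolded heat_solution_def]
  have d1: "dir_deriv b (\<lambda>z. u (aff w z) t) z = a * dir_deriv b (\<lambda>z. u z t) (aff w z)"
      "(\<lambda>s. u (aff w (z + s *\<^sub>R b)) t) differentiable (at 0)"
    if "b \<in> Basis" "z \<in> hspace" "0 < t" for b z t
  proof -
    have "(\<lambda>s. u (aff w z + s *\<^sub>R b) t) differentiable (at 0)"
      using h that aff_in_hspace[OF w] by blast
    from dir_deriv_aff[of "\<lambda>z. u z t", OF this]
    have "((\<lambda>s. u (aff w (z + s *\<^sub>R b)) t) has_real_derivative a * dir_deriv b (\<lambda>z. u z t) (aff w z)) (at 0)"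
      by (simp add: a_def)
    then show "dir_deriv b (\<lambda>z. u (aff w z) t) z = a * dir_deriv b (\<lambda>z. u z t) (aff w z)"
      "(\<lambda>s. u (aff w (z + s *\<^sub>R b)) t) differentiable (at 0)"
      by (auto simp: dir_deriv_def real_differentiable_def intro!: DERIV_imp_deriv)
  qed
  have d2: "((\<lambda>s. dir_deriv b (\<lambda>z. u (aff w z) t) (z + s *\<^sub>R c)) has_real_derivative
      a\<^sup>2 * dir_deriv c (dir_deriv b (\<lambda>z. u z t)) (aff w z)) (at 0)"
    if "b \<in> Basis" "c \<in> Basis" "z \<in> hspace" "0 < t" for b c z t
  proof -
    have "(\<lambda>s. dir_deriv b (\<lambda>z. u z t) (aff w z + s *\<^sub>R c)) differentiable (at 0)"
      using h that aff_in_hspace[OF w] by blast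
    from dir_deriv_aff[OF this]
    have "((\<lambda>s. a * dir_deriv b (\<lambda>z. u z t) (aff w (z + s *\<^sub>R c))) has_real_derivative
        a * (a * dir_deriv c (dir_deriv b (\<lambda>z. u z t)) (aff w z))) (at 0)"
      unfolding a_def by (rule DERIV_cmult)
    moreover have "eventually (\<lambda>s. a * dir_deriv b (\<lambda>z. u z t) (aff w (z + s *\<^sub>R c)) =
        dir_deriv b (\<lambda>z. u (aff w z) t) (z + s *\<^sub>R c)) (nhds 0)"
      using eventually_hspace_line[OF that(3), of c]
      by (rule eventually_mono) (simp add: d1(1)[OF that(1) _ that(4)])
    ultimately show ?thesis
      by (subst (asm) DERIV_cong_ev[OF refl _ refl]) (auto simp: power2_eq_square mult.assoc)
  qed
  have d2': "dir_deriv c (dir_deriv b (\<lambda>z. u (aff w z) t)) z = a\<^sup>2 * dir_deriv c (dir_deriv b (\<lambda>z. u z t)) (aff w z)"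
    if "b \<in> Basis" "c \<in> Basis" "z \<in> hspace" "0 < t" for b c z t
    using d2[OF that] unfolding dir_deriv_def[of c] by (rule DERIV_imp_deriv)
  have comp: "continuous_on (hspace \<times> {0<..}) (\<lambda>(z, t). g (aff w z) t)"
    if "continuous_on (hspace \<times> {0<..}) (\<lambda>(z, t). g z t)" for g :: "'m hpoint \<Rightarrow> real \<Rightarrow> real"
  proof -
    have "continuous_on (hspace \<times> {0<..}) (\<lambda>x. (\<lambda>(z, t). g z t) (aff w (fst x), snd x))"
      by (rule continuous_on_compose2[OF that])
        (auto intro!: continuous_intros aff_in_hspace[OF w])
    then show ?thesis by (simp add: case_prod_unfold)
  qed
  show ?thesis
    unfolding heat_solution_def
  proof (intro conjI ballI allI impI)
    fix z :: "'m hpoint" and t :: real assume z: "z \<in> hspace" and t: "0 < t"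
    show "u (aff w z) differentiable (at t)"
      using h aff_in_hspace[OF w z] t by blast
    have "hlaplacian (\<lambda>z. u (aff w z) t) z = hlaplacian (\<lambda>z. u z t) (aff w z)"
      unfolding hlaplacian_Basis using z t d1(1) d2'
      by (simp add: snd_aff a_def[symmetric] power_mult_distrib sum_distrib_left mult_ac)
    then show "deriv (u (aff w z)) t = hlaplacian (\<lambda>z. u (aff w z) t) z"
      using h aff_in_hspace[OF w z] t by simp
  next
    show "continuous_on (hspace \<times> {0<..}) (\<lambda>(z, t). deriv (u (aff w z)) t)"
      by (rule comp[of "\<lambda>z. deriv (u z)"]) (use h in blast)
  next
    fix b z :: "'m hpoint" and t :: real assume "b \<in> Basis" "z \<in> hspace" "0 < t"
    then show "(\<lambda>s. u (aff w (z + s *\<^sub>R b)) t) differentiable (at 0)" by (rule d1(2))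
  next
    fix b :: "'m hpoint" assume b: "b \<in> Basis"
    have "continuous_on (hspace \<times> {0<..}) (\<lambda>(z, t). dir_deriv b (\<lambda>z. u z t) z)"
      using h b by blast
    from comp[OF this]
    have "continuous_on (hspace \<times> {0<..}) (\<lambda>x. a * (\<lambda>(z, t). dir_deriv b (\<lambda>z. u z t) (aff w z)) x)"
      by (intro continuous_intros)
    then show "continuous_on (hspace \<times> {0<..}) (\<lambda>(z, t). dir_deriv b (\<lambda>z. u (aff w z) t) z)"
      by (rule continuous_on_eq) (auto simp: d1(1)[OF b])
  next
    fix b c z :: "'m hpoint" and t :: real assume "b \<in> Basis" "c \<in> Basis" "z \<in> hspace" "0 < t"
    from d2[OF this] show "(\<lambda>s. dir_deriv b (\<lambda>z. u (aff w z) t) (z + s *\<^sub>R c)) differentiable (at 0)"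
      by (auto simp: real_differentiable_def)
  next
    fix b c :: "'m hpoint" assume b: "b \<in> Basis" "c \<in> Basis"
    have "continuous_on (hspace \<times> {0<..}) (\<lambda>(z, t). dir_deriv c (dir_deriv b (\<lambda>z. u z t)) z)"
      using h b by blast
    from comp[OF this]
    have "continuous_on (hspace \<times> {0<..}) (\<lambda>x. a\<^sup>2 * (\<lambda>(z, t). dir_deriv c (dir_deriv b (\<lambda>z. u z t)) (aff w z)) x)"
      by (intro continuous_intros)
    then show "continuous_on (hspace \<times> {0<..}) (\<lambda>(z, t). dir_deriv c (dir_deriv b (\<lambda>z. u (aff w z) t)) z)"
      by (rule continuous_on_eq) (auto simp: d2'[OF b])
  qed
qed

lemma sets_hvolume: "sets (hvolume :: 'm::finite hpoint measure) = sets (restrict_space borel hspace)"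
  unfolding hvolume_def by (simp add: sets_restrict_space)

lemma space_hvolume: "space (hvolume :: 'm::finite hpoint measure) = hspace"
  unfolding hvolume_def by (simp add: space_restrict_space)

lemma nn_integral_hvolume:
  fixes f :: "'m::finite hpoint \<Rightarrow> ennreal"
  assumes [measurable]: "f \<in> borel_measurable borel"
  shows "(\<integral>\<^sup>+ z. f z \<partial>hvolume) = (\<integral>\<^sup>+ z. f z * ennreal (1 / snd z ^ hdim TYPE('m)) * indicator hspace z \<partial>lborel)"
  unfolding hvolume_def
  apply (subst nn_integral_density)
  subgoal by (rule measurable_restrict_space1) measurable
  subgoal by (rule measurable_restrict_space1) measurable
  apply (subst nn_integral_restrict_space)
   apply (auto simp: mult_ac)
  done

lemma aff_measurable_hvolume:
  fixes w :: "'m::finite hpoint"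
  assumes "w \<in> hspace"
  shows "aff w \<in> measurable hvolume hvolume"
proof -
  have "aff w \<in> measurable (restrict_space borel hspace) (restrict_space borel hspace)"
    by (rule measurable_restrict_space3[OF aff_measurable]) (auto intro: aff_in_hspace[OF assms])
  then show ?thesis
    by (simp cong: measurable_cong_sets add: sets_hvolume)
qed

text \<open>
  Lebesgue measure is scaled by the n-th power of the height of w, and so is the weight y^n.
\<close>

lemma distr_hvolume_aff:
  fixes w :: "'m::finite hpoint"
  assumes w: "w \<in> hspace"
  shows "distr hvolume hvolume (aff w) = hvolume"
proof (rule measure_eqI)
  define a where "a = snd w"
  define n where "n = hdim TYPE('m)"
  have a: "0 < a" using w by (simp add: a_def hspace_def)
  note meas = aff_measurable_hvolume[OF w]
  show "sets (distr hvolume hvolume (aff w)) = sets hvolume" by simp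
  fix A assume "A \<in> sets (distr hvolume hvolume (aff w))"
  then have A: "A \<in> sets hvolume" by simp
  then have A': "A \<subseteq> hspace" and [measurable]: "A \<in> sets borel"
    by (auto simp: sets_hvolume sets_restrict_space)
  have [measurable]: "aff w -` A \<in> sets borel"
    using measurable_sets[OF aff_measurable[of w], of A] by simp
  let ?g = "\<lambda>z::'m hpoint. indicator A z * ennreal (1 / snd z ^ n) * indicator hspace z :: ennreal"
  have "emeasure (distr hvolume hvolume (aff w)) A = emeasure hvolume (aff w -` A \<inter> hspace)"
    using A meas by (simp add: emeasure_distr space_hvolume)
  also have "\<dots> = (\<integral>\<^sup>+ z. indicator (aff w -` A \<inter> hspace) z \<partial>hvolume)"
    by (rule nn_integral_indicator[symmetric]) (simp add: sets_hvolume sets_restrict_space_iff)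
  also have "\<dots> = (\<integral>\<^sup>+ z. indicator (aff w -` A \<inter> hspace) z * ennreal (1 / snd z ^ n) * indicator hspace z \<partial>lborel)"
    unfolding n_def by (rule nn_integral_hvolume) measurable
  also have "\<dots> = (\<integral>\<^sup>+ z. ?g (aff w z) * ennreal (a ^ n) \<partial>lborel)"
  proof (rule nn_integral_cong)
    fix z :: "'m hpoint"
    have iff: "aff w z \<in> hspace \<longleftrightarrow> z \<in> hspace"
      using a by (auto simp: hspace_def snd_aff a_def zero_less_mult_iff)
    show "indicator (aff w -` A \<inter> hspace) z * ennreal (1 / snd z ^ n) * indicator hspace z = ?g (aff w z) * ennreal (a ^ n)"
      using a iff
      by (auto simp: snd_aff a_def[symmetric] power_mult_distrib hspace_def simp flip: ennreal_mult split: split_indicator)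
  qed
  also have "\<dots> = (\<integral>\<^sup>+ z. ?g z \<partial>lborel)"
  proof -
    have "lborel = density (distr lborel borel (aff w)) (\<lambda>_. ennreal (a ^ n))"
      using lborel_affine[of a "(fst w, 0) :: 'm hpoint"] a
      by (simp add: aff_def[abs_def] a_def[symmetric] n_def hdim_def)
    then have "(\<integral>\<^sup>+ z. ?g z \<partial>lborel) = (\<integral>\<^sup>+ z. ?g z \<partial>density (distr lborel borel (aff w)) (\<lambda>_. ennreal (a ^ n)))"
      by simp
    also have "\<dots> = (\<integral>\<^sup>+ z. ?g (aff w z) * ennreal (a ^ n) \<partial>lborel)"
      by (simp add: nn_integral_density nn_integral_distr mult.commute)
    finally show ?thesis by simp
  qed
  also have "\<dots> = (\<integral>\<^sup>+ z. indicator A z \<partial>hvolume)"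
    unfolding n_def by (rule nn_integral_hvolume[symmetric]) measurable
  also have "\<dots> = emeasure hvolume A"
    by (rule nn_integral_indicator[OF A])
  finally show "emeasure (distr hvolume hvolume (aff w)) A = emeasure hvolume A" .
qed

lemma integral_hvolume_aff:
  fixes F :: "'m::finite hpoint \<Rightarrow> real"
  assumes w: "w \<in> hspace"
  shows "(LINT z|hvolume. F (aff w z)) = (LINT z|hvolume. F z)"
proof (cases "F \<in> borel_measurable hvolume")
  case True
  then have "(LINT z|distr hvolume hvolume (aff w). F z) = (LINT z|hvolume. F (aff w z))"
    by (intro integral_distr aff_measurable_hvolume w)
  then show ?thesis by (simp add: distr_hvolume_aff[OF w])
next
  case False
  have "(\<lambda>z. F (aff w z)) \<notin> borel_measurable hvolume"
  proof
    assume "(\<lambda>z. F (aff w z)) \<in> borel_measurable hvolume"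
    from measurable_compose[OF aff_measurable_hvolume[OF ginv_in_hspace[OF w]] this]
    have "F \<in> borel_measurable hvolume" by (simp add: aff_ginv[OF w])
    then show False using False by blast
  qed
  then have "\<not> integrable hvolume (\<lambda>z. F (aff w z))" "\<not> integrable hvolume F"
    using False by auto
  then show ?thesis by (simp add: not_integrable_integral_eq)
qed

lemma fundamental_solution_aff:
  fixes u :: "'m::finite hpoint \<Rightarrow> real \<Rightarrow> real"
  assumes u: "fundamental_solution (aff w p) u" and w: "w \<in> hspace" and p: "p \<in> hspace"
  shows "fundamental_solution p (\<lambda>z. u (aff w z))"
  unfolding fundamental_solution_def
proof (intro conjI ballI allI impI)
  note h = u[unfolded fundamental_solution_def]
  show "heat_solution (\<lambda>z. u (aff w z))"
    using h w by (intro heat_solution_aff) auto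
  show "0 \<le> u (aff w z) t" if "z \<in> hspace" "0 < t" for z t
    using h aff_in_hspace[OF w that(1)] that(2) by blast
  fix f :: "'m hpoint \<Rightarrow> real"
  assume f: "continuous_on hspace f \<and> bounded (f ` hspace)"
  let ?f = "\<lambda>z. f (aff (ginv w) z)"
  have gw: "ginv w \<in> hspace" by (rule ginv_in_hspace[OF w])
  have "continuous_on hspace ?f"
    by (rule continuous_on_compose2[of hspace f]) (use f gw in \<open>auto intro!: continuous_intros aff_in_hspace\<close>)
  moreover have "bounded (?f ` hspace)"
    using f by (auto intro: bounded_subset simp: aff_in_hspace[OF gw] image_subset_iff)
  ultimately have "((\<lambda>t. LINT z|hvolume. u z t * ?f z) \<longlongrightarrow> ?f (aff w p)) (at_right 0)"
    using h by blast
  moreover have "(LINT z|hvolume. u z t * ?f z) = (LINT z|hvolume. u (aff w z) t * f z)" for t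
    using integral_hvolume_aff[OF w, of "\<lambda>z. u z t * ?f z"] by (simp add: ginv_aff[OF w])
  ultimately show "((\<lambda>t. LINT z|hvolume. u (aff w z) t * f z) \<longlongrightarrow> f p) (at_right 0)"
    by (simp add: ginv_aff[OF w])
qed

text \<open>
  Each side, moved by the isometry of w or of its inverse, is a fundamental solution with the pole of
  the other one; minimality of the heat kernel gives both inequalities.
\<close>

lemma heat_kernel_ginv:
  fixes k :: "'m::finite hpoint \<Rightarrow> 'm hpoint \<Rightarrow> real \<Rightarrow> real"
  assumes k: "heat_kernel k" and w: "w \<in> hspace" and t: "0 < t"
  shows "k horigin w t = k (ginv w) horigin t"
proof (rule antisym)
  note gw = ginv_in_hspace[OF w]
  have fund: "fundamental_solution p (\<lambda>z. k z p)" if "p \<in> hspace" for p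
    using k that by (auto simp: heat_kernel_def)
  have min: "k z p t \<le> u z t" if "p \<in> hspace" "fundamental_solution p u" "z \<in> hspace" for z p u
    using k that t by (auto simp: heat_kernel_def)
  have "fundamental_solution horigin (\<lambda>z. k (aff w z) w)"
    by (rule fundamental_solution_aff) (use fund[OF w] w in \<open>auto simp: aff_origin horigin_in_hspace\<close>)
  from min[OF horigin_in_hspace this gw] show "k (ginv w) horigin t \<le> k horigin w t"
    by (simp add: aff_ginv_self[OF w])
  have "fundamental_solution w (\<lambda>z. k (aff (ginv w) z) horigin)"
    by (rule fundamental_solution_aff)
      (use fund[OF horigin_in_hspace] w gw in \<open>auto simp: aff_ginv_self'\<close>)
  from min[OF w this horigin_in_hspace] show "k horigin w t \<le> k (ginv w) horigin t"
    by (simp add: aff_origin)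
qed

section \<open>The law of the inverted motion\<close>

text \<open>
  Exhaustion of the real line by the intervals [-j, j], on which the substitution rule applies.
\<close>


lemma nn_integral_exp_substitution:
  fixes G :: "real \<Rightarrow> ennreal"
  assumes [measurable]: "G \<in> borel_measurable borel"
  shows "(\<integral>\<^sup>+ u. G (exp u) \<partial>lborel) = (\<integral>\<^sup>+ y. G y * ennreal (1 / y) * indicator {0<..} y \<partial>lborel)"
proof -
  define M1 where "M1 = density lborel (\<lambda>u::real. G (exp u))"
  define M2 where "M2 = density lborel (\<lambda>y. G y * ennreal (1 / y))"
  define A where "A j = {- real j..real j}" for j
  define B where "B j = {exp (- real j)..exp (real j)}" for j
  have UA: "(\<Union>j. A j) = UNIV"
  proof -
    have "u \<in> (\<Union>j. A j)" for u
    proof -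
      obtain j where "\<bar>u\<bar> \<le> real j" using real_arch_simple by blast
      then have "u \<in> A j" by (auto simp: A_def)
      then show ?thesis by blast
    qed
    then show ?thesis by blast
  qed
  have UB: "(\<Union>j. B j) = {0<..}"
  proof -
    have "y \<in> (\<Union>j. B j) \<longleftrightarrow> y \<in> {0<..}" for y
    proof
      assume "y \<in> {0<..}"
      then have y: "0 < y" by simp
      obtain j where "\<bar>ln y\<bar> \<le> real j" using real_arch_simple by blast
      then have "- real j \<le> ln y" "ln y \<le> real j" by auto
      then have "exp (- real j) \<le> exp (ln y)" "exp (ln y) \<le> exp (real j)" by (simp_all only: exp_le_cancel_iff)
      then show "y \<in> (\<Union>j. B j)" using y by (auto simp: B_def)
    next
      assume "y \<in> (\<Union>j. B j)"
      then obtain j where "exp (- real j) \<le> y" by (auto simp: B_def)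
      then show "y \<in> {0<..}" using less_le_trans[OF exp_gt_zero[of "- real j"]] by simp
    qed
    then show ?thesis by blast
  qed
  have incA: "incseq A" and incB: "incseq B"
    by (auto simp: incseq_def A_def B_def)
  have eq: "emeasure M1 (A j) = emeasure M2 (B j)" for j
  proof (cases "j = 0")
    case True
    have "emeasure lborel (A j) = 0" "emeasure lborel (B j) = 0" by (simp_all add: True A_def B_def)
    moreover have "A j \<in> sets lborel" "B j \<in> sets lborel" by (simp_all add: A_def B_def)
    ultimately have "A j \<in> null_sets lborel" "B j \<in> null_sets lborel" by auto
    then have "A j \<in> null_sets M1" "B j \<in> null_sets M2"
      unfolding M1_def M2_def
      using absolutely_continuousI_density[of "\<lambda>u. G (exp u)" lborel]
        absolutely_continuousI_density[of "\<lambda>y. G y * ennreal (1 / y)" lborel]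
      by (auto simp: absolutely_continuous_def)
    then show ?thesis by (simp add: null_setsD1)
  next
    case False
    have "emeasure M2 (B j) = (\<integral>\<^sup>+ x. (G x * ennreal (1 / x)) * indicator {exp (- real j)..exp (real j)} x \<partial>lborel)"
      unfolding M2_def B_def by (rule emeasure_density) measurable
    also have "\<dots> = (\<integral>\<^sup>+ x. (G (exp x) * ennreal (1 / exp x)) * ennreal (exp x) * indicator {- real j..real j} x \<partial>lborel)"
      by (rule nn_integral_substitution_aux)
        (use False in \<open>auto intro!: derivative_eq_intros continuous_intros\<close>)
    also have "\<dots> = (\<integral>\<^sup>+ x. G (exp x) * indicator {- real j..real j} x \<partial>lborel)"
      by (rule nn_integral_cong) (simp add: mult.assoc flip: ennreal_mult)
    also have "\<dots> = emeasure M1 (A j)"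
      unfolding M1_def A_def by (rule emeasure_density[symmetric]) measurable
    finally show ?thesis by simp
  qed
  have "(\<integral>\<^sup>+ u. G (exp u) \<partial>lborel) = emeasure M1 (\<Union>j. A j)"
    by (simp add: UA M1_def emeasure_density)
  also have "\<dots> = (SUP j. emeasure M1 (A j))"
    by (rule SUP_emeasure_incseq[symmetric, OF _ incA]) (auto simp: M1_def A_def)
  also have "\<dots> = (SUP j. emeasure M2 (B j))"
    by (simp add: eq)
  also have "\<dots> = emeasure M2 (\<Union>j. B j)"
    by (rule SUP_emeasure_incseq[OF _ incB]) (auto simp: M2_def B_def)
  also have "\<dots> = (\<integral>\<^sup>+ y. G y * ennreal (1 / y) * indicator {0<..} y \<partial>lborel)"
    unfolding UB M2_def by (rule emeasure_density) measurable
  finally show ?thesis .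
qed

text \<open>
  dy / y is the Haar measure of the positive reals; in the coordinate u = ln y the inversion is a
  reflection.
\<close>

lemma nn_integral_inverse_substitution:
  fixes G :: "real \<Rightarrow> ennreal"
  assumes [measurable]: "G \<in> borel_measurable borel"
  shows "(\<integral>\<^sup>+ y. G (1 / y) * ennreal (1 / y) * indicator {0<..} y \<partial>lborel)
       = (\<integral>\<^sup>+ y. G y * ennreal (1 / y) * indicator {0<..} y \<partial>lborel)"
proof -
  have "(\<integral>\<^sup>+ y. G (1 / y) * ennreal (1 / y) * indicator {0<..} y \<partial>lborel) = (\<integral>\<^sup>+ u. G (1 / exp u) \<partial>lborel)"
    by (rule nn_integral_exp_substitution[symmetric]) measurable
  also have "\<dots> = (\<integral>\<^sup>+ u. G (exp (- u)) \<partial>lborel)"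
    by (simp add: exp_minus inverse_eq_divide)
  also have "\<dots> = (\<integral>\<^sup>+ u. G (exp u) \<partial>distr lborel borel uminus)"
    by (simp add: nn_integral_distr)
  also have "\<dots> = (\<integral>\<^sup>+ u. G (exp u) \<partial>lborel)"
    by (simp add: lborel_distr_uminus)
  also have "\<dots> = (\<integral>\<^sup>+ y. G y * ennreal (1 / y) * indicator {0<..} y \<partial>lborel)"
    by (rule nn_integral_exp_substitution) measurable
  finally show ?thesis .
qed

lemma nn_integral_lborel_hpoint:
  fixes f :: "'m::finite hpoint \<Rightarrow> ennreal"
  assumes [measurable]: "f \<in> borel_measurable borel"
  shows "(\<integral>\<^sup>+ z. f z \<partial>lborel) = (\<integral>\<^sup>+ y. (\<integral>\<^sup>+ x. f (x, y) \<partial>lborel) \<partial>lborel)"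
proof -
  have "f \<in> borel_measurable (lborel \<Otimes>\<^sub>M lborel)"
    by (simp add: lborel_prod)
  from lborel_pair.nn_integral_snd[OF this]
  show ?thesis by (simp add: lborel_prod)
qed

lemma nn_integral_lborel_scaleR:
  fixes f :: "'a::euclidean_space \<Rightarrow> ennreal"
  assumes [measurable]: "f \<in> borel_measurable borel" and c: "c \<noteq> 0"
  shows "(\<integral>\<^sup>+ x. f (c *\<^sub>R x) \<partial>lborel) = ennreal (1 / \<bar>c\<bar> ^ DIM('a)) * (\<integral>\<^sup>+ x. f x \<partial>lborel)"
proof -
  have "lborel = density (distr lborel borel (\<lambda>x::'a. c *\<^sub>R x)) (\<lambda>_. ennreal (\<bar>c\<bar> ^ DIM('a)))"
    using lborel_affine[OF c, of "0::'a"] by simp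
  then have "(\<integral>\<^sup>+ x. f x \<partial>lborel) = (\<integral>\<^sup>+ x. f x \<partial>density (distr lborel borel (\<lambda>x. c *\<^sub>R x)) (\<lambda>_. ennreal (\<bar>c\<bar> ^ DIM('a))))"
    by simp
  also have "\<dots> = ennreal (\<bar>c\<bar> ^ DIM('a)) * (\<integral>\<^sup>+ x. f (c *\<^sub>R x) \<partial>lborel)"
    by (simp add: nn_integral_density nn_integral_distr nn_integral_cmult)
  finally have "ennreal (1 / \<bar>c\<bar> ^ DIM('a)) * (\<integral>\<^sup>+ x. f x \<partial>lborel)
      = (ennreal (1 / \<bar>c\<bar> ^ DIM('a)) * ennreal (\<bar>c\<bar> ^ DIM('a))) * (\<integral>\<^sup>+ x. f (c *\<^sub>R x) \<partial>lborel)"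
    by (simp add: mult.assoc)
  also have "ennreal (1 / \<bar>c\<bar> ^ DIM('a)) * ennreal (\<bar>c\<bar> ^ DIM('a)) = 1"
    using c by (simp flip: ennreal_mult)
  finally show ?thesis by simp
qed

lemma ginv_measurable[measurable]: "ginv \<in> borel_measurable (borel :: 'm::finite hpoint measure)"
  unfolding ginv_def by measurable

text \<open>
  Group inversion takes the left Haar measure, which is the hyperbolic volume y^(-n) dx dy, to the right
  Haar measure y^(-1) dx dy: the fibre over y contributes y^(n - 1) by scaling, and the remaining
  integral is over dy / y.
\<close>

lemma distr_ginv:
  "distr (density lborel (\<lambda>z::'m::finite hpoint. ennreal (1 / snd z ^ hdim TYPE('m)) * indicator hspace z)) borel ginv
     = density lborel (\<lambda>z. ennreal (1 / snd z) * indicator hspace z)"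
    (is "distr ?V borel ginv = ?W")
proof (rule measure_eqI)
  fix A assume "A \<in> sets (distr ?V borel ginv)"
  then have [measurable]: "A \<in> sets borel" by simp
  define m where "m = CARD('m)"
  define H where "H y = (\<integral>\<^sup>+ x. indicator A (x::real ^ 'm, y) \<partial>lborel)" for y :: real
  have [measurable]: "(\<lambda>z::'m hpoint. indicator A z :: ennreal) \<in> borel_measurable borel" by measurable
  have Hm[measurable]: "H \<in> borel_measurable borel"
  proof -
    have "(\<lambda>z. indicator A (snd z, fst z) :: ennreal) \<in> borel_measurable (borel \<Otimes>\<^sub>M lborel)"
    proof -
      have "(\<lambda>z::real \<times> (real ^ 'm). indicator A (snd z, fst z) :: ennreal) \<in> borel_measurable borel"
        by (rule measurable_compose[of "\<lambda>z. (snd z, fst z)" _ borel])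
          (auto intro!: borel_measurable_continuous_onI continuous_intros)
      then show ?thesis by (simp add: borel_prod cong: measurable_cong_sets)
    qed
    from lborel.borel_measurable_nn_integral_fst[OF this]
    show ?thesis by (simp add: H_def[abs_def])
  qed
  have pos: "(indicator hspace (x :: real ^ 'm, y) :: ennreal) = indicator {0<..} y" for x y
    by (simp add: hspace_def indicator_def)
  have gA[measurable]: "ginv -` A \<in> sets borel"
    using measurable_sets[OF ginv_measurable, of A] by simp
  have "emeasure (distr ?V borel ginv) A = emeasure ?V (ginv -` A)"
    by (subst emeasure_distr) simp_all
  also have "\<dots> = (\<integral>\<^sup>+ z. (ennreal (1 / snd z ^ hdim TYPE('m)) * indicator hspace z) * indicator (ginv -` A) z \<partial>lborel)"
    by (rule emeasure_density; measurable)
  also have "\<dots> = (\<integral>\<^sup>+ z. indicator A (ginv z) * ennreal (1 / snd z ^ hdim TYPE('m)) * indicator hspace z \<partial>lborel)"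
    by (rule nn_integral_cong) (simp add: indicator_def)
  also have "\<dots> = (\<integral>\<^sup>+ y. (\<integral>\<^sup>+ x. indicator A (ginv (x, y)) * ennreal (1 / snd (x, y) ^ hdim TYPE('m)) * indicator hspace (x :: real ^ 'm, y) \<partial>lborel) \<partial>lborel)"
    by (rule nn_integral_lborel_hpoint) measurable
  also have "\<dots> = (\<integral>\<^sup>+ y. (\<integral>\<^sup>+ x. indicator A (- (1 / y) *\<^sub>R x, 1 / y) * ennreal (1 / y ^ hdim TYPE('m)) * indicator {0<..} y \<partial>lborel) \<partial>lborel)"
    by (simp only: ginv_def pos fst_conv snd_conv)
  also have "\<dots> = (\<integral>\<^sup>+ y. H (1 / y) * ennreal (1 / y) * indicator {0<..} y \<partial>lborel)"
  proof (rule nn_integral_cong)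
    fix y :: real
    show "(\<integral>\<^sup>+ x. indicator A (- (1 / y) *\<^sub>R x, 1 / y) * ennreal (1 / y ^ hdim TYPE('m)) * indicator {0<..} y \<partial>lborel)
       = H (1 / y) * ennreal (1 / y) * indicator {0<..} y"
    proof (cases "0 < y")
      case True
      have ind_m[measurable]: "(\<lambda>x. indicator A (x, 1 / y) :: ennreal) \<in> borel_measurable borel"
        by (rule measurable_compose[of "\<lambda>x. (x, 1 / y)" _ borel])
          (auto intro!: borel_measurable_continuous_onI continuous_intros)
      have ind_m2[measurable]: "(\<lambda>x. indicator A (- (1 / y) *\<^sub>R x, 1 / y) :: ennreal) \<in> borel_measurable borel"
        by (rule measurable_compose[of "\<lambda>x. (- (1 / y) *\<^sub>R x, 1 / y)" _ borel])
          (auto intro!: borel_measurable_continuous_onI continuous_intros)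
      have "(\<integral>\<^sup>+ x. indicator A (- (1 / y) *\<^sub>R x, 1 / y) * ennreal (1 / y ^ hdim TYPE('m)) * indicator {0<..} y \<partial>lborel)
        = (\<integral>\<^sup>+ x. indicator A (- (1 / y) *\<^sub>R x, 1 / y) \<partial>lborel) * ennreal (1 / y ^ hdim TYPE('m))"
        using True by (simp add: nn_integral_multc)
      also have "(\<integral>\<^sup>+ x. indicator A (- (1 / y) *\<^sub>R x, 1 / y) \<partial>lborel) = ennreal (1 / \<bar>- (1 / y)\<bar> ^ m) * H (1 / y)"
        unfolding H_def using nn_integral_lborel_scaleR[OF ind_m, of "- (1 / y)"] True by (simp add: m_def)
      also have "1 / \<bar>- (1 / y)\<bar> ^ m = y ^ m"
        using True by (simp add: power_divide)
      also have "ennreal (y ^ m) * H (1 / y) * ennreal (1 / y ^ hdim TYPE('m)) = H (1 / y) * (ennreal (y ^ m) * ennreal (1 / y ^ hdim TYPE('m)))"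
        by (simp add: mult_ac)
      also have "ennreal (y ^ m) * ennreal (1 / y ^ hdim TYPE('m)) = ennreal (1 / y)"
        using True by (simp add: hdim_def m_def flip: ennreal_mult)
      finally show ?thesis using True by simp
    qed simp
  qed
  also have "\<dots> = (\<integral>\<^sup>+ y. H y * ennreal (1 / y) * indicator {0<..} y \<partial>lborel)"
    by (rule nn_integral_inverse_substitution) measurable
  also have "\<dots> = (\<integral>\<^sup>+ y. (\<integral>\<^sup>+ x. indicator A (x, y) * ennreal (1 / y) * indicator {0<..} y \<partial>lborel) \<partial>lborel)"
  proof (rule nn_integral_cong)
    fix y :: real
    have [measurable]: "(\<lambda>x. indicator A (x, y) :: ennreal) \<in> borel_measurable borel"
      by (rule measurable_compose[of "\<lambda>x. (x, y)" _ borel])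
        (auto intro!: borel_measurable_continuous_onI continuous_intros)
    show "H y * ennreal (1 / y) * indicator {0<..} y = (\<integral>\<^sup>+ x. indicator A (x, y) * ennreal (1 / y) * indicator {0<..} y \<partial>lborel)"
      unfolding H_def by (simp add: nn_integral_multc)
  qed
  also have "\<dots> = (\<integral>\<^sup>+ y. (\<integral>\<^sup>+ x. indicator A (x, y) * ennreal (1 / snd (x, y)) * indicator hspace (x :: real ^ 'm, y) \<partial>lborel) \<partial>lborel)"
    by (simp only: pos snd_conv)
  also have "\<dots> = (\<integral>\<^sup>+ z. indicator A z * ennreal (1 / snd z) * indicator hspace z \<partial>lborel)"
    by (rule nn_integral_lborel_hpoint[symmetric]) measurable
  also have "\<dots> = (\<integral>\<^sup>+ z. (ennreal (1 / snd z) * indicator hspace z) * indicator A z \<partial>lborel)"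
    by (simp only: mult_ac)
  also have "\<dots> = emeasure ?W A"
    by (rule emeasure_density[symmetric]; measurable)
  finally show "emeasure (distr ?V borel ginv) A = emeasure ?W A" .
qed simp

text \<open>
  The Markov property at time 0, where the motion is at a, and integration of the conditional
  probability.
\<close>

lemma prob_hyperbolic_brownian_motion:
  fixes k :: "'m::finite hpoint \<Rightarrow> 'm hpoint \<Rightarrow> real \<Rightarrow> real"
    and M :: "'w measure" and Z :: "real \<Rightarrow> 'w \<Rightarrow> 'm hpoint"
  assumes bm: "hyperbolic_brownian_motion k a M Z" and t: "0 < t" and A: "A \<in> sets borel"
  shows "measure M (Z t -` A \<inter> space M) = (LINT w:A|hvolume. k a w t)"
proof -
  interpret prob_space M using bm by (simp add: hyperbolic_brownian_motion_def)
  note h = bm[unfolded hyperbolic_brownian_motion_def]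
  have [measurable]: "Z t \<in> borel_measurable M" "Z 0 \<in> borel_measurable M"
    using h t by auto
  let ?F = "natural_filtration M Z 0"
  have sub: "{Z r -` A \<inter> space M | r A. 0 \<le> r \<and> r \<le> 0 \<and> A \<in> sets borel} \<subseteq> sets M"
  proof safe
    fix r :: real and A :: "'m hpoint set" assume "0 \<le> r" "r \<le> 0" "A \<in> sets borel"
    moreover from this have r: "r = 0" by simp
    ultimately show "Z r -` A \<inter> space M \<in> sets M"
      unfolding r using measurable_sets[of "Z 0" M borel A] by simp
  qed
  have "subalgebra M ?F"
    unfolding subalgebra_def natural_filtration_def
    using sub sets.sigma_sets_subset[OF sub] by (auto simp: space_measure_of_conv sets_measure_of_conv)
  then interpret finite_measure_subalgebra M ?F
    by unfold_locales
  let ?I = "indicator (Z t -` A) :: 'w \<Rightarrow> real"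
  have ZA: "Z t -` A \<inter> space M \<in> sets M" using measurable_sets[of "Z t" M borel A] A by simp
  have I_eq: "integrable M ?I \<longleftrightarrow> integrable M (indicator (Z t -` A \<inter> space M) :: 'w \<Rightarrow> real)"
    by (rule Bochner_Integration.integrable_cong) (auto simp: indicator_def)
  have int: "integrable M ?I"
    unfolding I_eq using ZA by (intro integrable_real_indicator) (auto simp: less_top[symmetric])
  have "measure M (Z t -` A \<inter> space M) = (\<integral>\<omega>. indicator (Z t -` A \<inter> space M) \<omega> \<partial>M)"
    using ZA by simp
  also have "\<dots> = (\<integral>\<omega>. ?I \<omega> \<partial>M)"
    by (rule Bochner_Integration.integral_cong) (auto simp: indicator_def)
  also have "\<dots> = (\<integral>\<omega>. real_cond_exp M ?F ?I \<omega> \<partial>M)"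
    using real_cond_exp_int(2)[OF int] by simp
  also have "\<dots> = (\<integral>\<omega>. (LINT w:A|hvolume. k a w t) \<partial>M)"
  proof (rule integral_cong_AE)
    have "AE \<omega> in M. real_cond_exp M ?F ?I \<omega> = (LINT w:A|hvolume. k (Z 0 \<omega>) w (t - 0))"
      using h t A by blast
    moreover have "AE \<omega> in M. Z 0 \<omega> = a" using h by blast
    ultimately show "AE \<omega> in M. real_cond_exp M ?F ?I \<omega> = (LINT w:A|hvolume. k a w t)"
      by eventually_elim simp
  qed auto
  also have "\<dots> = (LINT w:A|hvolume. k a w t)" by (simp add: prob_space)
  finally show ?thesis .
qed

lemma heat_kernel_nonneg: "heat_kernel k \<Longrightarrow> z \<in> hspace \<Longrightarrow> w \<in> hspace \<Longrightarrow> 0 < t \<Longrightarrow> 0 \<le> k z w t"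
  unfolding heat_kernel_def fundamental_solution_def by blast

text \<open>
  The density k O w t of the motion is, as a function of the inverse z of w, the solution k z O t of the
  heat equation. Its measurability in w comes from total mass one: a function that is not integrable
  would have integral 0.
\<close>

lemma distr_ginv_hyperbolic_brownian_motion:
  fixes k :: "'m::finite hpoint \<Rightarrow> 'm hpoint \<Rightarrow> real \<Rightarrow> real"
  assumes bm: "hyperbolic_brownian_motion k horigin M Z" and t: "0 < t"
  shows "distr M borel (\<lambda>\<omega>. ginv (Z t \<omega>)) = density lborel (\<lambda>z. ennreal (indicator hspace z * k z horigin t / snd z))"
    and "(\<lambda>z. indicator hspace z * k z horigin t) \<in> borel_measurable borel"
proof -
  interpret prob_space M using bm by (simp add: hyperbolic_brownian_motion_def)
  note h = bm[unfolded hyperbolic_brownian_motion_def]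
  have hk: "heat_kernel k" using h by blast
  have [measurable]: "Z t \<in> borel_measurable M" using h t by auto
  have Zh: "Z t \<omega> \<in> hspace" if "\<omega> \<in> space M" for \<omega> using h t that by auto
  define K where "K z = indicator hspace z * k z horigin t" for z :: "'m hpoint"
  have kK: "k horigin w t = K (ginv w)" if "w \<in> hspace" for w
    using heat_kernel_ginv[OF hk that t] ginv_in_hspace[OF that] by (simp add: K_def)
  have K0: "0 \<le> K z" for z
    using heat_kernel_nonneg[OF hk _ horigin_in_hspace t] by (auto simp: K_def split: split_indicator)
  note P = prob_hyperbolic_brownian_motion[OF bm t]
  have "(LINT w|hvolume. k horigin w t) = 1"
    using P[of UNIV] prob_space by (simp add: set_lebesgue_integral_def)
  then have int: "integrable hvolume (\<lambda>w. k horigin w t)"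
    using not_integrable_integral_eq[of hvolume "\<lambda>w. k horigin w t"] by force
  then have "(\<lambda>w. k horigin w t) \<in> borel_measurable (restrict_space borel hspace)"
    using borel_measurable_integrable[OF int] by (simp cong: measurable_cong_sets add: sets_hvolume)
  then have "(\<lambda>w. indicator hspace w *\<^sub>R k horigin w t) \<in> borel_measurable borel"
    by (subst (asm) borel_measurable_restrict_space_iff) (auto simp: sets_hspace)
  moreover have "(\<lambda>w. indicator hspace w *\<^sub>R k horigin w t) = (\<lambda>w. indicator hspace w * K (ginv w))"
    using kK by (auto simp: fun_eq_iff split: split_indicator)
  ultimately have [measurable]: "(\<lambda>w. indicator hspace w * K (ginv w)) \<in> borel_measurable borel"
    by (simp only:)
  have gg: "ginv (ginv z) = z" if "z \<in> hspace" for z :: "'m hpoint"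
    using that by (auto simp: ginv_def hspace_def)
  have "(\<lambda>z. indicator hspace z * (indicator hspace (ginv z) * K (ginv (ginv z)))) \<in> borel_measurable borel"
    by measurable
  moreover have "indicator hspace z * (indicator hspace (ginv z) * K (ginv (ginv z))) = K z" for z
    using gg[of z] ginv_in_hspace[of z] by (auto simp: K_def split: split_indicator)
  ultimately have Km[measurable]: "K \<in> borel_measurable borel" by simp
  then show "(\<lambda>z. indicator hspace z * k z horigin t) \<in> borel_measurable borel"
    by (simp add: K_def[abs_def])
  let ?V = "density lborel (\<lambda>z::'m hpoint. ennreal (1 / snd z ^ hdim TYPE('m)) * indicator hspace z)"
  have law: "distr M borel (Z t) = density ?V (\<lambda>w. ennreal (K (ginv w)))"
  proof (rule measure_eqI)
    fix A assume "A \<in> sets (distr M borel (Z t))"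
    then have A[measurable]: "A \<in> sets borel" by simp
    have "emeasure (distr M borel (Z t)) A = ennreal (measure M (Z t -` A \<inter> space M))"
      by (simp add: emeasure_distr emeasure_eq_measure)
    also have "measure M (Z t -` A \<inter> space M) = (LINT w|hvolume. indicator A w * k horigin w t)"
      using P[OF A] by (simp add: set_lebesgue_integral_def)
    also have "ennreal \<dots> = (\<integral>\<^sup>+ w. ennreal (indicator A w * k horigin w t) \<partial>hvolume)"
    proof (rule nn_integral_eq_integral[symmetric])
      have "A \<inter> hspace \<in> sets hvolume"
        by (simp add: sets_hvolume sets_restrict_space_iff)
      from integrable_mult_indicator[OF this int]
      have "integrable hvolume (\<lambda>w. indicator (A \<inter> hspace) w * k horigin w t)" by simp
      then show "integrable hvolume (\<lambda>w. indicator A w * k horigin w t)"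
        by (rule Bochner_Integration.integrable_cong[THEN iffD1, rotated -1]) (auto simp: space_hvolume indicator_def)
      show "AE w in hvolume. 0 \<le> indicator A w * k horigin w t"
        using kK K0 by (intro AE_I2) (auto simp: space_hvolume)
    qed
    also have "\<dots> = (\<integral>\<^sup>+ w. indicator A w * ennreal (indicator hspace w * K (ginv w)) \<partial>hvolume)"
      by (rule nn_integral_cong) (auto simp: space_hvolume kK split: split_indicator)
    also have "\<dots> = (\<integral>\<^sup>+ w. indicator A w * ennreal (indicator hspace w * K (ginv w)) * ennreal (1 / snd w ^ hdim TYPE('m)) * indicator hspace w \<partial>lborel)"
      by (rule nn_integral_hvolume) measurable
    also have "\<dots> = (\<integral>\<^sup>+ w. (ennreal (1 / snd w ^ hdim TYPE('m)) * indicator hspace w) * (ennreal (K (ginv w)) * indicator A w) \<partial>lborel)"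
      by (rule nn_integral_cong) (auto simp: mult_ac split: split_indicator)
    also have "\<dots> = (\<integral>\<^sup>+ w. ennreal (K (ginv w)) * indicator A w \<partial>?V)"
      by (rule nn_integral_density[symmetric]) auto
    also have "\<dots> = emeasure (density ?V (\<lambda>w. ennreal (K (ginv w)))) A"
      by (rule emeasure_density[symmetric]) auto
    finally show "emeasure (distr M borel (Z t)) A = emeasure (density ?V (\<lambda>w. ennreal (K (ginv w)))) A" .
  qed simp
  have "distr M borel (\<lambda>\<omega>. ginv (Z t \<omega>)) = distr (distr M borel (Z t)) borel ginv"
    by (simp add: distr_distr o_def)
  also have "\<dots> = density (distr ?V borel ginv) (\<lambda>z. ennreal (K z))"
    unfolding law by (rule density_distr[symmetric]) auto
  also have "\<dots> = density lborel (\<lambda>z. (ennreal (1 / snd z) * indicator hspace z) * ennreal (K z))"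
    unfolding distr_ginv by (rule density_density_eq) auto
  also have "\<dots> = density lborel (\<lambda>z. ennreal (indicator hspace z * k z horigin t / snd z))"
  proof (rule arg_cong[where f="density lborel"], rule ext)
    fix z :: "'m hpoint"
    show "(ennreal (1 / snd z) * indicator hspace z) * ennreal (K z) = ennreal (indicator hspace z * k z horigin t / snd z)"
      using K0[of z] by (auto simp: K_def hspace_def simp flip: ennreal_mult split: split_indicator)
  qed
  finally show "distr M borel (\<lambda>\<omega>. ginv (Z t \<omega>)) = density lborel (\<lambda>z. ennreal (indicator hspace z * k z horigin t / snd z))" .
qed

lemma expectation_ginv_hyperbolic_brownian_motion:
  fixes k :: "'m::finite hpoint \<Rightarrow> 'm hpoint \<Rightarrow> real \<Rightarrow> real"
  assumes bm: "hyperbolic_brownian_motion k horigin M Z" and t: "0 < t"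
    and [measurable]: "g \<in> borel_measurable borel"
  shows "(LINT \<omega>|M. g (ginv (Z t \<omega>))) = (LINT z|lborel. indicator hspace z * k z horigin t / snd z * g z)"
proof -
  have Z[measurable]: "Z t \<in> borel_measurable M"
    using bm t by (auto simp: hyperbolic_brownian_motion_def)
  note [measurable] = distr_ginv_hyperbolic_brownian_motion(2)[OF bm t]
  have nn: "0 \<le> indicator hspace z * k z horigin t / snd z" for z :: "'m hpoint"
  proof (cases "z \<in> hspace")
    case True
    have "heat_kernel k" using bm by (simp add: hyperbolic_brownian_motion_def)
    from heat_kernel_nonneg[OF this True horigin_in_hspace t] show ?thesis
      using True by (simp add: hspace_def)
  qed simp
  have "(LINT \<omega>|M. g (ginv (Z t \<omega>))) = (LINT z|distr M borel (\<lambda>\<omega>. ginv (Z t \<omega>)). g z)"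
    by (rule integral_distr[symmetric]) measurable
  also have "\<dots> = (LINT z|density lborel (\<lambda>z. ennreal (indicator hspace z * k z horigin t / snd z)). g z)"
    unfolding distr_ginv_hyperbolic_brownian_motion(1)[OF bm t] ..
  also have "\<dots> = (LINT z|lborel. (indicator hspace z * k z horigin t / snd z) *\<^sub>R g z)"
    by (rule integral_density) (use nn in auto)
  finally show ?thesis by simp
qed

section \<open>Integration by parts along coordinate directions\<close>

text \<open>
  Heat solutions are described by their derivatives along the coordinate axes. Changing one coordinate
  at a time, with the mean value inequality for each change, gives a local Lipschitz bound.
\<close>


lemma continuous_on_of_partial_derivatives:
  fixes f :: "'a::euclidean_space \<Rightarrow> real"
  assumes S: "open S"
    and der: "\<And>b z. b \<in> Basis \<Longrightarrow> z \<in> S \<Longrightarrow> ((\<lambda>r. f (z + r *\<^sub>R b)) has_real_derivative f' b z) (at 0)"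
    and cont: "\<And>b. b \<in> Basis \<Longrightarrow> continuous_on S (f' b)"
  shows "continuous_on S f"
proof (rule continuous_at_imp_continuous_on, rule ballI)
  fix z0 assume z0: "z0 \<in> S"
  obtain r where r: "0 < r" "cball z0 r \<subseteq> S"
    using S[unfolded open_contains_cball] z0 by auto
  have "\<exists>M. \<forall>b\<in>Basis. \<forall>z\<in>cball z0 r. \<bar>f' b z\<bar> \<le> M"
  proof -
    have "bounded (f' b ` cball z0 r)" if "b \<in> Basis" for b
      using continuous_on_subset[OF cont[OF that] r(2)] by (intro compact_imp_bounded compact_continuous_image) auto
    then have "bounded (\<Union>b\<in>Basis. f' b ` cball z0 r)" by (intro bounded_UN) auto
    then obtain M where "\<And>x. x \<in> (\<Union>b\<in>Basis. f' b ` cball z0 r) \<Longrightarrow> norm x \<le> M"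
      unfolding bounded_iff by blast
    then have "\<forall>b\<in>Basis. \<forall>z\<in>cball z0 r. \<bar>f' b z\<bar> \<le> M" unfolding real_norm_def by blast
    then show ?thesis by blast
  qed
  then obtain M where M: "\<And>b z. b \<in> Basis \<Longrightarrow> z \<in> cball z0 r \<Longrightarrow> \<bar>f' b z\<bar> \<le> M" by blast
  have lip: "\<bar>f (z0 + h) - f z0\<bar> \<le> M * (DIM('a) * norm h)" if h: "DIM('a) * norm h \<le> r" for h
  proof -
    have part: "norm (\<Sum>b\<in>B. (h \<bullet> b) *\<^sub>R b) \<le> card B * norm h" if "B \<subseteq> Basis" for B
    proof -
      have "norm (\<Sum>b\<in>B. (h \<bullet> b) *\<^sub>R b) \<le> (\<Sum>b\<in>B. norm ((h \<bullet> b) *\<^sub>R b))" by (rule norm_sum)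
      also have "\<dots> \<le> (\<Sum>b\<in>B. norm h)"
        using that by (intro sum_mono) (auto simp: norm_Basis Basis_le_norm subset_iff)
      finally show ?thesis by simp
    qed
    have "\<bar>f (z0 + (\<Sum>b\<in>B. (h \<bullet> b) *\<^sub>R b)) - f z0\<bar> \<le> M * (card B * norm h)" if "B \<subseteq> Basis" for B
    proof -
      have "finite B" using that finite_Basis by (rule finite_subset)
      then show ?thesis using that
      proof (induction B rule: finite_induct)
        case (insert c B)
        define z where "z = z0 + (\<Sum>b\<in>B. (h \<bullet> b) *\<^sub>R b)"
        have c: "c \<in> Basis" and B: "B \<subseteq> Basis" using insert by auto
        have card: "real (card B) + 1 \<le> DIM('a)"
          using card_mono[OF finite_Basis insert.prems] insert.hyps by simp
        have seg: "z + s *\<^sub>R c \<in> cball z0 r" if "s \<in> closed_segment 0 (h \<bullet> c)" for s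
        proof -
          have "\<bar>s\<bar> \<le> \<bar>h \<bullet> c\<bar>" using that by (auto simp: closed_segment_eq_real_ivl split: if_splits)
          then have "\<bar>s\<bar> \<le> norm h" using Basis_le_norm[OF c, of h] by linarith
          then have "norm (s *\<^sub>R c) \<le> norm h" using c by (simp add: norm_Basis)
          then have "norm ((\<Sum>b\<in>B. (h \<bullet> b) *\<^sub>R b) + s *\<^sub>R c) \<le> card B * norm h + norm h"
            by (rule norm_triangle_mono[OF part[OF B]])
          also have "\<dots> = (real (card B) + 1) * norm h" by (simp add: algebra_simps)
          also have "\<dots> \<le> DIM('a) * norm h" using card by (rule mult_right_mono) simp
          also have "\<dots> \<le> r" by (rule h)
          finally have "norm ((\<Sum>b\<in>B. (h \<bullet> b) *\<^sub>R b) + s *\<^sub>R c) \<le> r" .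
          moreover have "z + s *\<^sub>R c - z0 = (\<Sum>b\<in>B. (h \<bullet> b) *\<^sub>R b) + s *\<^sub>R c" by (simp add: z_def)
          ultimately have "norm (z + s *\<^sub>R c - z0) \<le> r" by (simp only:)
          then show ?thesis by (simp add: dist_norm norm_minus_commute)
        qed
        have "norm (f (z + (h \<bullet> c) *\<^sub>R c) - f (z + 0 *\<^sub>R c)) \<le> M * norm ((h \<bullet> c) - 0)"
        proof (rule field_differentiable_bound[where f="\<lambda>s. f (z + s *\<^sub>R c)" and S="closed_segment 0 (h \<bullet> c)" and f'="\<lambda>s. f' c (z + s *\<^sub>R c)"])
          fix s assume s: "s \<in> closed_segment 0 (h \<bullet> c)"
          have "((\<lambda>r. f ((z + s *\<^sub>R c) + r *\<^sub>R c)) has_real_derivative f' c (z + s *\<^sub>R c)) (at 0)"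
            by (rule der[OF c]) (use seg[OF s] r in auto)
          then have "((\<lambda>r. f (z + (r + s) *\<^sub>R c)) has_real_derivative f' c (z + s *\<^sub>R c)) (at 0)"
            by (simp add: scaleR_add_left add_ac)
          then have "((\<lambda>s. f (z + s *\<^sub>R c)) has_real_derivative f' c (z + s *\<^sub>R c)) (at s)"
            using DERIV_shift[of "\<lambda>s. f (z + s *\<^sub>R c)" _ 0 s] by simp
          then show "((\<lambda>s. f (z + s *\<^sub>R c)) has_real_derivative f' c (z + s *\<^sub>R c)) (at s within closed_segment 0 (h \<bullet> c))"
            by (rule has_field_derivative_at_within)
          show "norm (f' c (z + s *\<^sub>R c)) \<le> M" using M[OF c seg[OF s]] by simp
        qed auto
        also have "\<dots> \<le> M * norm h"
        proof (rule mult_left_mono)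
          show "norm ((h \<bullet> c) - 0) \<le> norm h" using Basis_le_norm[OF c, of h] by simp
          show "0 \<le> M" using M[OF c, of z0] r by (auto intro: order_trans[OF abs_ge_zero])
        qed
        finally have step: "\<bar>f (z + (h \<bullet> c) *\<^sub>R c) - f z\<bar> \<le> M * norm h" by simp
        have "\<bar>f z - f z0\<bar> \<le> M * (card B * norm h)"
          using insert.IH[OF B] by (simp add: z_def)
        with step have "\<bar>f (z + (h \<bullet> c) *\<^sub>R c) - f z0\<bar> \<le> M * norm h + M * (card B * norm h)" by linarith
        moreover have eq: "z0 + (\<Sum>b\<in>insert c B. (h \<bullet> b) *\<^sub>R b) = z + (h \<bullet> c) *\<^sub>R c"
          using insert.hyps by (simp add: z_def add_ac)
        moreover have "M * (card (insert c B) * norm h) = M * norm h + M * (card B * norm h)"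
          using insert.hyps by (simp add: algebra_simps)
        ultimately show ?case by (simp only: eq)
      qed simp
    qed
    from this[of Basis] show ?thesis by (simp add: euclidean_representation)
  qed
  have "((\<lambda>z. f z - f z0) \<longlongrightarrow> 0) (at z0)"
  proof (rule Lim_null_comparison)
    have "eventually (\<lambda>z. z \<in> ball z0 (r / DIM('a))) (at z0)"
      by (rule eventually_at_in_open') (use r in auto)
    then show "eventually (\<lambda>z. norm (f z - f z0) \<le> M * (DIM('a) * norm (z - z0))) (at z0)"
    proof eventually_elim
      case (elim z)
      then have "norm (z - z0) < r / DIM('a)" by (simp add: dist_norm norm_minus_commute)
      then have "DIM('a) * norm (z - z0) \<le> r" by (simp add: field_simps)
      from lip[OF this] show ?case by simp
    qed
    have "((\<lambda>z. M * (DIM('a) * norm (z - z0))) \<longlongrightarrow> M * (DIM('a) * norm (z0 - z0))) (at z0)"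
      by (intro tendsto_intros)
    then show "((\<lambda>z. M * (DIM('a) * norm (z - z0))) \<longlongrightarrow> 0) (at z0)" by simp
  qed
  then show "isCont f z0" unfolding isCont_def by (rule LIM_zero_cancel)
qed

lemma integral_lborel_cbox:
  fixes h :: "'a::euclidean_space \<Rightarrow> real"
  assumes "continuous_on (cbox a b) h"
  shows "(LINT z|lborel. indicator (cbox a b) z * h z) = integral (cbox a b) h"
proof -
  have "set_integrable lborel (cbox a b) h"
    unfolding set_integrable_def by (rule borel_integrable_compact[OF compact_cbox assms])
  from set_borel_integral_eq_integral(2)[OF this] show ?thesis
    by (simp add: set_lebesgue_integral_def)
qed

lemma integral_lborel_shift:
  fixes G :: "'a::euclidean_space \<Rightarrow> real"
  assumes [measurable]: "G \<in> borel_measurable borel"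
  shows "(LINT z|lborel. G (z + v)) = (LINT z|lborel. G z)"
proof -
  have "(LINT z|lborel. G z) = (LINT z|distr lborel borel ((+) v). G z)"
    by (simp add: lborel_distr_plus)
  also have "\<dots> = (LINT z|lborel. G (v + z))"
    by (rule integral_distr) measurable
  finally show ?thesis by (simp add: add.commute)
qed

text \<open>
  The integral of g (z + r v) over z does not depend on r, by translation invariance; its derivative in
  r at 0 is the integral of g'. The box is enlarged by the length of v, so that it contains the support
  of all translates with \<bar>r\<bar> \<le> 1.
\<close>

lemma integral_dir_deriv_eq_0:
  fixes g g' :: "'a::euclidean_space \<Rightarrow> real"
  assumes S: "open S" and sub: "cbox a b \<subseteq> S"
    and der: "\<And>z. z \<in> S \<Longrightarrow> ((\<lambda>r. g (z + r *\<^sub>R v)) has_real_derivative g' z) (at 0)"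
    and cont: "continuous_on S g" "continuous_on S g'"
    and zero: "\<And>z. z \<in> S \<Longrightarrow> z \<notin> cbox a b \<Longrightarrow> g z = 0" "\<And>z. z \<in> S \<Longrightarrow> z \<notin> cbox a b \<Longrightarrow> g' z = 0"
  shows "integral (cbox a b) g' = 0"
proof -
  define G where "G z = (if z \<in> S then g z else 0)" for z
  define G' where "G' z = (if z \<in> S then g' z else 0)" for z
  have U: "S \<union> - cbox a b = UNIV" using sub by blast
  have oc: "open (- cbox a b)" by (rule open_Compl[OF closed_cbox])
  have line: "eventually (\<lambda>r. z + r *\<^sub>R v \<in> T) (nhds (0::real))" if "open T" "z \<in> T" for T z
  proof -
    have "open ((\<lambda>r. z + r *\<^sub>R v) -` T)"
      by (intro continuous_open_vimage that continuous_intros)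
    from eventually_nhds_in_open[OF this, of 0] show ?thesis using that by simp
  qed
  have G0: "G z = 0" "G' z = 0" if "z \<notin> cbox a b" for z
    using zero[of z] that by (auto simp: G_def G'_def)
  have contG: "continuous_on UNIV G" "continuous_on UNIV G'"
  proof -
    have "continuous_on S G" "continuous_on S G'"
      using cont by (auto simp: G_def G'_def cong: continuous_on_cong)
    moreover have "continuous_on (- cbox a b) G" "continuous_on (- cbox a b) G'"
      by (subst continuous_on_cong[OF refl, of _ _ "\<lambda>_. 0"]; simp add: G0)+
    ultimately have "continuous_on (S \<union> - cbox a b) G" "continuous_on (S \<union> - cbox a b) G'"
      using S oc by (auto intro: continuous_on_open_Un)
    then show "continuous_on UNIV G" "continuous_on UNIV G'" by (simp_all only: U)
  qed
  have derG: "((\<lambda>r. G (z + r *\<^sub>R v)) has_real_derivative G' z) (at 0)" for z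
  proof (cases "z \<in> S")
    case True
    have "eventually (\<lambda>r. g (z + r *\<^sub>R v) = G (z + r *\<^sub>R v)) (nhds 0)"
      using line[OF S True] by eventually_elim (simp add: G_def)
    with der[OF True] show ?thesis
      by (subst (asm) DERIV_cong_ev[OF refl _ refl]) (auto simp: G'_def True)
  next
    case False
    then have "z \<in> - cbox a b" using sub by blast
    have "eventually (\<lambda>r. 0 = G (z + r *\<^sub>R v)) (nhds 0)"
      using line[OF oc \<open>z \<in> - cbox a b\<close>] by eventually_elim (simp add: G0)
    moreover have "((\<lambda>r::real. 0::real) has_real_derivative 0) (at 0)" by simp
    ultimately show ?thesis
      by (subst (asm) DERIV_cong_ev[OF refl _ refl]) (auto simp: G'_def False)
  qed
  have derG': "((\<lambda>r. G (z + r *\<^sub>R v)) has_real_derivative G' (z + r *\<^sub>R v)) (at r)" for z r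
  proof -
    have "((\<lambda>s. G (z + r *\<^sub>R v + s *\<^sub>R v)) has_real_derivative G' (z + r *\<^sub>R v)) (at 0)"
      by (rule derG)
    then have "((\<lambda>s. G (z + (s + r) *\<^sub>R v)) has_real_derivative G' (z + r *\<^sub>R v)) (at 0)"
      by (simp add: scaleR_add_left add_ac)
    then show ?thesis
      using DERIV_shift[of "\<lambda>r. G (z + r *\<^sub>R v)" _ 0 r] by simp
  qed
  define a' b' where "a' = a - norm v *\<^sub>R One" and "b' = b + norm v *\<^sub>R One"
  have box: "z \<in> cbox a' b'" if "z + r *\<^sub>R v \<in> cbox a b" "\<bar>r\<bar> \<le> 1" for z r
    unfolding mem_box
  proof
    fix i :: 'a assume i: "i \<in> Basis"
    have "\<bar>r * (v \<bullet> i)\<bar> \<le> 1 * norm v"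
      unfolding abs_mult using that(2) Basis_le_norm[OF i, of v] by (intro mult_mono) auto
    moreover have "a \<bullet> i \<le> z \<bullet> i + r * (v \<bullet> i)" "z \<bullet> i + r * (v \<bullet> i) \<le> b \<bullet> i"
      using that(1) i by (auto simp: mem_box inner_add_left)
    moreover have "a' \<bullet> i = a \<bullet> i - norm v" "b' \<bullet> i = b \<bullet> i + norm v"
      using i by (auto simp: a'_def b'_def inner_diff_left inner_add_left)
    ultimately show "a' \<bullet> i \<le> z \<bullet> i \<and> z \<bullet> i \<le> b' \<bullet> i" by linarith
  qed
  have contGr: "continuous_on A (\<lambda>z. G (z + w))" "continuous_on A (\<lambda>z. G' (z + w))" for A w
    by (auto intro!: continuous_on_compose2[OF contG(1)] continuous_on_compose2[OF contG(2)] continuous_intros)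
  have [measurable]: "G \<in> borel_measurable borel"
    using contG(1) by (rule borel_measurable_continuous_onI)
  have const: "integral (cbox a' b') (\<lambda>z. G (z + r *\<^sub>R v)) = (LINT z|lborel. G z)" if "\<bar>r\<bar> \<le> 1" for r
  proof -
    have "integral (cbox a' b') (\<lambda>z. G (z + r *\<^sub>R v)) = (LINT z|lborel. indicator (cbox a' b') z * G (z + r *\<^sub>R v))"
      by (rule integral_lborel_cbox[symmetric]) (rule contGr)
    also have "\<dots> = (LINT z|lborel. G (z + r *\<^sub>R v))"
      by (rule Bochner_Integration.integral_cong) (use box[OF _ that] G0 in \<open>auto simp: indicator_def\<close>)
    also have "\<dots> = (LINT z|lborel. G z)" by (rule integral_lborel_shift) measurable
    finally show ?thesis .
  qed
  have "((\<lambda>r. integral (cbox a' b') (\<lambda>z. G (z + r *\<^sub>R v))) has_field_derivative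
      integral (cbox a' b') (\<lambda>z. G' (z + 0 *\<^sub>R v))) (at 0 within {-1<..<1})"
  proof (rule leibniz_rule_field_derivative)
    show "((\<lambda>r. G (z + r *\<^sub>R v)) has_field_derivative G' (z + r *\<^sub>R v)) (at r within {-1<..<1})" for r z
      by (rule has_field_derivative_at_within[OF derG'])
    show "(\<lambda>z. G (z + r *\<^sub>R v)) integrable_on cbox a' b'" for r
      by (rule integrable_continuous[OF contGr(1)])
    show "continuous_on ({-1<..<1} \<times> cbox a' b') (\<lambda>(r, z). G' (z + r *\<^sub>R v))"
      unfolding case_prod_unfold by (rule continuous_on_compose2[OF contG(2)]) (auto intro!: continuous_intros)
  qed auto
  then have d: "((\<lambda>r. integral (cbox a' b') (\<lambda>z. G (z + r *\<^sub>R v))) has_real_derivative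
      integral (cbox a' b') G') (at 0)"
    by (simp add: at_within_open[of 0 "{-1<..<1::real}"])
  have "eventually (\<lambda>r::real. r \<in> {-1<..<1}) (nhds 0)"
    by (rule eventually_nhds_in_open) auto
  then have "eventually (\<lambda>r. integral (cbox a' b') (\<lambda>z. G (z + r *\<^sub>R v)) = (LINT z|lborel. G z)) (nhds 0)"
    by eventually_elim (rule const, auto)
  from d[unfolded DERIV_cong_ev[OF refl this refl]]
  have zero': "integral (cbox a' b') G' = 0"
    by (rule DERIV_unique[OF _ DERIV_const])
  have sub': "cbox a b \<subseteq> cbox a' b'" using box[of _ 0] by auto
  have "integral (cbox a b) g' = integral (cbox a b) G'"
    by (rule integral_cong) (use sub in \<open>auto simp: G'_def\<close>)
  also have "\<dots> = (LINT z|lborel. indicator (cbox a b) z * G' z)"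
    by (rule integral_lborel_cbox[symmetric]) (rule continuous_on_subset[OF contG(2)], simp)
  also have "\<dots> = (LINT z|lborel. indicator (cbox a' b') z * G' z)"
    by (rule Bochner_Integration.integral_cong) (use sub' G0 in \<open>auto simp: indicator_def\<close>)
  also have "\<dots> = integral (cbox a' b') G'"
    by (rule integral_lborel_cbox) (rule continuous_on_subset[OF contG(2)], simp)
  finally show ?thesis by (simp add: zero')
qed

section \<open>The weak heat equation for radial test functions\<close>

text \<open>
  The hyperbolic cosine of the distance from the origin.
\<close>


definition ch :: "'m::finite hpoint \<Rightarrow> real" where
  "ch z = ((norm (fst z))\<^sup>2 + (snd z)\<^sup>2 + 1) / (2 * snd z)"

text \<open>
  The first derivative of \<open>ch\<close> at z in the direction v; \<open>ddch\<close> is the second one.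
\<close>

definition dch :: "'m::finite hpoint \<Rightarrow> 'm hpoint \<Rightarrow> real" where
  "dch v z = (z \<bullet> v) / snd z - ch z * snd v / snd z"

definition ddch :: "'m::finite hpoint \<Rightarrow> 'm hpoint \<Rightarrow> real" where
  "ddch v z = (v \<bullet> v) / snd z - 2 * (z \<bullet> v) * snd v / (snd z)\<^sup>2 + 2 * ch z * (snd v)\<^sup>2 / (snd z)\<^sup>2"

lemma ch_inner: "ch z = (z \<bullet> z + 1) / (2 * snd z)"
  by (simp add: ch_def inner_prod_def power2_norm_eq_inner) (simp add: power2_eq_square)

lemma hspace_pos: "z \<in> hspace \<Longrightarrow> 0 < snd z"
  by (simp add: hspace_def)

lemma ch_sum_le: "z \<in> hspace \<Longrightarrow> snd z + 1 / snd z \<le> 2 * ch z"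
  using hspace_pos[of z] by (simp add: ch_def field_simps power2_eq_square)

lemma ch_pos: "z \<in> hspace \<Longrightarrow> 0 < ch z"
  using hspace_pos[of z] unfolding ch_def by (intro divide_pos_pos add_nonneg_pos) auto

lemma snd_line: "((\<lambda>r. snd (z + r *\<^sub>R v)) has_real_derivative snd v) (at 0)"
  for z :: "'m::finite hpoint"
  by (auto intro!: derivative_eq_intros)

lemma inner_line: "((\<lambda>r. (z + r *\<^sub>R v) \<bullet> w) has_real_derivative v \<bullet> w) (at 0)"
  for z :: "'a::real_inner"
  by (auto simp: inner_add_left intro!: derivative_eq_intros)

lemma powr_line:
  fixes z :: "'m::finite hpoint"
  assumes "z \<in> hspace"
  shows "((\<lambda>r. snd (z + r *\<^sub>R v) powr s) has_real_derivative s * snd z powr s * snd v / snd z) (at 0)"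
proof -
  have "((\<lambda>r. (snd z + r * snd v) powr s) has_real_derivative s * snd z powr s * snd v / snd z) (at 0)"
    using hspace_pos[OF assms] by (auto intro!: derivative_eq_intros simp: powr_diff)
  then show ?thesis by simp
qed

lemma ch_line:
  fixes z :: "'m::finite hpoint"
  assumes "z \<in> hspace"
  shows "((\<lambda>r. ch (z + r *\<^sub>R v)) has_real_derivative dch v z) (at 0)"
proof -
  note y = hspace_pos[OF assms]
  have eq: "ch (z + r *\<^sub>R v) = (z \<bullet> z + 2 * r * (z \<bullet> v) + r\<^sup>2 * (v \<bullet> v) + 1) / (2 * (snd z + r * snd v))" for r
    by (simp add: ch_inner inner_add_left inner_add_right inner_commute power2_eq_square algebra_simps)
  have "((\<lambda>r. (z \<bullet> z + 2 * r * (z \<bullet> v) + r\<^sup>2 * (v \<bullet> v) + 1) / (2 * (snd z + r * snd v))) has_real_derivative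
     (2 * (z \<bullet> v) * (2 * snd z) - (z \<bullet> z + 1) * (2 * snd v)) / (2 * snd z)\<^sup>2) (at 0)"
    using y by (auto intro!: derivative_eq_intros simp: power2_eq_square)
  moreover have "(2 * (z \<bullet> v) * (2 * snd z) - (z \<bullet> z + 1) * (2 * snd v)) / (2 * snd z)\<^sup>2 = dch v z"
    using y by (simp add: dch_def ch_inner field_simps power2_eq_square)
  ultimately show ?thesis unfolding eq by simp
qed

lemma comp_ch_line:
  fixes z :: "'m::finite hpoint"
  assumes "z \<in> hspace" "(f has_real_derivative D) (at (ch z))"
  shows "((\<lambda>r. f (ch (z + r *\<^sub>R v))) has_real_derivative D * dch v z) (at 0)"
  by (rule DERIV_chain2[of f D "\<lambda>r. ch (z + r *\<^sub>R v)" 0]) (use assms ch_line[OF assms(1)] in auto)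

lemma dch_line:
  fixes z :: "'m::finite hpoint"
  assumes "z \<in> hspace"
  shows "((\<lambda>r. dch v (z + r *\<^sub>R v)) has_real_derivative ddch v z) (at 0)"
proof -
  note y = hspace_pos[OF assms]
  have y0: "snd (z + 0 *\<^sub>R v) \<noteq> 0" using y by simp
  note d1 = DERIV_divide[OF inner_line[of z v v] snd_line[of z v] y0]
  note d2 = DERIV_divide[OF DERIV_mult[OF ch_line[OF assms] DERIV_const[of "snd v"]] snd_line[of z v] y0]
  have "((\<lambda>r. dch v (z + r *\<^sub>R v)) has_real_derivative
     ((v \<bullet> v) * snd z - (z \<bullet> v) * snd v) / (snd z * snd z) - ((dch v z * snd v) * snd z - (ch z * snd v) * snd v) / (snd z * snd z)) (at 0)"
    using DERIV_diff[OF d1 d2] unfolding dch_def by simp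
  moreover have "((v \<bullet> v) * snd z - (z \<bullet> v) * snd v) / (snd z * snd z) - ((dch v z * snd v) * snd z - (ch z * snd v) * snd v) / (snd z * snd z) = ddch v z"
    using y by (simp add: ddch_def dch_def field_simps power2_eq_square)
  ultimately show ?thesis by simp
qed

lemma sum_Basis_inner_snd:
  fixes z :: "'m::finite hpoint"
  shows "(\<Sum>b\<in>Basis. (z \<bullet> b) * snd b) = snd z" "(\<Sum>b\<in>Basis. (z \<bullet> b)\<^sup>2) = z \<bullet> z"
    "(\<Sum>b\<in>(Basis :: 'm hpoint set). (snd b)\<^sup>2) = 1"
proof -
  have snd: "snd b = (0, 1) \<bullet> b" for b :: "'m hpoint" by (simp add: inner_prod_def)
  have "(\<Sum>b\<in>Basis. (z \<bullet> b) * snd b) = z \<bullet> (0, 1)"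
    unfolding snd by (rule euclidean_inner[symmetric])
  then show "(\<Sum>b\<in>Basis. (z \<bullet> b) * snd b) = snd z" by (simp add: inner_prod_def)
  show "(\<Sum>b\<in>Basis. (z \<bullet> b)\<^sup>2) = z \<bullet> z"
    unfolding power2_eq_square by (rule euclidean_inner[symmetric])
  have "(\<Sum>b\<in>(Basis :: 'm hpoint set). (snd b)\<^sup>2) = ((0, 1) :: 'm hpoint) \<bullet> (0, 1)"
    unfolding snd power2_eq_square by (rule euclidean_inner[symmetric])
  then show "(\<Sum>b\<in>(Basis :: 'm hpoint set). (snd b)\<^sup>2) = 1" by (simp add: inner_prod_def)
qed

text \<open>
  Up to powers of y these are y \<partial>_y c = y - c, the squared gradient of c, and the Euclidean Laplacian
  of c.
\<close>

lemma sum_Basis_dch: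
  fixes z :: "'m::finite hpoint"
  assumes "z \<in> hspace"
  shows "(\<Sum>b\<in>Basis. snd b * dch b z) = 1 - ch z / snd z"
    "(\<Sum>b\<in>Basis. (dch b z)\<^sup>2) = ((ch z)\<^sup>2 - 1) / (snd z)\<^sup>2"
    "(\<Sum>b\<in>Basis. ddch b z) = (real (hdim TYPE('m)) - 2) / snd z + 2 * ch z / (snd z)\<^sup>2"
proof -
  note y = hspace_pos[OF assms]
  have zz: "z \<bullet> z = 2 * ch z * snd z - 1" using y by (simp add: ch_inner field_simps)
  have "(\<Sum>b\<in>Basis. snd b * dch b z) = (\<Sum>b\<in>Basis. (z \<bullet> b) * snd b / snd z - ch z / snd z * (snd b)\<^sup>2)"
    by (rule sum.cong) (auto simp: dch_def algebra_simps power2_eq_square)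
  also have "\<dots> = (\<Sum>b\<in>Basis. (z \<bullet> b) * snd b) / snd z - ch z / snd z * (\<Sum>b\<in>(Basis::'m hpoint set). (snd b)\<^sup>2)"
    by (simp only: sum_subtractf sum_divide_distrib sum_distrib_left)
  finally show "(\<Sum>b\<in>Basis. snd b * dch b z) = 1 - ch z / snd z"
    using y by (simp add: sum_Basis_inner_snd)
  have "(\<Sum>b\<in>Basis. (dch b z)\<^sup>2) = (\<Sum>b\<in>Basis. (z \<bullet> b)\<^sup>2 / (snd z)\<^sup>2 - 2 * ch z / (snd z)\<^sup>2 * ((z \<bullet> b) * snd b) + (ch z)\<^sup>2 / (snd z)\<^sup>2 * (snd b)\<^sup>2)"
    using y by (intro sum.cong) (auto simp: dch_def power2_eq_square field_simps)
  also have "\<dots> = (\<Sum>b\<in>Basis. (z \<bullet> b)\<^sup>2) / (snd z)\<^sup>2 - 2 * ch z / (snd z)\<^sup>2 * (\<Sum>b\<in>Basis. (z \<bullet> b) * snd b) + (ch z)\<^sup>2 / (snd z)\<^sup>2 * (\<Sum>b\<in>(Basis::'m hpoint set). (snd b)\<^sup>2)"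
    by (simp only: sum_subtractf sum.distrib sum_divide_distrib sum_distrib_left)
  also have "\<dots> = ((ch z)\<^sup>2 - 1) / (snd z)\<^sup>2"
    unfolding sum_Basis_inner_snd zz using y by (simp add: power2_eq_square field_simps)
  finally show "(\<Sum>b\<in>Basis. (dch b z)\<^sup>2) = ((ch z)\<^sup>2 - 1) / (snd z)\<^sup>2" .
  have "(\<Sum>b\<in>Basis. ddch b z) = (\<Sum>b\<in>(Basis::'m hpoint set). 1 / snd z - 2 / (snd z)\<^sup>2 * ((z \<bullet> b) * snd b) + 2 * ch z / (snd z)\<^sup>2 * (snd b)\<^sup>2)"
    by (rule sum.cong) (auto simp: ddch_def)
  also have "\<dots> = (\<Sum>b\<in>(Basis::'m hpoint set). 1 / snd z) - 2 / (snd z)\<^sup>2 * (\<Sum>b\<in>Basis. (z \<bullet> b) * snd b) + 2 * ch z / (snd z)\<^sup>2 * (\<Sum>b\<in>(Basis::'m hpoint set). (snd b)\<^sup>2)"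
    by (simp only: sum_subtractf sum.distrib sum_distrib_left)
  also have "(\<Sum>b\<in>(Basis::'m hpoint set). 1 / snd z) = real (hdim TYPE('m)) / snd z"
    by (simp add: hdim_def)
  finally show "(\<Sum>b\<in>Basis. ddch b z) = (real (hdim TYPE('m)) - 2) / snd z + 2 * ch z / (snd z)\<^sup>2"
    unfolding sum_Basis_inner_snd using y by (simp add: power2_eq_square field_simps)
qed

lemma continuous_on_time_slice:
  assumes "continuous_on (S \<times> {0<..}) (\<lambda>(z, t). g z t)" "0 < (t :: real)"
  shows "continuous_on S (\<lambda>z. g z t)"
proof -
  have "continuous_on S (\<lambda>z. (z, t))" by (intro continuous_intros)
  moreover have "(\<lambda>z. (z, t)) ` S \<subseteq> S \<times> {0<..}" using assms(2) by auto
  ultimately have "continuous_on S (\<lambda>z. (\<lambda>(z, t). g z t) (z, t))"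
    by (rule continuous_on_compose2[OF assms(1)])
  then show ?thesis by simp
qed

lemma heat_solution_line:
  assumes u: "heat_solution u" and "v \<in> Basis" "z \<in> hspace" "0 < t"
  shows "((\<lambda>r. u (z + r *\<^sub>R v) t) has_real_derivative dir_deriv v (\<lambda>z. u z t) z) (at 0)"
proof -
  have "(\<lambda>r. u (z + r *\<^sub>R v) t) differentiable (at 0)"
    using u[unfolded heat_solution_def] assms(2-4) by blast
  then show ?thesis by (simp add: dir_deriv_def DERIV_deriv_iff_real_differentiable)
qed

lemma heat_solution_continuous_on:
  assumes u: "heat_solution u" and t: "0 < t"
  shows "continuous_on hspace (\<lambda>z. u z t)"
proof (rule continuous_on_of_partial_derivatives[OF open_hspace])
  show "((\<lambda>r. u (z + r *\<^sub>R v) t) has_real_derivative dir_deriv v (\<lambda>z. u z t) z) (at 0)"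
    if "v \<in> Basis" "z \<in> hspace" for v z
    by (rule heat_solution_line[OF u that t])
  show "continuous_on hspace (dir_deriv v (\<lambda>z. u z t))" if v: "v \<in> Basis" for v
  proof -
    have "continuous_on (hspace \<times> {0<..}) (\<lambda>(z, t). dir_deriv v (\<lambda>z. u z t) z)"
      using u[unfolded heat_solution_def] v by blast
    from continuous_on_time_slice[OF this t] show ?thesis by simp
  qed
qed

lemma continuous_on_ch: "continuous_on hspace (ch :: 'm::finite hpoint \<Rightarrow> real)"
  unfolding ch_def by (intro continuous_intros) (use hspace_pos in fastforce)

lemma continuous_on_radial:
  assumes rt: "radial_test R \<psi> \<psi>1 \<psi>2"
  shows "continuous_on hspace (\<lambda>z::'m::finite hpoint. \<psi> (ch z))" "continuous_on hspace (\<lambda>z::'m hpoint. \<psi>1 (ch z))"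
    "continuous_on hspace (\<lambda>z::'m hpoint. \<psi>2 (ch z))"
    "continuous_on hspace (\<lambda>z::'m hpoint. snd z powr p * \<psi> (ch z))"
    and "continuous_on hspace (\<lambda>z::'m hpoint. radial_gen m p \<psi> \<psi>1 \<psi>2 (snd z) (ch z))"
proof -
  note r = rt[unfolded radial_test_def]
  note ch_cont = continuous_on_ch
  have c: "continuous_on {0<..} \<psi>" "continuous_on {0<..} \<psi>1" "continuous_on {0<..} \<psi>2"
    using r by (auto intro!: continuous_at_imp_continuous_on DERIV_isCont)
  have im: "ch ` (hspace :: 'm hpoint set) \<subseteq> {0<..}" using ch_pos by auto
  note psi_cont = continuous_on_compose2[OF c(1) ch_cont im] continuous_on_compose2[OF c(2) ch_cont im]
    continuous_on_compose2[OF c(3) ch_cont im]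
  show "continuous_on hspace (\<lambda>z::'m hpoint. \<psi> (ch z))" by (rule psi_cont(1))
  show "continuous_on hspace (\<lambda>z::'m hpoint. \<psi>1 (ch z))" by (rule psi_cont(2))
  show "continuous_on hspace (\<lambda>z::'m hpoint. \<psi>2 (ch z))" by (rule psi_cont(3))
  show "continuous_on hspace (\<lambda>z::'m hpoint. snd z powr p * \<psi> (ch z))"
    by (intro continuous_intros psi_cont) (use hspace_pos in fastforce)
  show "continuous_on hspace (\<lambda>z::'m hpoint. radial_gen m p \<psi> \<psi>1 \<psi>2 (snd z) (ch z))"
    unfolding radial_gen_def by (intro continuous_intros psi_cont ch_cont) (use hspace_pos in fastforce)
qed

text \<open>
  Green's formula. For f = y^(m + p) \<psi>(c), the function y^(-n) (f \<Delta>u - u \<Delta>f) is the Euclidean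
  divergence of y^(2 - n) (f grad u - u grad f), a field supported in the box, so that its integral
  vanishes. Moreover \<Delta>f is y^m times the operator of the inverted motion at y^p \<psi>(c).
\<close>

lemma weak_heat_equation:
  fixes u :: "'m::finite hpoint \<Rightarrow> real \<Rightarrow> real"
  assumes u: "heat_solution u" and rt: "radial_test R \<psi> \<psi>1 \<psi>2" and t: "0 < t"
    and Q: "cbox a b \<subseteq> hspace" and supp: "\<And>z. z \<in> hspace \<Longrightarrow> ch z \<le> R \<Longrightarrow> z \<in> cbox a b"
    and m: "m = real (hdim TYPE('m)) - 1"
  shows "((\<lambda>t. integral (cbox a b) (\<lambda>z. u z t / snd z * (snd z powr p * \<psi> (ch z)))) has_real_derivative
     integral (cbox a b) (\<lambda>z. u z t / snd z * radial_gen m p \<psi> \<psi>1 \<psi>2 (snd z) (ch z))) (at t)"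
proof -
  let ?P = "\<lambda>z. snd z powr p * \<psi> (ch z)" and ?G = "\<lambda>z. radial_gen m p \<psi> \<psi>1 \<psi>2 (snd z) (ch z)"
  define n where "n = real (hdim TYPE('m))"
  define s where "s = m + p"
  define f0 where "f0 z = snd z powr s * \<psi> (ch z)" for z :: "'m hpoint"
  define f1 where "f1 v z = snd z powr s * (\<psi>1 (ch z) * dch v z + s * \<psi> (ch z) * snd v / snd z)" for v z :: "'m hpoint"
  define f2 where "f2 v z = snd z powr s * (\<psi>2 (ch z) * (dch v z)\<^sup>2 + \<psi>1 (ch z) * ddch v z
      + 2 * s * \<psi>1 (ch z) * dch v z * snd v / snd z + s * (s - 1) * \<psi> (ch z) * (snd v)\<^sup>2 / (snd z)\<^sup>2)" for v z :: "'m hpoint"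
  note h = u[unfolded heat_solution_def]
  note r = rt[unfolded radial_test_def]
  have f0_line: "((\<lambda>r. f0 (z + r *\<^sub>R v)) has_real_derivative f1 v z) (at 0)" if z: "z \<in> hspace" for z v
  proof -
    have "(\<psi> has_real_derivative \<psi>1 (ch z)) (at (ch z))" using r ch_pos[OF z] by blast
    from DERIV_mult[OF powr_line[OF z, of v s] comp_ch_line[OF z this, of v]]
    show ?thesis unfolding f0_def f1_def using hspace_pos[OF z] by (simp add: algebra_simps)
  qed
  have f1_line: "((\<lambda>r. f1 v (z + r *\<^sub>R v)) has_real_derivative f2 v z) (at 0)" if z: "z \<in> hspace" for z v
  proof -
    note y = hspace_pos[OF z]
    have y0: "snd (z + 0 *\<^sub>R v) \<noteq> 0" using y by simp
    have "(\<psi> has_real_derivative \<psi>1 (ch z)) (at (ch z))" using r ch_pos[OF z] by blast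
    note d0 = comp_ch_line[OF z this, of v]
    have "(\<psi>1 has_real_derivative \<psi>2 (ch z)) (at (ch z))" using r ch_pos[OF z] by blast
    note d1 = comp_ch_line[OF z this, of v]
    note e1 = DERIV_mult[OF d1 dch_line[OF z, of v]]
    note e2 = DERIV_divide[OF DERIV_mult[OF DERIV_cmult[OF d0, of s] DERIV_const[of "snd v"]] snd_line[of z v] y0]
    have "((\<lambda>r. f1 v (z + r *\<^sub>R v)) has_real_derivative
       s * snd z powr s * snd v / snd z * (\<psi>1 (ch z) * dch v z + s * \<psi> (ch z) * snd v / snd z)
       + (\<psi>2 (ch z) * dch v z * dch v z + ddch v z * \<psi>1 (ch z)
         + (s * (\<psi>1 (ch z) * dch v z) * snd v * snd z - s * \<psi> (ch z) * snd v * snd v) / (snd z * snd z)) * snd z powr s) (at 0)"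
      using DERIV_mult[OF powr_line[OF z, of v s] DERIV_add[OF e1 e2]] unfolding f1_def by simp
    moreover have "s * snd z powr s * snd v / snd z * (\<psi>1 (ch z) * dch v z + s * \<psi> (ch z) * snd v / snd z)
       + (\<psi>2 (ch z) * dch v z * dch v z + ddch v z * \<psi>1 (ch z)
         + (s * (\<psi>1 (ch z) * dch v z) * snd v * snd z - s * \<psi> (ch z) * snd v * snd v) / (snd z * snd z)) * snd z powr s = f2 v z"
      unfolding f2_def using y by (simp add: field_simps power2_eq_square)
    ultimately show ?thesis by simp
  qed
  have lap: "(snd z)\<^sup>2 * (\<Sum>b\<in>Basis. f2 b z) - (n - 2) * snd z * (\<Sum>b\<in>Basis. snd b * f1 b z)
      = snd z powr m * ?G z" if z: "z \<in> hspace" for z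
  proof -
    note y = hspace_pos[OF z] and S = sum_Basis_dch[OF z, folded n_def]
    define c where "c = ch z"
    define y where "y = snd z"
    have y0: "0 < y" using y by (simp add: y_def)
    have "(\<Sum>b\<in>Basis. f2 b z) = (\<Sum>b\<in>Basis. y powr s * (\<psi>2 c * (dch b z)\<^sup>2 + \<psi>1 c * ddch b z
      + 2 * s * \<psi>1 c / y * (snd b * dch b z) + s * (s - 1) * \<psi> c / y\<^sup>2 * (snd b)\<^sup>2))"
      by (rule sum.cong) (auto simp: f2_def c_def y_def mult_ac)
    also have "\<dots> = y powr s * (\<psi>2 c * (\<Sum>b\<in>Basis. (dch b z)\<^sup>2) + \<psi>1 c * (\<Sum>b\<in>Basis. ddch b z)
      + 2 * s * \<psi>1 c / y * (\<Sum>b\<in>Basis. snd b * dch b z) + s * (s - 1) * \<psi> c / y\<^sup>2 * (\<Sum>b\<in>(Basis::'m hpoint set). (snd b)\<^sup>2))"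
      by (simp only: sum_distrib_left[symmetric] sum.distrib)
    also have "\<dots> = y powr s * (\<psi>2 c * ((c\<^sup>2 - 1) / y\<^sup>2) + \<psi>1 c * ((n - 2) / y + 2 * c / y\<^sup>2)
      + 2 * s * \<psi>1 c / y * (1 - c / y) + s * (s - 1) * \<psi> c / y\<^sup>2)"
      unfolding S sum_Basis_inner_snd by (simp add: c_def y_def)
    finally have F2: "(\<Sum>b\<in>Basis. f2 b z) = \<dots>" .
    have "(\<Sum>b\<in>Basis. snd b * f1 b z) = (\<Sum>b\<in>Basis. y powr s * (\<psi>1 c * (snd b * dch b z) + s * \<psi> c / y * (snd b)\<^sup>2))"
      by (rule sum.cong) (auto simp: f1_def c_def y_def power2_eq_square algebra_simps)
    also have "\<dots> = y powr s * (\<psi>1 c * (\<Sum>b\<in>Basis. snd b * dch b z) + s * \<psi> c / y * (\<Sum>b\<in>(Basis::'m hpoint set). (snd b)\<^sup>2))"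
      by (simp only: sum_distrib_left[symmetric] sum.distrib)
    also have "\<dots> = y powr s * (\<psi>1 c * (1 - c / y) + s * \<psi> c / y)"
      unfolding S sum_Basis_inner_snd by (simp add: c_def y_def)
    finally have F1: "(\<Sum>b\<in>Basis. snd b * f1 b z) = \<dots>" .
    have nm: "n = m + 1" by (simp add: n_def m)
    have ys: "y powr s = y powr m * y powr p" by (simp add: s_def powr_add)
    have "y\<^sup>2 * (y powr s * (\<psi>2 c * ((c\<^sup>2 - 1) / y\<^sup>2) + \<psi>1 c * ((n - 2) / y + 2 * c / y\<^sup>2)
      + 2 * s * \<psi>1 c / y * (1 - c / y) + s * (s - 1) * \<psi> c / y\<^sup>2))
      = y powr s * (\<psi>2 c * (c\<^sup>2 - 1) + \<psi>1 c * ((n - 2) * y + 2 * c) + 2 * s * \<psi>1 c * (y - c) + s * (s - 1) * \<psi> c)"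
      using y0 by (simp add: field_simps power2_eq_square)
    moreover have "(n - 2) * y * (y powr s * (\<psi>1 c * (1 - c / y) + s * \<psi> c / y)) = y powr s * ((n - 2) * (\<psi>1 c * (y - c) + s * \<psi> c))"
      using y0 by (simp add: field_simps)
    ultimately have "y\<^sup>2 * (\<Sum>b\<in>Basis. f2 b z) - (n - 2) * y * (\<Sum>b\<in>Basis. snd b * f1 b z) =
       y powr s * (\<psi>2 c * (c\<^sup>2 - 1) + \<psi>1 c * ((n - 2) * y + 2 * c) + 2 * s * \<psi>1 c * (y - c) + s * (s - 1) * \<psi> c)
       - y powr s * ((n - 2) * (\<psi>1 c * (y - c) + s * \<psi> c))"
      unfolding F1 F2 by (simp only:)
    also have "\<dots> = y powr m * radial_gen m p \<psi> \<psi>1 \<psi>2 y c"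
      unfolding radial_gen_def ys nm by (simp add: s_def power2_eq_square algebra_simps)
    finally show ?thesis by (simp only: y_def c_def)
  qed
  note ch_cont = continuous_on_ch
  have dch_cont: "continuous_on hspace (dch v)" "continuous_on hspace (ddch v)" for v :: "'m hpoint"
    unfolding dch_def ddch_def by (intro continuous_intros ch_cont; use hspace_pos in fastforce)+
  note psi_cont = continuous_on_radial(1-3)[OF rt]
  have f_cont: "continuous_on hspace f0" "continuous_on hspace (f1 v)" "continuous_on hspace (f2 v)" for v
    unfolding f0_def f1_def f2_def
    by (intro continuous_intros psi_cont dch_cont; use hspace_pos in fastforce)+
  note gen_cont = continuous_on_radial(5)[OF rt]
  have zero: "f0 z = 0" "f1 v z = 0" "f2 v z = 0" if "z \<in> hspace" "z \<notin> cbox a b" for v z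
  proof -
    have "R \<le> ch z" using supp[OF that(1)] that(2) by force
    then have "\<psi> (ch z) = 0" "\<psi>1 (ch z) = 0" "\<psi>2 (ch z) = 0" using r by auto
    then show "f0 z = 0" "f1 v z = 0" "f2 v z = 0" by (simp_all add: f0_def f1_def f2_def)
  qed
  define U where "U v z = dir_deriv v (\<lambda>z. u z t) z" for v z
  define UU where "UU v z = dir_deriv v (U v) z" for v z
  note slice = continuous_on_time_slice
  note u_line = heat_solution_line[OF u]
  have U_line: "((\<lambda>r. U v (z + r *\<^sub>R v)) has_real_derivative UU v z) (at 0)" if "v \<in> Basis" "z \<in> hspace" for v z
  proof -
    have "(\<lambda>r. U v (z + r *\<^sub>R v)) differentiable (at 0)" using h that t unfolding U_def by blast
    then show ?thesis by (simp add: UU_def dir_deriv_def DERIV_deriv_iff_real_differentiable)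
  qed
  have U_cont: "continuous_on hspace (U v)" "continuous_on hspace (UU v)" if "v \<in> Basis" for v
  proof -
    have "continuous_on (hspace \<times> {0<..}) (\<lambda>(z, t). dir_deriv v (\<lambda>z. u z t) z)" using h that by blast
    from slice[OF this t] show "continuous_on hspace (U v)" by (simp add: U_def[abs_def])
    have "continuous_on (hspace \<times> {0<..}) (\<lambda>(z, t). dir_deriv v (dir_deriv v (\<lambda>z. u z t)) z)" using h that by blast
    from slice[OF this t] show "continuous_on hspace (UU v)" by (simp add: UU_def[abs_def] U_def[abs_def])
  qed
  note u_cont = heat_solution_continuous_on[OF u]
  define E where "E v z = snd z powr (2 - n) * (f0 z * UU v z - u z t * f2 v z)
      + (2 - n) * snd z powr (2 - n) * snd v / snd z * (f0 z * U v z - u z t * f1 v z)" for v z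
  have E_cont: "continuous_on hspace (E v)" if "v \<in> Basis" for v
    unfolding E_def by (intro continuous_intros f_cont U_cont[OF that] u_cont[OF t]; use hspace_pos in fastforce)
  have E0: "integral (cbox a b) (E v) = 0" if v: "v \<in> Basis" for v
  proof (rule integral_dir_deriv_eq_0[OF open_hspace Q])
    let ?g = "\<lambda>z. snd z powr (2 - n) * (f0 z * U v z - u z t * f1 v z)"
    show "((\<lambda>r. ?g (z + r *\<^sub>R v)) has_real_derivative E v z) (at 0)" if z: "z \<in> hspace" for z
    proof -
      note A = DERIV_mult[OF f0_line[OF z, of v] U_line[OF v z]]
      note B = DERIV_mult[OF u_line[OF v z t] f1_line[OF z, of v]]
      show ?thesis
        using DERIV_mult[OF powr_line[OF z, of v "2 - n"] DERIV_diff[OF A B]]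
        unfolding E_def U_def[symmetric] by (simp add: algebra_simps)
    qed
    show "continuous_on hspace ?g"
      by (intro continuous_intros f_cont U_cont[OF v] u_cont[OF t]; use hspace_pos in fastforce)
    show "continuous_on hspace (E v)" by (rule E_cont[OF v])
    show "?g z = 0" "E v z = 0" if "z \<in> hspace" "z \<notin> cbox a b" for z
      using zero[OF that] by (simp_all add: E_def)
  qed
  have sumE: "(\<Sum>v\<in>Basis. E v z) = deriv (u z) t / snd z * ?P z - u z t / snd z * ?G z"
    if z: "z \<in> hspace" for z
  proof -
    note y = hspace_pos[OF z]
    have p1: "snd z powr (2 - n) * (snd z powr (m + q)) = snd z powr q * snd z" for q
      using y by (simp add: m n_def flip: powr_add) (simp add: powr_add)
    have lapu: "deriv (u z) t = (snd z)\<^sup>2 * (\<Sum>v\<in>Basis. UU v z) - (n - 2) * snd z * (\<Sum>v\<in>Basis. snd v * U v z)"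
      using h z t unfolding hlaplacian_Basis n_def UU_def U_def by simp
    have "(\<Sum>v\<in>Basis. E v z) = (\<Sum>v\<in>Basis. snd z powr (2 - n) * (f0 z * UU v z) - snd z powr (2 - n) * (u z t * f2 v z)
      + ((2 - n) * snd z powr (2 - n) / snd z * (f0 z * (snd v * U v z)) - (2 - n) * snd z powr (2 - n) / snd z * (u z t * (snd v * f1 v z))))"
      unfolding E_def by (intro sum.cong) (auto simp: algebra_simps add_divide_distrib diff_divide_distrib)
    also have "\<dots> = snd z powr (2 - n) * (f0 z * (\<Sum>v\<in>Basis. UU v z)) - snd z powr (2 - n) * (u z t * (\<Sum>v\<in>Basis. f2 v z))
      + ((2 - n) * snd z powr (2 - n) / snd z * (f0 z * (\<Sum>v\<in>Basis. snd v * U v z)) - (2 - n) * snd z powr (2 - n) / snd z * (u z t * (\<Sum>v\<in>Basis. snd v * f1 v z)))"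
      by (simp only: sum.distrib sum_subtractf sum_distrib_left)
    also have "\<dots> = snd z powr (2 - n) / (snd z)\<^sup>2 * (f0 z * deriv (u z) t - u z t * (snd z powr m * ?G z))"
      unfolding lapu lap[OF z, symmetric] using y by (simp add: field_simps power2_eq_square)
    also have "\<dots> = deriv (u z) t / snd z * ?P z - u z t / snd z * ?G z"
    proof -
      have e1: "snd z powr (2 - n) * f0 z = snd z powr p * \<psi> (ch z) * snd z"
        unfolding f0_def s_def mult.assoc[symmetric] p1[of p] by simp
      have e2: "snd z powr (2 - n) * snd z powr m = snd z"
        using p1[of 0] y by simp
      have ring: "P * (F * d - w * (N * G)) = P * F * d - w * (P * N) * G" for P F d w N G :: real
        by (simp add: algebra_simps)
      have e3: "snd z powr (2 - n) * (f0 z * deriv (u z) t - u z t * (snd z powr m * ?G z))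
        = snd z powr p * \<psi> (ch z) * snd z * deriv (u z) t - u z t * snd z * ?G z"
        unfolding ring e1 e2 ..
      show ?thesis
        unfolding times_divide_eq_left e3 using y by (simp add: field_simps power2_eq_square)
    qed
    finally show ?thesis .
  qed
  have ut_cont: "continuous_on ({0<..} \<times> cbox a b) (\<lambda>(t, z). deriv (u z) t / snd z * ?P z)"
  proof -
    have "continuous_on (hspace \<times> {0<..}) (\<lambda>(z, t). deriv (u z) t)" using h by blast
    then have "continuous_on ({0<..} \<times> cbox a b) (\<lambda>x. (\<lambda>(z, t). deriv (u z) t) (snd x, fst x))"
      by (rule continuous_on_compose2) (use Q in \<open>auto intro!: continuous_intros\<close>)
    then have 1: "continuous_on ({0<..} \<times> cbox a b) (\<lambda>x. deriv (u (snd x)) (fst x))" by simp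
    have "continuous_on hspace (\<lambda>z::'m hpoint. snd z powr p * \<psi> (ch z) / snd z)"
      by (intro continuous_intros psi_cont; use hspace_pos in fastforce)
    then have 2: "continuous_on ({0<..} \<times> cbox a b) (\<lambda>x. (\<lambda>z. snd z powr p * \<psi> (ch z) / snd z) (snd x))"
      by (rule continuous_on_compose2) (use Q in \<open>auto intro!: continuous_intros\<close>)
    show ?thesis
      using continuous_on_mult[OF 1 2] by (simp add: case_prod_unfold mult_ac)
  qed
  have "((\<lambda>t. integral (cbox a b) (\<lambda>z. u z t / snd z * ?P z)) has_field_derivative
     integral (cbox a b) (\<lambda>z. deriv (u z) t / snd z * ?P z)) (at t within {0<..})"
  proof (rule leibniz_rule_field_derivative[OF _ _ ut_cont])
    fix t :: real and z :: "'m hpoint" assume t: "t \<in> {0<..}" and z: "z \<in> cbox a b"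
    have "u z differentiable (at t)" using h t z Q by auto
    then have "(u z has_real_derivative deriv (u z) t) (at t)"
      by (simp add: DERIV_deriv_iff_real_differentiable)
    from DERIV_cmult[OF this, of "?P z / snd z"]
    have "((\<lambda>t. u z t / snd z * ?P z) has_real_derivative deriv (u z) t / snd z * ?P z) (at t)"
      by (simp add: mult_ac)
    then show "((\<lambda>t. u z t / snd z * ?P z) has_field_derivative deriv (u z) t / snd z * ?P z) (at t within {0<..})"
      by (rule has_field_derivative_at_within)
  next
    fix t :: real assume t: "t \<in> {0<..}"
    have "continuous_on hspace (\<lambda>z. u z t / snd z * ?P z)"
      using t by (intro continuous_intros psi_cont u_cont) (use hspace_pos in fastforce)+
    then show "(\<lambda>z. u z t / snd z * ?P z) integrable_on cbox a b"
      by (intro integrable_continuous continuous_on_subset[OF _ Q])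
  qed (use t in auto)
  then have der: "((\<lambda>t. integral (cbox a b) (\<lambda>z. u z t / snd z * ?P z)) has_real_derivative
     integral (cbox a b) (\<lambda>z. deriv (u z) t / snd z * ?P z)) (at t)"
    using t by (simp add: at_within_open[of t "{0<..}"])
  have int: "(\<lambda>z. deriv (u z) t / snd z * ?P z) integrable_on cbox a b"
    "(\<lambda>z. u z t / snd z * ?G z) integrable_on cbox a b"
  proof -
    have "continuous_on (hspace \<times> {0<..}) (\<lambda>(z, t). deriv (u z) t)" using h by blast
    from slice[OF this t] have "continuous_on hspace (\<lambda>z. deriv (u z) t / snd z * ?P z)"
      by (intro continuous_intros psi_cont; use hspace_pos in fastforce)
    moreover have "continuous_on hspace (\<lambda>z. u z t / snd z * ?G z)"
      by (intro continuous_intros gen_cont u_cont[OF t]; use hspace_pos in fastforce)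
    ultimately show "(\<lambda>z. deriv (u z) t / snd z * ?P z) integrable_on cbox a b"
      "(\<lambda>z. u z t / snd z * ?G z) integrable_on cbox a b"
      by (auto intro!: integrable_continuous continuous_on_subset[OF _ Q])
  qed
  have "integral (cbox a b) (\<lambda>z. deriv (u z) t / snd z * ?P z) - integral (cbox a b) (\<lambda>z. u z t / snd z * ?G z)
     = integral (cbox a b) (\<lambda>z. deriv (u z) t / snd z * ?P z - u z t / snd z * ?G z)"
    by (rule integral_diff[symmetric, OF int])
  also have "\<dots> = integral (cbox a b) (\<lambda>z. \<Sum>v\<in>Basis. E v z)"
    by (rule integral_cong) (use sumE Q in auto)
  also have "\<dots> = (\<Sum>v\<in>Basis. integral (cbox a b) (E v))"
    by (rule integral_sum) (auto intro!: integrable_continuous continuous_on_subset[OF E_cont Q])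
  also have "\<dots> = 0" using E0 by simp
  finally show ?thesis using der by simp
qed

section \<open>Large deviations of the radial component\<close>


lemma ch_ginv: "z \<in> hspace \<Longrightarrow> ch (ginv z) = ch z"
  using hspace_pos[of z] by (simp add: ch_def ginv_def field_simps power2_eq_square)

lemma ch_horigin: "ch horigin = 1"
  by (simp add: ch_def horigin_def)

lemma hdist_horigin: "hdist horigin z = arcosh (ch z)"
  by (simp add: hdist_def ch_def horigin_def add_ac)

lemma ch_le_imp_cbox:
  fixes z :: "'m::finite hpoint"
  assumes z: "z \<in> hspace" and R: "0 < R" and le: "ch z \<le> R"
  shows "z \<in> cbox (- (2 * R) *\<^sub>R One, 1 / (2 * R)) ((2 * R) *\<^sub>R One, 2 * R)"
proof -
  obtain x y where xy: "z = (x, y)" by (cases z)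
  have y: "0 < y" using hspace_pos[OF z] xy by simp
  have ineq: "(norm x)\<^sup>2 + y\<^sup>2 + 1 \<le> 2 * R * y"
    using le y xy by (simp add: ch_def field_simps)
  have "y * y \<le> (2 * R) * y"
    using ineq zero_le_power2[of "norm x"] unfolding power2_eq_square[of y] by linarith
  then have y2: "y \<le> 2 * R" using y by simp
  have "1 \<le> 2 * R * y" using ineq zero_le_power2[of "norm x"] zero_le_power2[of y] by linarith
  then have y1: "1 / (2 * R) \<le> y" using R by (simp add: field_simps)
  have "(norm x)\<^sup>2 \<le> 2 * R * y" using ineq zero_le_power2[of y] by linarith
  also have "\<dots> \<le> 2 * R * (2 * R)" using y2 R by (intro mult_left_mono) auto
  finally have "(norm x)\<^sup>2 \<le> (2 * R)\<^sup>2" by (simp add: power2_eq_square)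
  then have nx: "norm x \<le> 2 * R" by (rule power2_le_imp_le) (use R in simp)
  have "x \<in> cbox (- (2 * R) *\<^sub>R One) ((2 * R) *\<^sub>R One)"
    unfolding mem_box
  proof
    fix i :: "real ^ 'm" assume i: "i \<in> Basis"
    have "\<bar>x \<bullet> i\<bar> \<le> 2 * R" using Basis_le_norm[OF i, of x] nx by linarith
    then show "(- (2 * R) *\<^sub>R One) \<bullet> i \<le> x \<bullet> i \<and> x \<bullet> i \<le> ((2 * R) *\<^sub>R One) \<bullet> i"
      using i by (auto simp: abs_le_iff)
  qed
  then show ?thesis using y1 y2 by (simp add: xy cbox_Pair_eq)
qed

lemma cbox_subset_hspace:
  assumes "0 < R"
  shows "cbox (a, 1 / (2 * R)) (b, c) \<subseteq> (hspace :: 'm::finite hpoint set)"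
proof
  fix z :: "'m hpoint" assume "z \<in> cbox (a, 1 / (2 * R)) (b, c)"
  then have "1 / (2 * R) \<le> snd z" by (auto simp: cbox_Pair_eq)
  moreover have "0 < 1 / (2 * R)" using assms by simp
  ultimately show "z \<in> hspace" unfolding hspace_def mem_Collect_eq by linarith
qed

lemma integral_hvolume:
  fixes g :: "'m::finite hpoint \<Rightarrow> real"
  assumes "continuous_on hspace g"
  shows "(LINT z|hvolume. g z) = (LINT z|lborel. indicator hspace z * (1 / snd z ^ hdim TYPE('m) * g z))"
proof -
  have "g \<in> borel_measurable (restrict_space lborel hspace)"
    using borel_measurable_continuous_on_restrict[OF assms]
    by (simp cong: measurable_cong_sets add: sets_restrict_space)
  moreover have "(\<lambda>z::'m hpoint. 1 / snd z ^ hdim TYPE('m)) \<in> borel_measurable (restrict_space lborel hspace)"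
    by (rule measurable_restrict_space1) measurable
  moreover have "AE z in restrict_space lborel (hspace :: 'm hpoint set). 0 \<le> 1 / snd z ^ hdim TYPE('m)"
    by (intro AE_I2) (auto simp: space_restrict_space hspace_def)
  ultimately have "(LINT z|hvolume. g z) = (LINT z|restrict_space lborel hspace. (1 / snd z ^ hdim TYPE('m)) *\<^sub>R g z)"
    unfolding hvolume_def by (rule integral_density)
  also have "\<dots> = (LINT z|lborel. indicator hspace z *\<^sub>R ((1 / snd z ^ hdim TYPE('m)) *\<^sub>R g z))"
    by (rule integral_restrict_space) (simp add: sets_hspace)
  finally show ?thesis by simp
qed

lemma fundamental_solution_heat_kernel:
  "hyperbolic_brownian_motion k a M Z \<Longrightarrow> w \<in> hspace \<Longrightarrow> fundamental_solution w (\<lambda>z. k z w)"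
  unfolding hyperbolic_brownian_motion_def heat_kernel_def by blast

lemma expectation_cbox:
  fixes k :: "'m::finite hpoint \<Rightarrow> 'm hpoint \<Rightarrow> real \<Rightarrow> real"
  assumes bm: "hyperbolic_brownian_motion k horigin M Z" and t: "0 < t"
    and h: "continuous_on hspace h" and Q: "cbox a b \<subseteq> hspace"
    and zero: "\<And>z. z \<in> hspace \<Longrightarrow> z \<notin> cbox a b \<Longrightarrow> h z = 0"
  shows "(LINT \<omega>|M. h (ginv (Z t \<omega>))) = integral (cbox a b) (\<lambda>z. k z horigin t / snd z * h z)"
proof -
  have "(\<lambda>z. indicator hspace z *\<^sub>R h z) \<in> borel_measurable borel"
    by (rule borel_measurable_continuous_on_indicator[OF sets_hspace h])
  then have m: "(\<lambda>z. indicator hspace z * h z) \<in> borel_measurable borel" by simp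
  have heat: "heat_solution (\<lambda>z. k z horigin)"
    using fundamental_solution_heat_kernel[OF bm horigin_in_hspace] by (simp add: fundamental_solution_def)
  have Zh: "Z t \<omega> \<in> hspace" if "\<omega> \<in> space M" for \<omega>
    using bm t that by (simp add: hyperbolic_brownian_motion_def)
  have "(LINT \<omega>|M. h (ginv (Z t \<omega>))) = (LINT \<omega>|M. indicator hspace (ginv (Z t \<omega>)) * h (ginv (Z t \<omega>)))"
    by (rule Bochner_Integration.integral_cong) (use ginv_in_hspace[OF Zh] in auto)
  also have "\<dots> = (LINT z|lborel. indicator hspace z * k z horigin t / snd z * (indicator hspace z * h z))"
    by (rule expectation_ginv_hyperbolic_brownian_motion[OF bm t m])
  also have "\<dots> = (LINT z|lborel. indicator (cbox a b) z * (k z horigin t / snd z * h z))"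
    by (rule Bochner_Integration.integral_cong) (use zero Q in \<open>auto simp: indicator_def\<close>)
  also have "\<dots> = integral (cbox a b) (\<lambda>z. k z horigin t / snd z * h z)"
  proof (rule integral_lborel_cbox, rule continuous_on_subset[OF _ Q])
    show "continuous_on hspace (\<lambda>z. k z horigin t / snd z * h z)"
      by (intro continuous_intros heat_solution_continuous_on[OF heat t] h; use hspace_pos in fastforce)
  qed
  finally show ?thesis .
qed

text \<open>
  Expectations of test functions along the inverted motion are integrals of the heat kernel with pole O
  over a box in the half-space. Their limit at time 0 is the initial condition of the fundamental
  solution for the bounded function y^(m + p) \<psi>(c).
\<close>

lemma radial_diffusion_hyperbolic_brownian_motion:
  fixes k :: "'m::finite hpoint \<Rightarrow> 'm hpoint \<Rightarrow> real \<Rightarrow> real"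
  assumes bm: "hyperbolic_brownian_motion k horigin M Z"
  shows "radial_diffusion M (\<lambda>t \<omega>. snd (ginv (Z t \<omega>))) (\<lambda>t \<omega>. ch (ginv (Z t \<omega>))) (real (hdim TYPE('m)) - 1)"
    (is "radial_diffusion M ?Y ?C ?m")
proof -
  note bm' = bm[unfolded hyperbolic_brownian_motion_def]
  interpret prob_space M using bm' by blast
  have fund: "fundamental_solution horigin (\<lambda>z. k z horigin)"
    by (rule fundamental_solution_heat_kernel[OF bm horigin_in_hspace])
  have heat: "heat_solution (\<lambda>z. k z horigin)"
    using fund by (simp add: fundamental_solution_def)
  have Zm: "Z t \<in> borel_measurable M" and Zh: "\<omega> \<in> space M \<Longrightarrow> ginv (Z t \<omega>) \<in> hspace" if "0 < t" for t \<omega>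
    using bm' that by (auto intro!: ginv_in_hspace)
  have ch_meas[measurable]: "(ch :: 'm hpoint \<Rightarrow> real) \<in> borel_measurable borel"
    unfolding ch_def by measurable
  show ?thesis
  proof unfold_locales
    show "0 \<le> ?m" by (simp add: hdim_def)
    show "?Y t \<in> borel_measurable M" "?C t \<in> borel_measurable M" if "0 < t" for t
      using Zm[OF that] by measurable
    show "0 < ?Y t \<omega>" "?Y t \<omega> + 1 / ?Y t \<omega> \<le> 2 * ?C t \<omega>" if "0 < t" "\<omega> \<in> space M" for t \<omega>
      using hspace_pos[OF Zh[OF that]] ch_sum_le[OF Zh[OF that]] by auto
  next
    fix R :: real and \<psi> \<psi>1 \<psi>2 :: "real \<Rightarrow> real" and p :: real
    assume "radial_test R \<psi> \<psi>1 \<psi>2"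
    then have rt: "radial_test (max R 1) \<psi> \<psi>1 \<psi>2" by (auto simp: radial_test_def)
    define S where "S = max R 1"
    have S: "0 < S" by (simp add: S_def)
    define a b :: "'m hpoint" where "a = (- (2 * S) *\<^sub>R One, 1 / (2 * S))" and "b = ((2 * S) *\<^sub>R One, 2 * S)"
    have Q: "cbox a b \<subseteq> hspace" unfolding a_def b_def by (rule cbox_subset_hspace[OF S])
    have supp: "z \<in> cbox a b" if "z \<in> hspace" "ch z \<le> S" for z
      unfolding a_def b_def by (rule ch_le_imp_cbox[OF that(1) S that(2)])
    note rt = rt[folded S_def]
    have zero: "\<psi> (ch z) = 0" "\<psi>1 (ch z) = 0" "\<psi>2 (ch z) = 0" if "z \<in> hspace" "z \<notin> cbox a b" for z
    proof -
      have "S \<le> ch z" using supp[OF that(1)] that(2) by force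
      then show "\<psi> (ch z) = 0" "\<psi>1 (ch z) = 0" "\<psi>2 (ch z) = 0" using rt by (auto simp: radial_test_def)
    qed
    have E: "expectation (\<lambda>\<omega>. ?Y t \<omega> powr p * \<psi> (?C t \<omega>)) = integral (cbox a b) (\<lambda>z. k z horigin t / snd z * (snd z powr p * \<psi> (ch z)))"
      if "0 < t" for t
      by (rule expectation_cbox[OF bm that continuous_on_radial(4)[OF rt] Q]) (simp add: zero)
    have EG: "expectation (\<lambda>\<omega>. radial_gen ?m p \<psi> \<psi>1 \<psi>2 (?Y t \<omega>) (?C t \<omega>))
        = integral (cbox a b) (\<lambda>z. k z horigin t / snd z * radial_gen ?m p \<psi> \<psi>1 \<psi>2 (snd z) (ch z))"
      if "0 < t" for t
      by (rule expectation_cbox[OF bm that continuous_on_radial(5)[OF rt] Q]) (simp add: zero radial_gen_def)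
    show "((\<lambda>t. expectation (\<lambda>\<omega>. ?Y t \<omega> powr p * \<psi> (?C t \<omega>))) has_real_derivative
        expectation (\<lambda>\<omega>. radial_gen ?m p \<psi> \<psi>1 \<psi>2 (?Y t \<omega>) (?C t \<omega>))) (at t)" if t: "0 < t" for t
    proof -
      have "eventually (\<lambda>t. t \<in> {0<..}) (nhds t)"
        by (rule eventually_nhds_in_open) (use t in auto)
      then have "eventually (\<lambda>t. integral (cbox a b) (\<lambda>z. k z horigin t / snd z * (snd z powr p * \<psi> (ch z)))
          = expectation (\<lambda>\<omega>. ?Y t \<omega> powr p * \<psi> (?C t \<omega>))) (nhds t)"
        by eventually_elim (simp add: E)
      from DERIV_cong_ev[OF refl this refl] show ?thesis
        using weak_heat_equation[OF heat rt t Q supp refl, of p] unfolding EG[OF t] by blast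
    qed
    define f where "f z = snd z powr (?m + p) * \<psi> (ch z)" for z :: "'m hpoint"
    have f_cont: "continuous_on hspace f"
      unfolding f_def by (rule continuous_on_radial(4)[OF rt])
    have "bounded (f ` hspace)"
    proof -
      have "bounded (insert 0 (f ` cbox a b))"
        using continuous_on_subset[OF f_cont Q] by (simp add: compact_imp_bounded compact_continuous_image)
      moreover have "f ` hspace \<subseteq> insert 0 (f ` cbox a b)"
      proof (rule image_subsetI)
        fix z :: "'m hpoint" assume z: "z \<in> hspace"
        show "f z \<in> insert 0 (f ` cbox a b)"
          using zero(1)[OF z] by (cases "z \<in> cbox a b") (simp_all add: f_def)
      qed
      ultimately show ?thesis by (rule bounded_subset)
    qed
    then have lim: "((\<lambda>t. LINT z|hvolume. k z horigin t * f z) \<longlongrightarrow> f horigin) (at_right 0)"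
      using fund f_cont by (simp add: fundamental_solution_def)
    have f0: "f horigin = \<psi> 1"
      by (simp add: f_def ch_horigin) (simp add: horigin_def)
    have "(LINT z|hvolume. k z horigin t * f z) = expectation (\<lambda>\<omega>. ?Y t \<omega> powr p * \<psi> (?C t \<omega>))" if t: "0 < t" for t
    proof -
      have k_cont: "continuous_on hspace (\<lambda>z. k z horigin t)" by (rule heat_solution_continuous_on[OF heat t])
      have "(LINT z|hvolume. k z horigin t * f z) = (LINT z|lborel. indicator hspace z * (1 / snd z ^ hdim TYPE('m) * (k z horigin t * f z)))"
        by (rule integral_hvolume) (intro continuous_intros k_cont f_cont)
      also have "\<dots> = (LINT z|lborel. indicator (cbox a b) z * (k z horigin t / snd z * (snd z powr p * \<psi> (ch z))))"
      proof (rule Bochner_Integration.integral_cong)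
        fix z :: "'m hpoint"
        show "indicator hspace z * (1 / snd z ^ hdim TYPE('m) * (k z horigin t * f z)) = indicator (cbox a b) z * (k z horigin t / snd z * (snd z powr p * \<psi> (ch z)))"
        proof (cases "z \<in> cbox a b")
          case True
          then have z: "z \<in> hspace" using Q by blast
          note y = hspace_pos[OF z]
          have "snd z powr (?m + p) = snd z ^ hdim TYPE('m) / snd z * snd z powr p"
            using y by (simp add: powr_add powr_diff powr_realpow)
          then show ?thesis using True z y by (simp add: f_def)
        next
          case False
          then show ?thesis using zero(1)[of z] by (cases "z \<in> hspace") (auto simp: f_def)
        qed
      qed simp
      also have "\<dots> = integral (cbox a b) (\<lambda>z. k z horigin t / snd z * (snd z powr p * \<psi> (ch z)))"
      proof (rule integral_lborel_cbox, rule continuous_on_subset[OF _ Q])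
        show "continuous_on hspace (\<lambda>z. k z horigin t / snd z * (snd z powr p * \<psi> (ch z)))"
          by (intro continuous_on_mult continuous_on_divide k_cont continuous_on_radial(4)[OF rt] continuous_intros; use hspace_pos in fastforce)
      qed
      finally show ?thesis by (simp add: E[OF t])
    qed
    then have "eventually (\<lambda>t. (LINT z|hvolume. k z horigin t * f z) = expectation (\<lambda>\<omega>. ?Y t \<omega> powr p * \<psi> (?C t \<omega>))) (at_right 0)"
      by (intro eventually_mono[OF eventually_at_right_less[of 0]])
    from Lim_transform_eventually[OF lim this]
    show "((\<lambda>t. expectation (\<lambda>\<omega>. ?Y t \<omega> powr p * \<psi> (?C t \<omega>))) \<longlongrightarrow> \<psi> 1) (at_right 0)"
      by (simp only: f0)
  qed
qed

lemma large_deviation_principle_cong: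
  assumes eq: "\<And>t \<omega>. 0 < t \<Longrightarrow> \<omega> \<in> space M \<Longrightarrow> X t \<omega> = X' t \<omega>"
    and X: "large_deviation_principle M X v I"
  shows "large_deviation_principle M X' v I"
proof -
  have meas: "X' t \<in> borel_measurable M \<longleftrightarrow> X t \<in> borel_measurable M" if "0 < t" for t
    by (rule measurable_cong) (simp add: eq[OF that])
  have ev: "eventually (\<lambda>t. ereal (1 / v t) * elog (measure M {\<omega> \<in> space M. X t \<omega> \<in> A})
      = ereal (1 / v t) * elog (measure M {\<omega> \<in> space M. X' t \<omega> \<in> A})) at_top" for A
    using eventually_gt_at_top[of "0::real"]
  proof eventually_elim
    case (elim t)
    have "{\<omega> \<in> space M. X t \<omega> \<in> A} = {\<omega> \<in> space M. X' t \<omega> \<in> A}" using eq[OF elim] by auto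
    then show ?case by simp
  qed
  show ?thesis
    using X unfolding large_deviation_principle_def
    by (simp add: meas Limsup_eq[OF ev] Liminf_eq[OF ev])
qed

theorem proposition3p2:
  fixes n :: nat
    and k :: "'m::finite hpoint \<Rightarrow> 'm hpoint \<Rightarrow> real \<Rightarrow> real"
    and M :: "'w measure"
    and Z :: "real \<Rightarrow> 'w \<Rightarrow> 'm hpoint"
  assumes "n \<ge> 2" and "hdim TYPE('m) = n"
    and "hyperbolic_brownian_motion k horigin M Z"
  shows "large_deviation_principle M (\<lambda>t \<omega>. radial_component Z t \<omega> / t) (\<lambda>t. t) (I1 n)
    \<and> good_rate_function (I1 n)"
proof
  interpret radial_diffusion M "\<lambda>t \<omega>. snd (ginv (Z t \<omega>))" "\<lambda>t \<omega>. ch (ginv (Z t \<omega>))" "real n - 1"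
    using radial_diffusion_hyperbolic_brownian_motion[OF assms(3)] by (simp only: assms(2))
  show "large_deviation_principle M (\<lambda>t \<omega>. radial_component Z t \<omega> / t) (\<lambda>t. t) (I1 n)"
  proof (rule large_deviation_principle_cong[OF _ large_deviation_principle_D[OF refl]])
    fix t :: real and \<omega> assume "0 < t" "\<omega> \<in> space M"
    then have "Z t \<omega> \<in> hspace"
      using assms(3) by (simp add: hyperbolic_brownian_motion_def)
    then show "arcosh (ch (ginv (Z t \<omega>))) / t = radial_component Z t \<omega> / t"
      by (simp add: ch_ginv radial_component_def hdist_horigin)
  qed
  show "good_rate_function (I1 n)" by (rule good_rate_function_I1)
qed

end
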